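(* Let $\underline{\mathcal C}$ be a $G$-$A$-coring with left dual graded ring $R$. There is a functor $F_4:\mathcal M^{\underline{\mathcal C}}\to\mathcal M_R$, given by $F_4(M)=M$ with right $R$-action $m\cdot f=\sum_{\alpha\in G}m_{[0]}f_\alpha(m_{[1,\alpha^{-1}]})$ for $f=\sum_\alpha f_\alpha$ with $f_\alpha\in R_\alpha$, and $F_4(f)=f$ on morphisms. The functor $F_4$ is an equivalence of categories if $\underline{\mathcal C}$ is left homogeneously finite and $G$ is a finite group.
   Context: $G$ is a group with unit $e$, $A$ is a ring with unit. A $G$-$A$-coring (group coring) $\underline{\mathcal C}$ is a family $(\mathcal C_\alpha)_{\alpha\in G}$ of $A$-bimodules with $A$-bimodule maps $\Delta_{\alpha,\beta}:\mathcal C_{\alpha\beta}\to\mathcal C_\alpha\otimes_A\mathcal C_\beta$, written $\Delta_{\alpha,\beta}(c)=c_{(1,\alpha)}\otimes_Ac_{(2,\beta)}$, and $\varepsilon:\mathcal C_e\to A$ such that, for all $\alpha,\beta,\gamma\in G$, $(\Delta_{\alpha,\beta}\otimes_A\mathcal C_\gamma)\circ\Delta_{\alpha\beta,\gamma}=(\mathcal C_\alpha\otimes_A\Delta_{\beta,\gamma})\circ\Delta_{\alpha,\beta\gamma}$ and $(\mathcal C_\alpha\otimes_A\varepsilon)\circ\Delta_{\alpha,e}=\mathcal C_\alpha=(\varepsilon\otimes_A\mathcal C_\alpha)\circ\Delta_{e,\alpha}$ (an object also denotes its identity map). $\underline{\mathcal C}$ is left homogeneously finite if every $\mathcal C_\alpha$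 is finitely generated and projective as a left $A$-module. A right $\underline{\mathcal C}$-comodule is a right $A$-module $M$ with right $A$-linear maps $\rho_\alpha:M\to M\otimes_A\mathcal C_\alpha$, written $\rho_\alpha(m)=m_{[0]}\otimes_Am_{[1,\alpha]}$, such that $(M\otimes_A\Delta_{\alpha,\beta})\circ\rho_{\alpha\beta}=(\rho_\alpha\otimes_A\mathcal C_\beta)\circ\rho_\beta$ and $(M\otimes_A\varepsilon)\circ\rho_e=M$. Morphisms are right $A$-linear maps $f$ with $(f\otimes_A\mathcal C_\alpha)\circ\rho_\alpha=\rho_\alpha\circ f$ for all $\alpha$. The category is $\mathcal M^{\underline{\mathcal C}}$. The left dual graded ring of $\underline{\mathcal C}$ is $R={}^*\underline{\mathcal C}=\bigoplus_{\alpha\in G}R_\alpha$, $R_\alpha={}_A\mathrm{Hom}(\mathcal C_{\alpha^{-1}},A)$ (left $A$-linear maps), with $A$-bimodule structure $(a\cdot f\cdot b)(c)=f(ca)b$, multiplication $(f\#g)(c)=g(c_{(1,\beta^{-1})}f(c_{(2,\alpha^{-1})}))$ for $f\in R_\alpha$, $g\in R_\beta$, $c\in\mathcal C_{(\alpha\beta)^{-1}}$, and unit $\varepsilon\in R_e$. $\mathcal M_R$ is the category of right $R$-modules. *)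

theory Defs
  imports "HOL-Algebra.Ring" "HOL-Algebra.Free_Abelian_Groups"
begin

section \<open>Modules and bimodules over a ring that need not be commutative\<close>

text \<open>As for the record \<open>module\<close> of HOL-Algebra, the fields \<open>mult\<close> and \<open>one\<close>
  inherited from \<open>ring\<close> carry no meaning in the module records below.\<close>

record ('a, 'm) rmodule = "'m ring" +
  ract :: "'m \<Rightarrow> 'a \<Rightarrow> 'm"  (infixl \<open>\<triangleleft>\<index>\<close> 70)

record ('a, 'm) bimodule = "('a, 'm) rmodule" +
  lact :: "'a \<Rightarrow> 'm \<Rightarrow> 'm"  (infixr \<open>\<triangleright>\<index>\<close> 70)

locale right_module = A?: ring A + M?: abelian_group M
  for A :: "('a, 'x) ring_scheme" (structure)
    and M :: "('a, 'm, 'y) rmodule_scheme" (structure) +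
  assumes ract_closed: "\<lbrakk>m \<in> carrier M; a \<in> carrier A\<rbrakk> \<Longrightarrow> m \<triangleleft>\<^bsub>M\<^esub> a \<in> carrier M"
    and ract_add: "\<lbrakk>m \<in> carrier M; n \<in> carrier M; a \<in> carrier A\<rbrakk>
      \<Longrightarrow> (m \<oplus>\<^bsub>M\<^esub> n) \<triangleleft>\<^bsub>M\<^esub> a = m \<triangleleft>\<^bsub>M\<^esub> a \<oplus>\<^bsub>M\<^esub> n \<triangleleft>\<^bsub>M\<^esub> a"
    and ract_add_scalar: "\<lbrakk>m \<in> carrier M; a \<in> carrier A; b \<in> carrier A\<rbrakk>
      \<Longrightarrow> m \<triangleleft>\<^bsub>M\<^esub> (a \<oplus>\<^bsub>A\<^esub> b) = m \<triangleleft>\<^bsub>M\<^esub> a \<oplus>\<^bsub>M\<^esub> m \<triangleleft>\<^bsub>M\<^esub> b"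
    and ract_assoc: "\<lbrakk>m \<in> carrier M; a \<in> carrier A; b \<in> carrier A\<rbrakk>
      \<Longrightarrow> (m \<triangleleft>\<^bsub>M\<^esub> a) \<triangleleft>\<^bsub>M\<^esub> b = m \<triangleleft>\<^bsub>M\<^esub> (a \<otimes>\<^bsub>A\<^esub> b)"
    and ract_one: "m \<in> carrier M \<Longrightarrow> m \<triangleleft>\<^bsub>M\<^esub> \<one>\<^bsub>A\<^esub> = m"

locale abimodule = right_module A M
  for A :: "('a, 'x) ring_scheme" (structure)
    and M :: "('a, 'm, 'y) bimodule_scheme" (structure) +
  assumes lact_closed: "\<lbrakk>a \<in> carrier A; m \<in> carrier M\<rbrakk> \<Longrightarrow> a \<triangleright>\<^bsub>M\<^esub> m \<in> carrier M"
    and lact_add: "\<lbrakk>a \<in> carrier A; m \<in> carrier M; n \<in> carrier M\<rbrakk>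
      \<Longrightarrow> a \<triangleright>\<^bsub>M\<^esub> (m \<oplus>\<^bsub>M\<^esub> n) = (a \<triangleright>\<^bsub>M\<^esub> m) \<oplus>\<^bsub>M\<^esub> (a \<triangleright>\<^bsub>M\<^esub> n)"
    and lact_add_scalar: "\<lbrakk>a \<in> carrier A; b \<in> carrier A; m \<in> carrier M\<rbrakk>
      \<Longrightarrow> (a \<oplus>\<^bsub>A\<^esub> b) \<triangleright>\<^bsub>M\<^esub> m = (a \<triangleright>\<^bsub>M\<^esub> m) \<oplus>\<^bsub>M\<^esub> (b \<triangleright>\<^bsub>M\<^esub> m)"
    and lact_assoc: "\<lbrakk>a \<in> carrier A; b \<in> carrier A; m \<in> carrier M\<rbrakk>
      \<Longrightarrow> a \<triangleright>\<^bsub>M\<^esub> (b \<triangleright>\<^bsub>M\<^esub> m) = (a \<otimes>\<^bsub>A\<^esub> b) \<triangleright>\<^bsub>M\<^esub> m"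
    and lact_one: "m \<in> carrier M \<Longrightarrow> \<one>\<^bsub>A\<^esub> \<triangleright>\<^bsub>M\<^esub> m = m"
    and lact_ract: "\<lbrakk>a \<in> carrier A; m \<in> carrier M; b \<in> carrier A\<rbrakk>
      \<Longrightarrow> (a \<triangleright>\<^bsub>M\<^esub> m) \<triangleleft>\<^bsub>M\<^esub> b = a \<triangleright>\<^bsub>M\<^esub> (m \<triangleleft>\<^bsub>M\<^esub> b)"

definition right_linear ::
  "('a, 'x) ring_scheme \<Rightarrow> ('a, 'm, 'y) rmodule_scheme \<Rightarrow> ('a, 'n, 'z) rmodule_scheme \<Rightarrow> ('m \<Rightarrow> 'n) set"
  where "right_linear A M N =
    {f \<in> hom (add_monoid M) (add_monoid N).
      \<forall>m \<in> carrier M. \<forall>a \<in> carrier A. f (m \<triangleleft>\<^bsub>M\<^esub> a) = f m \<triangleleft>\<^bsub>N\<^esub> a}"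

definition left_linear ::
  "('a, 'x) ring_scheme \<Rightarrow> ('a, 'm, 'y) bimodule_scheme \<Rightarrow> ('a, 'n, 'z) bimodule_scheme \<Rightarrow> ('m \<Rightarrow> 'n) set"
  where "left_linear A M N =
    {f \<in> hom (add_monoid M) (add_monoid N).
      \<forall>m \<in> carrier M. \<forall>a \<in> carrier A. f (a \<triangleright>\<^bsub>M\<^esub> m) = a \<triangleright>\<^bsub>N\<^esub> f m}"

definition regular_bimodule :: "('a, 'x) ring_scheme \<Rightarrow> ('a, 'a) bimodule"
  where "regular_bimodule A =
    \<lparr>carrier = carrier A, monoid.mult = monoid.mult A, one = one A, ring.zero = ring.zero A, ring.add = ring.add A,
     ract = monoid.mult A, lact = monoid.mult A\<rparr>"

definition free_bimodule :: "('a, 'x) ring_scheme \<Rightarrow> 'i set \<Rightarrow> ('a, 'i \<Rightarrow> 'a) bimodule"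
  where "free_bimodule A I =
    \<lparr>carrier = {x \<in> I \<rightarrow>\<^sub>E carrier A. finite {i \<in> I. x i \<noteq> \<zero>\<^bsub>A\<^esub>}},
     monoid.mult = undefined, one = undefined,
     ring.zero = (\<lambda>i \<in> I. \<zero>\<^bsub>A\<^esub>), ring.add = (\<lambda>x y. \<lambda>i \<in> I. x i \<oplus>\<^bsub>A\<^esub> y i),
     ract = (\<lambda>x a. \<lambda>i \<in> I. x i \<otimes>\<^bsub>A\<^esub> a), lact = (\<lambda>a x. \<lambda>i \<in> I. a \<otimes>\<^bsub>A\<^esub> x i)\<rparr>"

definition finitely_generated_left ::
  "('a, 'x) ring_scheme \<Rightarrow> ('a, 'm, 'y) bimodule_scheme \<Rightarrow> bool"
  where "finitely_generated_left A P \<longleftrightarrow>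
    (\<exists>S. finite S \<and> S \<subseteq> carrier P \<and>
      (\<forall>p \<in> carrier P. \<exists>a \<in> S \<rightarrow> carrier A. p = (\<Oplus>\<^bsub>P\<^esub>s\<in>S. a s \<triangleright>\<^bsub>P\<^esub> s)))"

text \<open>A left module is projective if it is (isomorphic to) a direct summand of a free left module.
  It is no restriction to draw the basis \<open>I\<close> from the type of the elements of \<open>P\<close>: a summand of any
  free module is also a summand of the free module on its own underlying set.\<close>

definition projective_left ::
  "('a, 'x) ring_scheme \<Rightarrow> ('a, 'm, 'y) bimodule_scheme \<Rightarrow> bool"
  where "projective_left A P \<longleftrightarrow>
    (\<exists>(I :: 'm set) i p. i \<in> left_linear A P (free_bimodule A I) \<and>
       p \<in> left_linear A (free_bimodule A I) P \<and> (\<forall>x \<in> carrier P. p (i x) = x))"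


section \<open>Tensor products over a ring\<close>

text \<open>The tensor product of \<open>M\<close> and \<open>N\<close> over \<open>A\<close> is the free abelian group on the pairs \<open>(m, n)\<close>,
  modulo the subgroup generated by the expressions that make \<open>(m, n) \<mapsto> m \<otimes> n\<close> biadditive
  and \<open>A\<close>-balanced. Its elements are cosets. The library writes free abelian groups and
  their quotients multiplicatively; \<open>tensor_group\<close> turns the result into an additive structure.\<close>

type_synonym ('m, 'n) tensor = "(('m \<times> 'n) \<Rightarrow>\<^sub>0 int) set"

definition tensor_relations ::
  "('a, 'x) ring_scheme \<Rightarrow> ('a, 'm, 'y) rmodule_scheme \<Rightarrow> ('a, 'n, 'z) bimodule_scheme
    \<Rightarrow> (('m \<times> 'n) \<Rightarrow>\<^sub>0 int) set"
  where "tensor_relations A M N =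
    {frag_of (m \<oplus>\<^bsub>M\<^esub> m', n) - frag_of (m, n) - frag_of (m', n) | m m' n.
       m \<in> carrier M \<and> m' \<in> carrier M \<and> n \<in> carrier N} \<union>
    {frag_of (m, n \<oplus>\<^bsub>N\<^esub> n') - frag_of (m, n) - frag_of (m, n') | m n n'.
       m \<in> carrier M \<and> n \<in> carrier N \<and> n' \<in> carrier N} \<union>
    {frag_of (m \<triangleleft>\<^bsub>M\<^esub> a, n) - frag_of (m, a \<triangleright>\<^bsub>N\<^esub> n) | m a n.
       m \<in> carrier M \<and> a \<in> carrier A \<and> n \<in> carrier N}"

definition tensor_kernel ::
  "('a, 'x) ring_scheme \<Rightarrow> ('a, 'm, 'y) rmodule_scheme \<Rightarrow> ('a, 'n, 'z) bimodule_scheme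
    \<Rightarrow> (('m \<times> 'n) \<Rightarrow>\<^sub>0 int) set"
  where "tensor_kernel A M N =
    generate (free_Abelian_group (carrier M \<times> carrier N)) (tensor_relations A M N)"

definition tensor_quotient ::
  "('a, 'x) ring_scheme \<Rightarrow> ('a, 'm, 'y) rmodule_scheme \<Rightarrow> ('a, 'n, 'z) bimodule_scheme
    \<Rightarrow> ('m, 'n) tensor monoid"
  where "tensor_quotient A M N =
    free_Abelian_group (carrier M \<times> carrier N) Mod tensor_kernel A M N"

definition tensor_group ::
  "('a, 'x) ring_scheme \<Rightarrow> ('a, 'm, 'y) rmodule_scheme \<Rightarrow> ('a, 'n, 'z) bimodule_scheme
    \<Rightarrow> ('m, 'n) tensor ring"
  where "tensor_group A M N =
    \<lparr>carrier = carrier (tensor_quotient A M N), monoid.mult = undefined, one = undefined,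
     ring.zero = \<one>\<^bsub>tensor_quotient A M N\<^esub>, ring.add = monoid.mult (tensor_quotient A M N)\<rparr>"

definition pure_tensor ::
  "('a, 'x) ring_scheme \<Rightarrow> ('a, 'm, 'y) rmodule_scheme \<Rightarrow> ('a, 'n, 'z) bimodule_scheme
    \<Rightarrow> 'm \<Rightarrow> 'n \<Rightarrow> ('m, 'n) tensor"
  where "pure_tensor A M N m n =
    tensor_kernel A M N #>\<^bsub>free_Abelian_group (carrier M \<times> carrier N)\<^esub> frag_of (m, n)"

text \<open>For \<open>\<beta>\<close> biadditive and balanced with values in the abelian group \<open>P\<close>, \<open>tensor_lift P \<beta>\<close>
  is the additive map with \<open>m \<otimes> n \<mapsto> \<beta> m n\<close>: the linear extension of \<open>\<beta>\<close> to formal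
  combinations takes a single value on each coset.\<close>

definition tensor_lift ::
  "('p, 'x) ring_scheme \<Rightarrow> ('m \<Rightarrow> 'n \<Rightarrow> 'p) \<Rightarrow> ('m, 'n) tensor \<Rightarrow> 'p"
  where "tensor_lift P \<beta> t =
    the_elem ((\<lambda>u. \<Oplus>\<^bsub>P\<^esub>z\<in>Poly_Mapping.keys u. [Poly_Mapping.lookup u z] \<cdot>\<^bsub>P\<^esub> \<beta> (fst z) (snd z)) ` t)"

definition tensor_rmodule ::
  "('a, 'x) ring_scheme \<Rightarrow> ('a, 'm, 'y) rmodule_scheme \<Rightarrow> ('a, 'n, 'z) bimodule_scheme
    \<Rightarrow> ('a, ('m, 'n) tensor) rmodule"
  where "tensor_rmodule A M N =
    (let T = tensor_group A M N in
     \<lparr>carrier = carrier T, monoid.mult = monoid.mult T, one = one T, ring.zero = ring.zero T, ring.add = ring.add T,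
      ract = (\<lambda>t a. tensor_lift T (\<lambda>m n. pure_tensor A M N m (n \<triangleleft>\<^bsub>N\<^esub> a)) t)\<rparr>)"

definition tensor_bimodule ::
  "('a, 'x) ring_scheme \<Rightarrow> ('a, 'm, 'y) bimodule_scheme \<Rightarrow> ('a, 'n, 'z) bimodule_scheme
    \<Rightarrow> ('a, ('m, 'n) tensor) bimodule"
  where "tensor_bimodule A M N =
    (let T = tensor_group A M N in
     \<lparr>carrier = carrier T, monoid.mult = monoid.mult T, one = one T, ring.zero = ring.zero T, ring.add = ring.add T,
      ract = (\<lambda>t a. tensor_lift T (\<lambda>m n. pure_tensor A M N m (n \<triangleleft>\<^bsub>N\<^esub> a)) t),
      lact = (\<lambda>a t. tensor_lift T (\<lambda>m n. pure_tensor A M N (a \<triangleright>\<^bsub>M\<^esub> m) n) t)\<rparr>)"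

text \<open>\<open>tensor_map A M' N' f g\<close> is the map \<open>f \<otimes> g\<close> with values in the tensor product of \<open>M'\<close> and
  \<open>N'\<close>.\<close>

definition tensor_map ::
  "('a, 'x) ring_scheme \<Rightarrow> ('a, 'm2, 'y) rmodule_scheme \<Rightarrow> ('a, 'n2, 'z) bimodule_scheme
    \<Rightarrow> ('m \<Rightarrow> 'm2) \<Rightarrow> ('n \<Rightarrow> 'n2) \<Rightarrow> ('m, 'n) tensor \<Rightarrow> ('m2, 'n2) tensor"
  where "tensor_map A M' N' f g =
    tensor_lift (tensor_group A M' N') (\<lambda>m n. pure_tensor A M' N' (f m) (g n))"

text \<open>The canonical maps \<open>(L \<otimes> M) \<otimes> N \<rightarrow> L \<otimes> (M \<otimes> N)\<close>, \<open>M \<otimes> A \<rightarrow> M\<close>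
  and \<open>A \<otimes> M \<rightarrow> M\<close>.\<close>

definition tensor_assoc ::
  "('a, 'x) ring_scheme \<Rightarrow> ('a, 'l, 'w) rmodule_scheme \<Rightarrow> ('a, 'm, 'y) bimodule_scheme
    \<Rightarrow> ('a, 'n, 'z) bimodule_scheme
    \<Rightarrow> (('l, 'm) tensor, 'n) tensor \<Rightarrow> ('l, ('m, 'n) tensor) tensor"
  where "tensor_assoc A L M N =
    (let MN = tensor_bimodule A M N; T = tensor_group A L MN in
     tensor_lift T (\<lambda>s n. tensor_lift T (\<lambda>l m. pure_tensor A L MN l (pure_tensor A M N m n)) s))"

definition tensor_runit :: "('a, 'm, 'y) rmodule_scheme \<Rightarrow> ('m, 'a) tensor \<Rightarrow> 'm"
  where "tensor_runit M = tensor_lift M (\<lambda>m a. m \<triangleleft>\<^bsub>M\<^esub> a)"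

definition tensor_lunit :: "('a, 'm, 'y) bimodule_scheme \<Rightarrow> ('a, 'm) tensor \<Rightarrow> 'm"
  where "tensor_lunit M = tensor_lift M (\<lambda>a m. a \<triangleright>\<^bsub>M\<^esub> m)"


section \<open>Group corings and their comodules\<close>

record ('g, 'a, 'c) coring =
  component :: "'g \<Rightarrow> ('a, 'c) bimodule"
  comult :: "'g \<Rightarrow> 'g \<Rightarrow> 'c \<Rightarrow> ('c, 'c) tensor"
  counit :: "'c \<Rightarrow> 'a"

locale group_coring = G?: group G + A?: ring A
  for G :: "('g, 'x) monoid_scheme" (structure)
    and A :: "('a, 'y) ring_scheme" (structure)
    and C :: "('g, 'a, 'c) coring" +
  assumes component_bimodule: "\<alpha> \<in> carrier G \<Longrightarrow> abimodule A (component C \<alpha>)"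
    and comult_linear: "\<lbrakk>\<alpha> \<in> carrier G; \<beta> \<in> carrier G\<rbrakk> \<Longrightarrow>
      comult C \<alpha> \<beta> \<in>
        left_linear A (component C (\<alpha> \<otimes>\<^bsub>G\<^esub> \<beta>)) (tensor_bimodule A (component C \<alpha>) (component C \<beta>)) \<inter>
        right_linear A (component C (\<alpha> \<otimes>\<^bsub>G\<^esub> \<beta>)) (tensor_bimodule A (component C \<alpha>) (component C \<beta>))"
    and counit_linear:
      "counit C \<in> left_linear A (component C \<one>\<^bsub>G\<^esub>) (regular_bimodule A) \<inter>
        right_linear A (component C \<one>\<^bsub>G\<^esub>) (regular_bimodule A)"
    and coassociative:
      "\<lbrakk>\<alpha> \<in> carrier G; \<beta> \<in> carrier G; \<gamma> \<in> carrier G;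
        c \<in> carrier (component C (\<alpha> \<otimes>\<^bsub>G\<^esub> \<beta> \<otimes>\<^bsub>G\<^esub> \<gamma>))\<rbrakk> \<Longrightarrow>
       tensor_assoc A (component C \<alpha>) (component C \<beta>) (component C \<gamma>)
         (tensor_map A (tensor_bimodule A (component C \<alpha>) (component C \<beta>)) (component C \<gamma>)
           (comult C \<alpha> \<beta>) (\<lambda>x. x) (comult C (\<alpha> \<otimes>\<^bsub>G\<^esub> \<beta>) \<gamma> c)) =
       tensor_map A (component C \<alpha>) (tensor_bimodule A (component C \<beta>) (component C \<gamma>))
         (\<lambda>x. x) (comult C \<beta> \<gamma>) (comult C \<alpha> (\<beta> \<otimes>\<^bsub>G\<^esub> \<gamma>) c)"
    and counit_right:
      "\<lbrakk>\<alpha> \<in> carrier G; c \<in> carrier (component C \<alpha>)\<rbrakk> \<Longrightarrow>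
       tensor_runit (component C \<alpha>)
         (tensor_map A (component C \<alpha>) (regular_bimodule A) (\<lambda>x. x) (counit C)
           (comult C \<alpha> \<one>\<^bsub>G\<^esub> c)) = c"
    and counit_left:
      "\<lbrakk>\<alpha> \<in> carrier G; c \<in> carrier (component C \<alpha>)\<rbrakk> \<Longrightarrow>
       tensor_lunit (component C \<alpha>)
         (tensor_map A (regular_bimodule A) (component C \<alpha>) (counit C) (\<lambda>x. x)
           (comult C \<one>\<^bsub>G\<^esub> \<alpha> c)) = c"

definition left_homogeneously_finite ::
  "('g, 'x) monoid_scheme \<Rightarrow> ('a, 'y) ring_scheme \<Rightarrow> ('g, 'a, 'c) coring \<Rightarrow> bool"
  where "left_homogeneously_finite G A C \<longleftrightarrow>
    (\<forall>\<alpha> \<in> carrier G. finitely_generated_left A (component C \<alpha>) \<and>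
       projective_left A (component C \<alpha>))"

record ('g, 'a, 'c, 'm) comodule = "('a, 'm) rmodule" +
  coact :: "'g \<Rightarrow> 'm \<Rightarrow> ('m, 'c) tensor"

locale right_comodule = group_coring G A C + right_module A M
  for G :: "('g, 'x) monoid_scheme" (structure)
    and A :: "('a, 'y) ring_scheme" (structure)
    and C :: "('g, 'a, 'c) coring"
    and M :: "('g, 'a, 'c, 'm) comodule" (structure) +
  assumes coact_linear: "\<alpha> \<in> carrier G \<Longrightarrow>
      coact M \<alpha> \<in> right_linear A M (tensor_rmodule A M (component C \<alpha>))"
    and coact_coassociative:
      "\<lbrakk>\<alpha> \<in> carrier G; \<beta> \<in> carrier G; m \<in> carrier M\<rbrakk> \<Longrightarrow>
       tensor_map A M (tensor_bimodule A (component C \<alpha>) (component C \<beta>))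
         (\<lambda>x. x) (comult C \<alpha> \<beta>) (coact M (\<alpha> \<otimes>\<^bsub>G\<^esub> \<beta>) m) =
       tensor_assoc A M (component C \<alpha>) (component C \<beta>)
         (tensor_map A (tensor_rmodule A M (component C \<alpha>)) (component C \<beta>)
           (coact M \<alpha>) (\<lambda>x. x) (coact M \<beta> m))"
    and coact_counit:
      "m \<in> carrier M \<Longrightarrow>
       tensor_runit M
         (tensor_map A M (regular_bimodule A) (\<lambda>x. x) (counit C) (coact M \<one>\<^bsub>G\<^esub> m)) = m"


section \<open>The left dual graded ring\<close>

definition left_dual_component ::
  "('g, 'x) monoid_scheme \<Rightarrow> ('a, 'y) ring_scheme \<Rightarrow> ('g, 'a, 'c) coring \<Rightarrow> 'g \<Rightarrow> ('c \<Rightarrow> 'a) set"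
  where "left_dual_component G A C \<alpha> =
    left_linear A (component C (inv\<^bsub>G\<^esub> \<alpha>)) (regular_bimodule A) \<inter>
    extensional (carrier (component C (inv\<^bsub>G\<^esub> \<alpha>)))"

text \<open>The product of homogeneous elements \<open>f\<close> of degree \<open>\<alpha>\<close> and \<open>g\<close> of degree \<open>\<beta>\<close>.\<close>

definition left_dual_prod ::
  "('g, 'x) monoid_scheme \<Rightarrow> ('g, 'a, 'c) coring
    \<Rightarrow> 'g \<Rightarrow> 'g \<Rightarrow> ('c \<Rightarrow> 'a) \<Rightarrow> ('c \<Rightarrow> 'a) \<Rightarrow> ('c \<Rightarrow> 'a)"
  where "left_dual_prod G C \<alpha> \<beta> f g =
    (\<lambda>c \<in> carrier (component C (inv\<^bsub>G\<^esub> (\<alpha> \<otimes>\<^bsub>G\<^esub> \<beta>))).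
      g (tensor_lift (component C (inv\<^bsub>G\<^esub> \<beta>)) (\<lambda>x y. x \<triangleleft>\<^bsub>component C (inv\<^bsub>G\<^esub> \<beta>)\<^esub> f y)
          (comult C (inv\<^bsub>G\<^esub> \<beta>) (inv\<^bsub>G\<^esub> \<alpha>) c)))"

definition left_dual_support ::
  "('g, 'x) monoid_scheme \<Rightarrow> ('a, 'y) ring_scheme \<Rightarrow> ('g, 'a, 'c) coring \<Rightarrow> ('g \<Rightarrow> 'c \<Rightarrow> 'a) \<Rightarrow> 'g set"
  where "left_dual_support G A C f =
    {\<alpha> \<in> carrier G. \<exists>c \<in> carrier (component C (inv\<^bsub>G\<^esub> \<alpha>)). f \<alpha> c \<noteq> \<zero>\<^bsub>A\<^esub>}"

text \<open>The direct sum consists of the families of finite support; \<open>f \<alpha>\<close> is the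
  homogeneous component of degree \<open>\<alpha>\<close>.\<close>

definition left_dual_ring ::
  "('g, 'x) monoid_scheme \<Rightarrow> ('a, 'y) ring_scheme \<Rightarrow> ('g, 'a, 'c) coring \<Rightarrow> ('g \<Rightarrow> 'c \<Rightarrow> 'a) ring"
  where "left_dual_ring G A C =
    \<lparr>carrier = {f \<in> (\<Pi>\<^sub>E \<alpha>\<in>carrier G. left_dual_component G A C \<alpha>).
       finite (left_dual_support G A C f)},
     monoid.mult = (\<lambda>f g. \<lambda>\<gamma>\<in>carrier G. \<lambda>c\<in>carrier (component C (inv\<^bsub>G\<^esub> \<gamma>)).
       \<Oplus>\<^bsub>A\<^esub>z\<in>{z \<in> left_dual_support G A C f \<times> left_dual_support G A C g. fst z \<otimes>\<^bsub>G\<^esub> snd z = \<gamma>}.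
         left_dual_prod G C (fst z) (snd z) (f (fst z)) (g (snd z)) c),
     one = (\<lambda>\<gamma>\<in>carrier G. \<lambda>c\<in>carrier (component C (inv\<^bsub>G\<^esub> \<gamma>)).
       if \<gamma> = \<one>\<^bsub>G\<^esub> then counit C c else \<zero>\<^bsub>A\<^esub>),
     ring.zero = (\<lambda>\<gamma>\<in>carrier G. \<lambda>c\<in>carrier (component C (inv\<^bsub>G\<^esub> \<gamma>)). \<zero>\<^bsub>A\<^esub>),
     ring.add = (\<lambda>f g. \<lambda>\<gamma>\<in>carrier G. \<lambda>c\<in>carrier (component C (inv\<^bsub>G\<^esub> \<gamma>)).
       f \<gamma> c \<oplus>\<^bsub>A\<^esub> g \<gamma> c)\<rparr>"


section \<open>Categories, functors and equivalences\<close>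

text \<open>Hom-sets are indexed by domain and codomain and need not be disjoint;
  \<open>Comp \<C> X Y Z g f\<close> is the composite of \<open>f\<close> from \<open>X\<close> to \<open>Y\<close> with \<open>g\<close> from \<open>Y\<close> to \<open>Z\<close>.\<close>

record ('o, 'f) cat =
  Obj :: "'o set"
  Hom :: "'o \<Rightarrow> 'o \<Rightarrow> 'f set"
  Ident :: "'o \<Rightarrow> 'f"
  Comp :: "'o \<Rightarrow> 'o \<Rightarrow> 'o \<Rightarrow> 'f \<Rightarrow> 'f \<Rightarrow> 'f"

locale category =
  fixes \<C> :: "('o, 'f) cat"
  assumes Ident_in_Hom: "X \<in> Obj \<C> \<Longrightarrow> Ident \<C> X \<in> Hom \<C> X X"
    and Comp_in_Hom: "\<lbrakk>X \<in> Obj \<C>; Y \<in> Obj \<C>; Z \<in> Obj \<C>; f \<in> Hom \<C> X Y; g \<in> Hom \<C> Y Z\<rbrakk>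
      \<Longrightarrow> Comp \<C> X Y Z g f \<in> Hom \<C> X Z"
    and Comp_Ident_right: "\<lbrakk>X \<in> Obj \<C>; Y \<in> Obj \<C>; f \<in> Hom \<C> X Y\<rbrakk>
      \<Longrightarrow> Comp \<C> X X Y f (Ident \<C> X) = f"
    and Comp_Ident_left: "\<lbrakk>X \<in> Obj \<C>; Y \<in> Obj \<C>; f \<in> Hom \<C> X Y\<rbrakk>
      \<Longrightarrow> Comp \<C> X Y Y (Ident \<C> Y) f = f"
    and Comp_assoc: "\<lbrakk>W \<in> Obj \<C>; X \<in> Obj \<C>; Y \<in> Obj \<C>; Z \<in> Obj \<C>;
        f \<in> Hom \<C> W X; g \<in> Hom \<C> X Y; h \<in> Hom \<C> Y Z\<rbrakk>
      \<Longrightarrow> Comp \<C> W Y Z h (Comp \<C> W X Y g f) = Comp \<C> W X Z (Comp \<C> X Y Z h g) f"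

record ('o1, 'f1, 'o2, 'f2) fctr =
  obj_map :: "'o1 \<Rightarrow> 'o2"
  arr_map :: "'o1 \<Rightarrow> 'o1 \<Rightarrow> 'f1 \<Rightarrow> 'f2"

locale functor_between = C?: category \<C> + D?: category \<D>
  for \<C> :: "('o1, 'f1) cat" and \<D> :: "('o2, 'f2) cat" and F :: "('o1, 'f1, 'o2, 'f2) fctr" +
  assumes obj_map_in_Obj: "X \<in> Obj \<C> \<Longrightarrow> obj_map F X \<in> Obj \<D>"
    and arr_map_in_Hom: "\<lbrakk>X \<in> Obj \<C>; Y \<in> Obj \<C>; f \<in> Hom \<C> X Y\<rbrakk>
      \<Longrightarrow> arr_map F X Y f \<in> Hom \<D> (obj_map F X) (obj_map F Y)"
    and arr_map_Ident: "X \<in> Obj \<C> \<Longrightarrow> arr_map F X X (Ident \<C> X) = Ident \<D> (obj_map F X)"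
    and arr_map_Comp: "\<lbrakk>X \<in> Obj \<C>; Y \<in> Obj \<C>; Z \<in> Obj \<C>; f \<in> Hom \<C> X Y; g \<in> Hom \<C> Y Z\<rbrakk>
      \<Longrightarrow> arr_map F X Z (Comp \<C> X Y Z g f) =
        Comp \<D> (obj_map F X) (obj_map F Y) (obj_map F Z) (arr_map F Y Z g) (arr_map F X Y f)"

definition id_functor :: "('o, 'f, 'o, 'f) fctr"
  where "id_functor = \<lparr>obj_map = (\<lambda>X. X), arr_map = (\<lambda>X Y f. f)\<rparr>"

definition comp_functor ::
  "('o2, 'f2, 'o3, 'f3) fctr \<Rightarrow> ('o1, 'f1, 'o2, 'f2) fctr \<Rightarrow> ('o1, 'f1, 'o3, 'f3) fctr"
  where "comp_functor K F =
    \<lparr>obj_map = (\<lambda>X. obj_map K (obj_map F X)),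
     arr_map = (\<lambda>X Y f. arr_map K (obj_map F X) (obj_map F Y) (arr_map F X Y f))\<rparr>"

definition iso_arr :: "('o, 'f) cat \<Rightarrow> 'o \<Rightarrow> 'o \<Rightarrow> 'f \<Rightarrow> bool"
  where "iso_arr \<C> X Y f \<longleftrightarrow> f \<in> Hom \<C> X Y \<and>
    (\<exists>g \<in> Hom \<C> Y X. Comp \<C> X Y X g f = Ident \<C> X \<and> Comp \<C> Y X Y f g = Ident \<C> Y)"

definition naturally_isomorphic ::
  "('o1, 'f1) cat \<Rightarrow> ('o2, 'f2) cat \<Rightarrow> ('o1, 'f1, 'o2, 'f2) fctr \<Rightarrow> ('o1, 'f1, 'o2, 'f2) fctr \<Rightarrow> bool"
  where "naturally_isomorphic \<C> \<D> F K \<longleftrightarrow>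
    (\<exists>\<tau>. (\<forall>X \<in> Obj \<C>. iso_arr \<D> (obj_map F X) (obj_map K X) (\<tau> X)) \<and>
      (\<forall>X \<in> Obj \<C>. \<forall>Y \<in> Obj \<C>. \<forall>f \<in> Hom \<C> X Y.
        Comp \<D> (obj_map F X) (obj_map F Y) (obj_map K Y) (\<tau> Y) (arr_map F X Y f) =
        Comp \<D> (obj_map F X) (obj_map K X) (obj_map K Y) (arr_map K X Y f) (\<tau> X)))"

definition equivalence_of_categories ::
  "('o1, 'f1) cat \<Rightarrow> ('o2, 'f2) cat \<Rightarrow> ('o1, 'f1, 'o2, 'f2) fctr \<Rightarrow> bool"
  where "equivalence_of_categories \<C> \<D> F \<longleftrightarrow>
    functor_between \<C> \<D> F \<and>
    (\<exists>K. functor_between \<D> \<C> K \<and>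
      naturally_isomorphic \<C> \<C> id_functor (comp_functor K F) \<and>
      naturally_isomorphic \<D> \<D> (comp_functor F K) id_functor)"


section \<open>The two categories and the functor between them\<close>

text \<open>Objects are all comodules (resp. right modules) carried by subsets of the arbitrary type
  \<open>'m\<close>, which plays the role of a universe. Morphisms are made extensional so that they are
  determined by their values on the carrier.\<close>

definition comodule_cat ::
  "('g, 'x) monoid_scheme \<Rightarrow> ('a, 'y) ring_scheme \<Rightarrow> ('g, 'a, 'c) coring
    \<Rightarrow> (('g, 'a, 'c, 'm) comodule, 'm \<Rightarrow> 'm) cat"
  where "comodule_cat G A C =
    \<lparr>Obj = {M. right_comodule G A C M},
     Hom = (\<lambda>M N. {f \<in> right_linear A M N \<inter> extensional (carrier M).
       \<forall>\<alpha> \<in> carrier G. \<forall>m \<in> carrier M.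
         tensor_map A N (component C \<alpha>) f (\<lambda>x. x) (coact M \<alpha> m) = coact N \<alpha> (f m)}),
     Ident = (\<lambda>M. \<lambda>m \<in> carrier M. m),
     Comp = (\<lambda>L M N g f. compose (carrier L) g f)\<rparr>"

definition rmodule_cat :: "('r, 'x) ring_scheme \<Rightarrow> (('r, 'm) rmodule, 'm \<Rightarrow> 'm) cat"
  where "rmodule_cat R =
    \<lparr>Obj = {M. right_module R M},
     Hom = (\<lambda>M N. right_linear R M N \<inter> extensional (carrier M)),
     Ident = (\<lambda>M. \<lambda>m \<in> carrier M. m),
     Comp = (\<lambda>L M N g f. compose (carrier L) g f)\<rparr>"

definition F4_obj ::
  "('g, 'x) monoid_scheme \<Rightarrow> ('a, 'y) ring_scheme \<Rightarrow> ('g, 'a, 'c) coring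
    \<Rightarrow> ('g, 'a, 'c, 'm) comodule \<Rightarrow> ('g \<Rightarrow> 'c \<Rightarrow> 'a, 'm) rmodule"
  where "F4_obj G A C M =
    \<lparr>carrier = carrier M, monoid.mult = monoid.mult M, one = one M, ring.zero = ring.zero M, ring.add = ring.add M,
     ract = (\<lambda>m f. \<Oplus>\<^bsub>M\<^esub>\<alpha>\<in>left_dual_support G A C f.
       tensor_lift M (\<lambda>x c. x \<triangleleft>\<^bsub>M\<^esub> f \<alpha> c) (coact M (inv\<^bsub>G\<^esub> \<alpha>) m))\<rparr>"

definition F4 ::
  "('g, 'x) monoid_scheme \<Rightarrow> ('a, 'y) ring_scheme \<Rightarrow> ('g, 'a, 'c) coring
    \<Rightarrow> (('g, 'a, 'c, 'm) comodule, 'm \<Rightarrow> 'm, ('g \<Rightarrow> 'c \<Rightarrow> 'a, 'm) rmodule, 'm \<Rightarrow> 'm) fctr"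
  where "F4 G A C = \<lparr>obj_map = F4_obj G A C, arr_map = (\<lambda>M N f. f)\<rparr>"

end

theory Submission
  imports Defs
begin

text \<open>A left linear form \<open>f\<close> on a component \<open>C\<^sub>p\<close> contracts tensors: for every right module \<open>M\<close> there is an
additive map \<open>M \<otimes> C\<^sub>p \<rightarrow> M\<close> sending \<open>m \<otimes> c\<close> to \<open>m f(c)\<close>, written \<open>contract M f\<close>. The action of \<open>f\<close> on a
comodule is the coaction followed by this contraction, and the product \<open>f # g\<close> of \<open>R\<close> is \<open>g\<close> after the
contraction of the comultiplication with \<open>f\<close>, so every axiom that relates \<open>R\<close> to coactions is a
statement about contractions.

Two formulas carry both directions. For forms \<open>f\<close> on \<open>C\<^sub>p\<close> and \<open>g\<close> on \<open>C\<^sub>q\<close>, the map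
\<open>m \<otimes> c \<otimes> d \<mapsto> m g(c f(d))\<close> turns \<open>(M \<otimes> \<Delta>)(s)\<close> into the contraction of \<open>s\<close> with the convolution of \<open>f\<close>
and \<open>g\<close> (\<open>contract_comult\<close>), and turns \<open>(\<rho> \<otimes> C)(t)\<close> into the successive contractions of \<open>t\<close> with \<open>f\<close> and
of its image under \<open>\<rho>\<close> with \<open>g\<close> (\<open>contract_iterated\<close>). Equating them, coassociativity of the coring
becomes associativity of \<open>R\<close>, and coassociativity of a coaction becomes the identity
\<open>m \<cdot> (f # g) = (m \<cdot> f) \<cdot> g\<close>. Naturality of the contraction makes comodule morphisms \<open>R\<close>-linear. This
gives the functor.

If the components are finitely generated projective, then they have finite dual bases \<open>(e\<^sub>j, f\<^sub>j)\<close>,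
and \<open>t = \<Sum>\<^sub>j contract M f\<^sub>j t \<otimes> e\<^sub>j\<close> for every tensor \<open>t\<close> (\<open>tensor_expansion\<close>). A tensor is therefore
determined by its contractions, in \<open>M \<otimes> C\<^sub>p\<close> as well as in \<open>M \<otimes> (C\<^sub>p \<otimes> C\<^sub>q)\<close>, and the implications
above can be reversed. An \<open>R\<close>-linear map between comodules is a morphism of comodules
(\<open>comodule_hom_iff\<close>). On an \<open>R\<close>-module \<open>N\<close> there is exactly one candidate for a coaction, the element
\<open>\<rho>(n) = \<Sum>\<^sub>j n \<cdot> f\<^sub>j \<otimes> e\<^sub>j\<close>, which is characterised by \<open>contract N f (\<rho>(n)) = n \<cdot> f\<close> for all forms \<open>f\<close>;
the comodule axioms hold because both sides of each have the same contractions (\<open>KN_comodule\<close>).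
Neither passage changes the underlying set, and each recovers the structure that it started from,
so identity maps are the two natural isomorphisms (\<open>F4_equivalence\<close>).\<close>

section \<open>Additive maps\<close>

text \<open>This is not an abbreviation because the simplifier would rewrite the record \<open>add_monoid M\<close> inside
\<open>hom\<close>, after which facts about additive maps would no longer apply.\<close>

definition additive :: "('m, 'x) ring_scheme \<Rightarrow> ('n, 'y) ring_scheme \<Rightarrow> ('m \<Rightarrow> 'n) set"
  where "additive M N = hom (add_monoid M) (add_monoid N)"

lemma additiveI:
  assumes "\<And>x. x \<in> carrier M \<Longrightarrow> f x \<in> carrier N"
    and "\<And>x y. x \<in> carrier M \<Longrightarrow> y \<in> carrier M \<Longrightarrow> f (x \<oplus>\<^bsub>M\<^esub> y) = f x \<oplus>\<^bsub>N\<^esub> f y"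
  shows "f \<in> additive M N"
  using assms by (auto simp: additive_def hom_def)

lemma additive_closed: "f \<in> additive M N \<Longrightarrow> x \<in> carrier M \<Longrightarrow> f x \<in> carrier N"
  by (auto simp: additive_def hom_def)

lemma additive_add:
  "f \<in> additive M N \<Longrightarrow> x \<in> carrier M \<Longrightarrow> y \<in> carrier M \<Longrightarrow> f (x \<oplus>\<^bsub>M\<^esub> y) = f x \<oplus>\<^bsub>N\<^esub> f y"
  by (auto simp: additive_def hom_def)

lemma additive_id: "(\<lambda>x. x) \<in> additive M M"
  by (rule additiveI) simp_all

lemma additive_transfer:
  "carrier N' = carrier N \<Longrightarrow> ring.add N' = ring.add N \<Longrightarrow> additive M N' = additive M N"
  by (simp add: additive_def hom_def)

lemma additive_zero:
  assumes "f \<in> additive M N" "abelian_group M" "abelian_group N"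
  shows "f \<zero>\<^bsub>M\<^esub> = \<zero>\<^bsub>N\<^esub>"
  using hom_one[OF assms(1)[unfolded additive_def]] abelian_group.a_group[OF assms(2)] abelian_group.a_group[OF assms(3)]
  by simp

lemma additive_neg:
  assumes "f \<in> additive M N" "abelian_group M" "abelian_group N" "x \<in> carrier M"
  shows "f (\<ominus>\<^bsub>M\<^esub> x) = \<ominus>\<^bsub>N\<^esub> f x"
proof -
  interpret group_hom "add_monoid M" "add_monoid N" f
    using assms by (simp add: additive_def group_hom_def group_hom_axioms_def abelian_group.a_group)
  show ?thesis using hom_inv[of x] assms by (simp add: a_inv_def)
qed

lemma additive_finsum:
  assumes f: "f \<in> additive M N" and M: "abelian_group M" and N: "abelian_group N"
    and "finite I" "h \<in> I \<rightarrow> carrier M"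
  shows "f (\<Oplus>\<^bsub>M\<^esub>i\<in>I. h i) = (\<Oplus>\<^bsub>N\<^esub>i\<in>I. f (h i))"
proof -
  interpret M: abelian_group M by fact
  interpret N: abelian_group N by fact
  show ?thesis using assms(4,5)
  proof (induction I rule: finite_induct)
    case empty then show ?case using additive_zero[OF f M N] by simp
  next
    case (insert x F)
    then have "(\<lambda>i. f (h i)) \<in> F \<rightarrow> carrier N" "f (h x) \<in> carrier N"
      using additive_closed[OF f] by (auto simp: Pi_iff)
    with insert show ?case
      by (simp add: additive_add[OF f] Pi_iff M.finsum_closed)
  qed
qed

lemma additive_comp:
  "f \<in> additive L M \<Longrightarrow> g \<in> additive M N \<Longrightarrow> (\<lambda>x. g (f x)) \<in> additive L N"
  by (auto simp: additive_def hom_def Pi_iff)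

lemma (in abelian_group) additive_sum:
  assumes "f \<in> additive M G" "g \<in> additive M G"
  shows "(\<lambda>x. f x \<oplus> g x) \<in> additive M G"
  using assms by (auto intro!: additiveI simp: additive_closed additive_add a_ac)

lemma (in abelian_monoid) finsum_product:
  assumes "finite I" "finite J" "\<And>i j. i \<in> I \<Longrightarrow> j \<in> J \<Longrightarrow> h i j \<in> carrier G"
  shows "(\<Oplus>z\<in>I \<times> J. h (fst z) (snd z)) = (\<Oplus>i\<in>I. \<Oplus>j\<in>J. h i j)"
  using assms(1,3)
proof (induction I rule: finite_induct)
  case empty then show ?case by simp
next
  case (insert i I)
  have "(\<Oplus>z\<in>insert i I \<times> J. h (fst z) (snd z)) = (\<Oplus>z\<in>Pair i ` J \<union> I \<times> J. h (fst z) (snd z))"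
    by (rule arg_cong[where f = "finsum G _"]) auto
  also have "\<dots> = (\<Oplus>z\<in>Pair i ` J. h (fst z) (snd z)) \<oplus> (\<Oplus>z\<in>I \<times> J. h (fst z) (snd z))"
    using insert assms(2) by (intro finsum_Un_disjoint) auto
  also have "(\<Oplus>z\<in>Pair i ` J. h (fst z) (snd z)) = (\<Oplus>j\<in>J. h i j)"
    using insert.prems by (subst finsum_reindex) (auto simp: inj_on_def)
  finally show ?case using insert by (simp add: finsum_closed Pi_iff)
qed

section \<open>Modules\<close>

lemma abimodule_right: "abimodule A M \<Longrightarrow> right_module A M"
  by (simp add: abimodule_def)

lemma right_linearD:
  assumes "f \<in> right_linear A M N"
  shows "f \<in> additive M N"
    and "m \<in> carrier M \<Longrightarrow> f m \<in> carrier N"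
    and "m \<in> carrier M \<Longrightarrow> n \<in> carrier M \<Longrightarrow> f (m \<oplus>\<^bsub>M\<^esub> n) = f m \<oplus>\<^bsub>N\<^esub> f n"
    and "m \<in> carrier M \<Longrightarrow> a \<in> carrier A \<Longrightarrow> f (m \<triangleleft>\<^bsub>M\<^esub> a) = f m \<triangleleft>\<^bsub>N\<^esub> a"
  using assms by (auto simp: right_linear_def additive_def hom_def)

lemma left_linearD:
  assumes "f \<in> left_linear A M N"
  shows "f \<in> additive M N"
    and "m \<in> carrier M \<Longrightarrow> f m \<in> carrier N"
    and "m \<in> carrier M \<Longrightarrow> n \<in> carrier M \<Longrightarrow> f (m \<oplus>\<^bsub>M\<^esub> n) = f m \<oplus>\<^bsub>N\<^esub> f n"
    and "m \<in> carrier M \<Longrightarrow> a \<in> carrier A \<Longrightarrow> f (a \<triangleright>\<^bsub>M\<^esub> m) = a \<triangleright>\<^bsub>N\<^esub> f m"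
  using assms by (auto simp: left_linear_def additive_def hom_def)

lemma regular_simps [simp]:
  "carrier (regular_bimodule A) = carrier A"
  "ring.add (regular_bimodule A) = ring.add A"
  "ring.zero (regular_bimodule A) = ring.zero A"
  "ract (regular_bimodule A) = monoid.mult A"
  "lact (regular_bimodule A) = monoid.mult A"
  by (simp_all add: regular_bimodule_def)

lemma abelian_group_transfer:
  assumes "abelian_group M" "carrier N = carrier M" "ring.add N = ring.add M" "ring.zero N = ring.zero M"
  shows "abelian_group N"
proof -
  interpret abelian_group M by fact
  show ?thesis
    by (rule abelian_groupI) (use assms in \<open>auto simp: a_ac intro: bexI[of _ "\<ominus>\<^bsub>M\<^esub> _"] l_neg\<close>)
qed

lemma finsum_transfer:
  assumes "carrier N = carrier M" "ring.add N = ring.add M" "ring.zero N = ring.zero M"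
  shows "finsum N f I = finsum M f I"
  using assms by (simp add: finsum_def finprod_def)

lemma regular_abimodule:
  assumes "ring A" shows "abimodule A (regular_bimodule A)"
proof -
  interpret ring A by fact
  have "abelian_group (regular_bimodule A)"
    by (rule abelian_group_transfer[OF is_abelian_group]) auto
  then show ?thesis
    by (intro abimodule.intro right_module.intro right_module_axioms.intro
        abimodule_axioms.intro) (auto simp: assms l_distr r_distr m_assoc)
qed

context right_module
begin

lemma ract_additive: "a \<in> carrier A \<Longrightarrow> (\<lambda>m. m \<triangleleft>\<^bsub>M\<^esub> a) \<in> additive M M"
  by (auto intro!: additiveI simp: ract_closed ract_add)

lemma ract_scalar_additive: "m \<in> carrier M \<Longrightarrow> (\<lambda>a. m \<triangleleft>\<^bsub>M\<^esub> a) \<in> additive A M"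
  by (auto intro!: additiveI simp: ract_closed ract_add_scalar)

lemma ract_zero: "m \<in> carrier M \<Longrightarrow> m \<triangleleft>\<^bsub>M\<^esub> \<zero>\<^bsub>A\<^esub> = \<zero>\<^bsub>M\<^esub>"
  using additive_zero[OF ract_scalar_additive] A.is_abelian_group M.abelian_group_axioms by blast

end

section \<open>Tensor products\<close>

text \<open>The bilinear maps that factor through the tensor product over \<open>A\<close>.\<close>

definition balanced ::
  "('a, 'x) ring_scheme \<Rightarrow> ('a, 'm, 'y) rmodule_scheme \<Rightarrow> ('a, 'n, 'z) bimodule_scheme
    \<Rightarrow> ('p, 'w) ring_scheme \<Rightarrow> ('m \<Rightarrow> 'n \<Rightarrow> 'p) \<Rightarrow> bool"
  where "balanced A M N P \<beta> \<longleftrightarrow>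
    (\<forall>n \<in> carrier N. (\<lambda>m. \<beta> m n) \<in> additive M P) \<and>
    (\<forall>m \<in> carrier M. \<beta> m \<in> additive N P) \<and>
    (\<forall>m \<in> carrier M. \<forall>a \<in> carrier A. \<forall>n \<in> carrier N. \<beta> (m \<triangleleft>\<^bsub>M\<^esub> a) n = \<beta> m (a \<triangleright>\<^bsub>N\<^esub> n))"

lemma balancedI:
  assumes "\<And>m n. m \<in> carrier M \<Longrightarrow> n \<in> carrier N \<Longrightarrow> \<beta> m n \<in> carrier P"
    and "\<And>m m' n. m \<in> carrier M \<Longrightarrow> m' \<in> carrier M \<Longrightarrow> n \<in> carrier N \<Longrightarrow>
      \<beta> (m \<oplus>\<^bsub>M\<^esub> m') n = \<beta> m n \<oplus>\<^bsub>P\<^esub> \<beta> m' n"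
    and "\<And>m n n'. m \<in> carrier M \<Longrightarrow> n \<in> carrier N \<Longrightarrow> n' \<in> carrier N \<Longrightarrow>
      \<beta> m (n \<oplus>\<^bsub>N\<^esub> n') = \<beta> m n \<oplus>\<^bsub>P\<^esub> \<beta> m n'"
    and "\<And>m a n. m \<in> carrier M \<Longrightarrow> a \<in> carrier A \<Longrightarrow> n \<in> carrier N \<Longrightarrow>
      \<beta> (m \<triangleleft>\<^bsub>M\<^esub> a) n = \<beta> m (a \<triangleright>\<^bsub>N\<^esub> n)"
  shows "balanced A M N P \<beta>"
  using assms by (auto simp: balanced_def intro!: additiveI)

lemma balancedD:
  assumes "balanced A M N P \<beta>" "m \<in> carrier M" "n \<in> carrier N"
  shows "\<beta> m n \<in> carrier P"
    and "m' \<in> carrier M \<Longrightarrow> \<beta> (m \<oplus>\<^bsub>M\<^esub> m') n = \<beta> m n \<oplus>\<^bsub>P\<^esub> \<beta> m' n"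
    and "n' \<in> carrier N \<Longrightarrow> \<beta> m (n \<oplus>\<^bsub>N\<^esub> n') = \<beta> m n \<oplus>\<^bsub>P\<^esub> \<beta> m n'"
    and "a \<in> carrier A \<Longrightarrow> \<beta> (m \<triangleleft>\<^bsub>M\<^esub> a) n = \<beta> m (a \<triangleright>\<^bsub>N\<^esub> n)"
  using assms by (auto simp: balanced_def additive_def hom_def)

text \<open>The function whose image on a coset appears in \<open>tensor_lift\<close>.\<close>

definition linear_extension :: "('p, 'x) ring_scheme \<Rightarrow> ('z \<Rightarrow> 'p) \<Rightarrow> ('z \<Rightarrow>\<^sub>0 int) \<Rightarrow> 'p"
  where "linear_extension P b u = (\<Oplus>\<^bsub>P\<^esub>z\<in>Poly_Mapping.keys u. [Poly_Mapping.lookup u z] \<cdot>\<^bsub>P\<^esub> b z)"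

context abelian_group
begin

lemma multiple_closed: "x \<in> carrier G \<Longrightarrow> [(k::int)] \<cdot> x \<in> carrier G"
  using group.int_pow_closed[OF a_group, of x k] by (simp add: add_pow_def)

lemma multiple_add: "x \<in> carrier G \<Longrightarrow> [(k + l::int)] \<cdot> x = [k] \<cdot> x \<oplus> [l] \<cdot> x"
  using group.int_pow_mult[OF a_group, of x k l] by (simp add: add_pow_def)

lemma multiple_zero: "[(0::int)] \<cdot> x = \<zero>"
  by (simp add: add_pow_def int_pow_def2)

lemma multiple_one: "x \<in> carrier G \<Longrightarrow> [(1::int)] \<cdot> x = x"
  using group.int_pow_1[OF a_group, of x] by (simp add: add_pow_def)

text \<open>Sums over the keys of two combinations and of their sum can only be compared on a common index set.\<close>

lemma linear_extension_superset:
  assumes "finite S" "Poly_Mapping.keys u \<subseteq> S" "b ` S \<subseteq> carrier G"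
  shows "linear_extension G b u = (\<Oplus>z\<in>S. [Poly_Mapping.lookup u z] \<cdot> b z)"
  unfolding linear_extension_def
  using assms
  by (intro add.finprod_mono_neutral_cong_left)
     (auto simp: in_keys_iff multiple_zero intro!: multiple_closed)

lemma linear_extension_hom:
  assumes "b ` S \<subseteq> carrier G"
  shows "linear_extension G b \<in> hom (free_Abelian_group S) (add_monoid G)"
proof (rule homI)
  fix u assume "u \<in> carrier (free_Abelian_group S)"
  then show "linear_extension G b u \<in> carrier (add_monoid G)"
    unfolding linear_extension_def using assms by (auto intro!: finsum_closed multiple_closed)
next
  fix u v assume uv: "u \<in> carrier (free_Abelian_group S)" "v \<in> carrier (free_Abelian_group S)"
  let ?K = "Poly_Mapping.keys u \<union> Poly_Mapping.keys v"
  have K: "finite ?K" "b ` ?K \<subseteq> carrier G" "Poly_Mapping.keys (u + v) \<subseteq> ?K"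
    using uv assms keys_add[of u v] by auto
  have "linear_extension G b (u + v) =
      (\<Oplus>z\<in>?K. [Poly_Mapping.lookup u z] \<cdot> b z \<oplus> [Poly_Mapping.lookup v z] \<cdot> b z)"
    using K by (subst linear_extension_superset[OF K(1,3,2)])
      (auto intro!: finsum_cong' multiple_closed simp: lookup_add multiple_add)
  also have "\<dots> = linear_extension G b u \<oplus> linear_extension G b v"
    using K by (subst (1 2) linear_extension_superset[OF K(1) _ K(2)])
      (auto intro!: finsum_addf multiple_closed)
  finally show "linear_extension G b (u \<otimes>\<^bsub>free_Abelian_group S\<^esub> v) =
      linear_extension G b u \<otimes>\<^bsub>add_monoid G\<^esub> linear_extension G b v" by simp
qed

lemma linear_extension_frag_of:
  "b z \<in> carrier G \<Longrightarrow> linear_extension G b (frag_of z) = b z"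
  by (simp add: linear_extension_def add.finprod_singleton multiple_one)

end

lemma keys_add_subset:
  "Poly_Mapping.keys u \<subseteq> S \<Longrightarrow> Poly_Mapping.keys v \<subseteq> S \<Longrightarrow> Poly_Mapping.keys (u + v :: 'b \<Rightarrow>\<^sub>0 int) \<subseteq> S"
  using keys_add[of u v] by blast

lemma keys_diff_subset:
  "Poly_Mapping.keys u \<subseteq> S \<Longrightarrow> Poly_Mapping.keys v \<subseteq> S \<Longrightarrow> Poly_Mapping.keys (u - v :: 'b \<Rightarrow>\<^sub>0 int) \<subseteq> S"
  using keys_diff[of u v] by blast

locale tensor_pair = M: right_module A M + N: abimodule A N
  for A :: "('a, 'x) ring_scheme"
    and M :: "('a, 'm, 'y) rmodule_scheme"
    and N :: "('a, 'n, 'z) bimodule_scheme"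
begin

abbreviation "frags \<equiv> free_Abelian_group (carrier M \<times> carrier N)"
abbreviation "K \<equiv> tensor_kernel A M N"
abbreviation "T \<equiv> tensor_group A M N"
abbreviation "coset u \<equiv> K #>\<^bsub>frags\<^esub> u"

lemma relations_closed: "tensor_relations A M N \<subseteq> carrier frags"
proof
  fix r assume "r \<in> tensor_relations A M N"
  then show "r \<in> carrier frags" unfolding tensor_relations_def
    by (elim UnE CollectE exE conjE)
       (simp_all add: keys_diff_subset M.ract_closed N.lact_closed)
qed

lemma kernel_subgroup: "subgroup K frags"
  unfolding tensor_kernel_def
  by (rule group.generate_is_subgroup[OF group_free_Abelian_group relations_closed])

lemma kernel_normal: "K \<lhd> frags"
  by (rule comm_group.subgroup_imp_normal[OF abelian_free_Abelian_group kernel_subgroup])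

lemma T_simps:
  "carrier T = coset ` carrier frags"
  "\<zero>\<^bsub>T\<^esub> = K"
  "ring.add T = set_mult frags"
  by (auto simp: tensor_group_def tensor_quotient_def carrier_FactGroup)

lemma T_abelian_group: "abelian_group T"
proof (rule comm_group_abelian_groupI)
  have "comm_group (tensor_quotient A M N)" unfolding tensor_quotient_def
    by (rule comm_group.abelian_FactGroup[OF abelian_free_Abelian_group kernel_subgroup])
  moreover have "add_monoid T = tensor_quotient A M N" by (simp add: tensor_group_def)
  ultimately show "comm_group (add_monoid T)" by simp
qed

sublocale T: abelian_group T by (rule T_abelian_group)

lemma coset_closed: "u \<in> carrier frags \<Longrightarrow> coset u \<in> carrier T"
  by (simp add: T_simps)

lemma coset_add:
  "u \<in> carrier frags \<Longrightarrow> v \<in> carrier frags \<Longrightarrow> coset u \<oplus>\<^bsub>T\<^esub> coset v = coset (u + v)"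
  using normal.rcos_sum[OF kernel_normal, of u v] by (simp add: T_simps)

lemma coset_zero: "coset 0 = \<zero>\<^bsub>T\<^esub>"
  using group.coset_mult_one[OF group_free_Abelian_group, of K] subgroup.subset[OF kernel_subgroup]
  by (simp add: T_simps)

lemma coset_eqI:
  assumes "u \<in> carrier frags" "v \<in> carrier frags" "u - v \<in> K"
  shows "coset u = coset v"
proof -
  have "coset u = coset ((u - v) + v)" by simp
  also have "\<dots> = coset (u - v) \<oplus>\<^bsub>T\<^esub> coset v"
    using assms by (intro coset_add[symmetric]) (simp_all add: keys_diff_subset)
  also have "coset (u - v) = \<zero>\<^bsub>T\<^esub>"
    using group.coset_join2[OF group_free_Abelian_group _ kernel_subgroup assms(3)]
      subgroup.subset[OF kernel_subgroup] assms(3) by (auto simp: T_simps)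
  finally show ?thesis using coset_closed[OF assms(2)] by simp
qed

lemma relation_in_kernel: "r \<in> tensor_relations A M N \<Longrightarrow> r \<in> K"
  unfolding tensor_kernel_def by (rule generate.incl)

abbreviation pure (infixr "\<odot>" 72) where "m \<odot> n \<equiv> pure_tensor A M N m n"

lemma pure_closed: "m \<in> carrier M \<Longrightarrow> n \<in> carrier N \<Longrightarrow> m \<odot> n \<in> carrier T"
  by (simp add: pure_tensor_def coset_closed)

lemma pure_balanced: "balanced A M N T pure"
proof (rule balancedI)
  fix m n assume "m \<in> carrier M" "n \<in> carrier N"
  then show "m \<odot> n \<in> carrier T" by (rule pure_closed)
next
  fix m m' n assume mn: "m \<in> carrier M" "m' \<in> carrier M" "n \<in> carrier N"
  have "coset (frag_of (m \<oplus>\<^bsub>M\<^esub> m', n)) = coset (frag_of (m, n) + frag_of (m', n))"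
    using mn by (intro coset_eqI relation_in_kernel)
      (simp_all add: keys_add_subset, force simp: tensor_relations_def diff_diff_add)
  then show "(m \<oplus>\<^bsub>M\<^esub> m') \<odot> n = m \<odot> n \<oplus>\<^bsub>T\<^esub> m' \<odot> n"
    using mn by (simp add: pure_tensor_def coset_add)
next
  fix m n n' assume mn: "m \<in> carrier M" "n \<in> carrier N" "n' \<in> carrier N"
  have "coset (frag_of (m, n \<oplus>\<^bsub>N\<^esub> n')) = coset (frag_of (m, n) + frag_of (m, n'))"
    using mn by (intro coset_eqI relation_in_kernel)
      (simp_all add: keys_add_subset, force simp: tensor_relations_def diff_diff_add)
  then show "m \<odot> (n \<oplus>\<^bsub>N\<^esub> n') = m \<odot> n \<oplus>\<^bsub>T\<^esub> m \<odot> n'"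
    using mn by (simp add: pure_tensor_def coset_add)
next
  fix m a n assume mn: "m \<in> carrier M" "a \<in> carrier A" "n \<in> carrier N"
  then show "(m \<triangleleft>\<^bsub>M\<^esub> a) \<odot> n = m \<odot> (a \<triangleright>\<^bsub>N\<^esub> n)" unfolding pure_tensor_def
    by (intro coset_eqI relation_in_kernel)
       (simp_all add: M.ract_closed N.lact_closed, force simp: tensor_relations_def)
qed

lemmas pure_add_left = balancedD(2)[OF pure_balanced]
  and pure_add_right = balancedD(3)[OF pure_balanced]
  and pure_ract = balancedD(4)[OF pure_balanced]

lemma pure_additive_left: "n \<in> carrier N \<Longrightarrow> (\<lambda>m. m \<odot> n) \<in> additive M T"
  and pure_additive_right: "m \<in> carrier M \<Longrightarrow> pure m \<in> additive N T"
  using pure_balanced by (auto simp: balanced_def)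

text \<open>Pure tensors generate the tensor product as a monoid already, because \<open>- (m \<otimes> n) = (- m) \<otimes> n\<close>. The
induction on formal combinations needs the negatives, so it carries both signs along.\<close>

lemma tensor_induct [consumes 1, case_names pure add]:
  assumes t: "t \<in> carrier T"
    and pure: "\<And>m n. m \<in> carrier M \<Longrightarrow> n \<in> carrier N \<Longrightarrow> Q (m \<odot> n)"
    and add: "\<And>s t. s \<in> carrier T \<Longrightarrow> t \<in> carrier T \<Longrightarrow> Q s \<Longrightarrow> Q t \<Longrightarrow> Q (s \<oplus>\<^bsub>T\<^esub> t)"
  shows "Q t"
proof -
  obtain u where u: "Poly_Mapping.keys u \<subseteq> carrier M \<times> carrier N" "t = coset u"
    using t by (auto simp: T_simps)
  have "Q (coset u) \<and> Q (coset (- u))"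
  proof (rule free_Abelian_group_induct[OF u(1)], goal_cases)
    case 1
    have "\<zero>\<^bsub>M\<^esub> \<odot> \<zero>\<^bsub>N\<^esub> = \<zero>\<^bsub>T\<^esub>"
      by (rule additive_zero[OF pure_additive_left])
         (auto simp: M.M.abelian_group_axioms T_abelian_group)
    then show ?case using pure[of "\<zero>\<^bsub>M\<^esub>" "\<zero>\<^bsub>N\<^esub>"] coset_zero by simp
  next
    case (2 x y)
    then have "coset (x - y) = coset x \<oplus>\<^bsub>T\<^esub> coset (- y)"
      "coset (- (x - y)) = coset y \<oplus>\<^bsub>T\<^esub> coset (- x)"
      by (auto simp: coset_add)
    with 2 show ?case by (auto intro!: add coset_closed)
  next
    case (3 z)
    obtain m n where z: "z = (m, n)" "m \<in> carrier M" "n \<in> carrier N" using 3 by auto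
    have "coset (- frag_of z) \<oplus>\<^bsub>T\<^esub> coset (frag_of z) = \<zero>\<^bsub>T\<^esub>"
      using 3 by (subst coset_add) (auto simp: coset_zero)
    then have "coset (- frag_of z) = \<ominus>\<^bsub>T\<^esub> (m \<odot> n)"
      using z by (intro T.minus_equality[symmetric]) (auto simp: pure_tensor_def intro!: coset_closed)
    also have "\<dots> = (\<ominus>\<^bsub>M\<^esub> m) \<odot> n"
      using z by (intro additive_neg[OF pure_additive_left, symmetric])
        (auto simp: M.M.abelian_group_axioms T_abelian_group)
    finally show ?case using pure[of m n] pure[of "\<ominus>\<^bsub>M\<^esub> m" n] z by (simp add: pure_tensor_def)
  qed
  with u show ?thesis by simp
qed

text \<open>All identities between maps on tensor products below are reduced to pure tensors by this rule.\<close>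

lemma additive_eqI:
  assumes "t \<in> carrier T" "f \<in> additive T P" "g \<in> additive T P"
    and "\<And>m n. m \<in> carrier M \<Longrightarrow> n \<in> carrier N \<Longrightarrow> f (m \<odot> n) = g (m \<odot> n)"
  shows "f t = g t"
  using assms(1)
  by (induction rule: tensor_induct)
     (use assms in \<open>auto simp: additive_add[OF assms(2)] additive_add[OF assms(3)]\<close>)

context
  fixes P :: "('p, 'w) ring_scheme" and \<beta> :: "'m \<Rightarrow> 'n \<Rightarrow> 'p"
  assumes P: "abelian_group P" and \<beta>: "balanced A M N P \<beta>"
begin

interpretation P: abelian_group P by (rule P)

text \<open>The linear extension of a balanced map kills each defining relation, hence the subgroup that the
relations generate, so its image on a coset is a singleton and \<open>the_elem\<close> returns its value there.\<close>

lemma lift_coset: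
  assumes u: "u \<in> carrier frags"
  shows "tensor_lift P \<beta> (coset u) = linear_extension P (\<lambda>z. \<beta> (fst z) (snd z)) u"
proof -
  let ?h = "linear_extension P (\<lambda>z. \<beta> (fst z) (snd z))"
  have h: "?h \<in> hom frags (add_monoid P)"
    by (rule P.linear_extension_hom) (auto simp: balancedD(1)[OF \<beta>])
  interpret h: group_hom frags "add_monoid P" ?h
    using h by (simp add: group_hom_def group_hom_axioms_def P.a_group)
  have of: "?h (frag_of (m, n)) = \<beta> m n" if "m \<in> carrier M" "n \<in> carrier N" for m n
    using balancedD(1)[OF \<beta> that] by (simp add: P.linear_extension_frag_of)
  have diff: "?h (x - y) = ?h x \<ominus>\<^bsub>P\<^esub> ?h y" if "x \<in> carrier frags" "y \<in> carrier frags" for x y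
  proof -
    have "?h (x + (- y)) = ?h x \<oplus>\<^bsub>P\<^esub> ?h (- y)" using h.hom_mult[of x "- y"] that by simp
    also have "?h (- y) = \<ominus>\<^bsub>P\<^esub> ?h y" using h.hom_inv[of y] that by (simp add: a_inv_def)
    finally show ?thesis by (simp add: a_minus_def)
  qed
  have cancel: "x \<oplus>\<^bsub>P\<^esub> y \<ominus>\<^bsub>P\<^esub> x \<ominus>\<^bsub>P\<^esub> y = \<zero>\<^bsub>P\<^esub>" if "x \<in> carrier P" "y \<in> carrier P" for x y
    using that P.r_neg[of "x \<oplus>\<^bsub>P\<^esub> y"] by (simp add: a_minus_def P.a_ac P.minus_add)
  have cancel': "x \<ominus>\<^bsub>P\<^esub> x = \<zero>\<^bsub>P\<^esub>" if "x \<in> carrier P" for x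
    using that by (simp add: a_minus_def P.r_neg)
  have "tensor_relations A M N \<subseteq> kernel frags (add_monoid P) ?h"
  proof
    fix r assume r: "r \<in> tensor_relations A M N"
    then have rc: "r \<in> carrier frags" by (rule subsetD[OF relations_closed])
    from r have "?h r = \<zero>\<^bsub>P\<^esub>" unfolding tensor_relations_def
      by (elim UnE CollectE exE conjE)
         (simp_all add: diff of keys_diff_subset M.ract_closed N.lact_closed balancedD[OF \<beta>]
           cancel cancel')
    with rc show "r \<in> kernel frags (add_monoid P) ?h" by (simp add: kernel_def)
  qed
  then have K: "K \<subseteq> kernel frags (add_monoid P) ?h" unfolding tensor_kernel_def
    by (intro group.generate_subgroup_incl[OF group_free_Abelian_group _ h.subgroup_kernel])
  have "?h (k + u) = ?h u" if "k \<in> K" for k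
    using K that u h.hom_mult[of k u] h.hom_closed[of u] by (auto simp: kernel_def)
  moreover have "0 \<in> K" using subgroup.one_closed[OF kernel_subgroup] by simp
  ultimately have "?h ` coset u = {?h u}"
    by (force simp: r_coset_def)
  then show ?thesis
    by (simp add: tensor_lift_def linear_extension_def[abs_def])
qed

lemma lift_pure: "m \<in> carrier M \<Longrightarrow> n \<in> carrier N \<Longrightarrow> tensor_lift P \<beta> (m \<odot> n) = \<beta> m n"
  unfolding pure_tensor_def
  by (subst lift_coset) (auto simp: P.linear_extension_frag_of balancedD(1)[OF \<beta>])

lemma lift_additive: "tensor_lift P \<beta> \<in> additive T P"
proof (rule additiveI)
  let ?h = "linear_extension P (\<lambda>z. \<beta> (fst z) (snd z))"
  have h: "?h \<in> hom frags (add_monoid P)"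
    by (rule P.linear_extension_hom) (auto simp: balancedD(1)[OF \<beta>])
  fix t assume "t \<in> carrier T"
  then obtain u where u: "u \<in> carrier frags" "t = coset u" by (auto simp: T_simps)
  then show "tensor_lift P \<beta> t \<in> carrier P"
    using hom_in_carrier[OF h u(1)] by (simp only: lift_coset) simp
  fix s assume "s \<in> carrier T"
  then obtain v where v: "v \<in> carrier frags" "s = coset v" by (auto simp: T_simps)
  have "u + v \<in> carrier frags" using u v by (simp add: keys_add_subset)
  then show "tensor_lift P \<beta> (t \<oplus>\<^bsub>T\<^esub> s) = tensor_lift P \<beta> t \<oplus>\<^bsub>P\<^esub> tensor_lift P \<beta> s"
    using hom_mult[OF h u(1) v(1)] unfolding u v coset_add[OF u(1) v(1)]
    by (simp only: lift_coset u v) simp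
qed

end

end

section \<open>Tensor products as modules\<close>

lemma id_right_linear: "(\<lambda>x. x) \<in> right_linear A M M"
  by (simp add: right_linear_def hom_def)

lemma id_left_linear: "(\<lambda>x. x) \<in> left_linear A M M"
  by (simp add: left_linear_def hom_def)

lemma left_linear_comp:
  "f \<in> left_linear A L M \<Longrightarrow> g \<in> left_linear A M N \<Longrightarrow> (\<lambda>x. g (f x)) \<in> left_linear A L N"
  by (auto simp: left_linear_def hom_def Pi_iff)

lemma left_linear_cong:
  assumes "f \<in> left_linear A M N" "abimodule A M" "\<And>x. x \<in> carrier M \<Longrightarrow> f x = g x"
  shows "g \<in> left_linear A M N"
proof -
  interpret abimodule A M by fact
  show ?thesis using assms(1,3) by (auto simp: left_linear_def hom_def Pi_iff lact_closed)
qed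

lemma tensor_rmodule_simps [simp]:
  "carrier (tensor_rmodule A M N) = carrier (tensor_group A M N)"
  "ring.add (tensor_rmodule A M N) = ring.add (tensor_group A M N)"
  "ring.zero (tensor_rmodule A M N) = ring.zero (tensor_group A M N)"
  "ract (tensor_rmodule A M N) =
    (\<lambda>t a. tensor_lift (tensor_group A M N) (\<lambda>m n. pure_tensor A M N m (n \<triangleleft>\<^bsub>N\<^esub> a)) t)"
  by (simp_all add: tensor_rmodule_def Let_def)

lemma tensor_bimodule_simps [simp]:
  "carrier (tensor_bimodule A M N) = carrier (tensor_group A M N)"
  "ring.add (tensor_bimodule A M N) = ring.add (tensor_group A M N)"
  "ring.zero (tensor_bimodule A M N) = ring.zero (tensor_group A M N)"
  "ract (tensor_bimodule A M N) =
    (\<lambda>t a. tensor_lift (tensor_group A M N) (\<lambda>m n. pure_tensor A M N m (n \<triangleleft>\<^bsub>N\<^esub> a)) t)"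
  "lact (tensor_bimodule A M N) =
    (\<lambda>a t. tensor_lift (tensor_group A M N) (\<lambda>m n. pure_tensor A M N (a \<triangleright>\<^bsub>M\<^esub> m) n) t)"
  by (simp_all add: tensor_bimodule_def Let_def)

text \<open>The left action on \<open>M \<otimes> N\<close> does not occur in the relations of \<open>(M \<otimes> N) \<otimes> P\<close>. The axioms of corings
use bimodule structures where those of comodules use right module structures; these equations allow
one set of lemmas to serve both.\<close>

lemma tensor_bimodule_as_rmodule:
  shows "right_linear A L (tensor_bimodule A M N) = right_linear A L (tensor_rmodule A M N)"
    and "tensor_group A (tensor_bimodule A M N) P = tensor_group A (tensor_rmodule A M N) P"
    and "tensor_map A (tensor_bimodule A M N) P = tensor_map A (tensor_rmodule A M N) P"
proof -
  have rel: "tensor_relations A (tensor_bimodule A M N) P = tensor_relations A (tensor_rmodule A M N) P"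
    by (simp add: tensor_relations_def)
  show grp: "tensor_group A (tensor_bimodule A M N) P = tensor_group A (tensor_rmodule A M N) P"
    by (simp add: tensor_group_def tensor_quotient_def tensor_kernel_def rel)
  have "pure_tensor A (tensor_bimodule A M N) P = pure_tensor A (tensor_rmodule A M N) P"
    by (simp add: fun_eq_iff pure_tensor_def tensor_kernel_def rel)
  with grp show "tensor_map A (tensor_bimodule A M N) P = tensor_map A (tensor_rmodule A M N) P"
    by (simp add: fun_eq_iff tensor_map_def)
  show "right_linear A L (tensor_bimodule A M N) = right_linear A L (tensor_rmodule A M N)"
    by (simp add: right_linear_def hom_def)
qed

context tensor_pair
begin

abbreviation tensor_ract (infixl "\<triangleleft>\<^sub>T" 70)
  where "t \<triangleleft>\<^sub>T a \<equiv> tensor_lift T (\<lambda>m n. m \<odot> (n \<triangleleft>\<^bsub>N\<^esub> a)) t"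

text \<open>Acting on the right factor commutes with the balancing relation because \<open>N\<close> is a bimodule.\<close>

lemma tensor_ract_balanced:
  "a \<in> carrier A \<Longrightarrow> balanced A M N T (\<lambda>m n. m \<odot> (n \<triangleleft>\<^bsub>N\<^esub> a))"
  by (rule balancedI)
     (simp_all add: pure_closed N.ract_closed pure_add_left N.ract_add pure_add_right pure_ract
        N.lact_ract)

lemmas tensor_ract_additive = lift_additive[OF T_abelian_group tensor_ract_balanced]
  and tensor_ract_pure = lift_pure[OF T_abelian_group tensor_ract_balanced]

lemma tensor_ract_right_module:
  assumes "t \<in> carrier T" "a \<in> carrier A" "b \<in> carrier A"
  shows "t \<triangleleft>\<^sub>T (a \<oplus>\<^bsub>A\<^esub> b) = t \<triangleleft>\<^sub>T a \<oplus>\<^bsub>T\<^esub> t \<triangleleft>\<^sub>T b"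
    and "(t \<triangleleft>\<^sub>T a) \<triangleleft>\<^sub>T b = t \<triangleleft>\<^sub>T (a \<otimes>\<^bsub>A\<^esub> b)"
proof -
  note [simp] = assms(2,3) tensor_ract_pure N.ract_closed pure_add_right N.ract_add_scalar
    N.ract_assoc
  show "t \<triangleleft>\<^sub>T (a \<oplus>\<^bsub>A\<^esub> b) = t \<triangleleft>\<^sub>T a \<oplus>\<^bsub>T\<^esub> t \<triangleleft>\<^sub>T b"
    by (rule additive_eqI[OF assms(1) tensor_ract_additive
          T.additive_sum[OF tensor_ract_additive tensor_ract_additive]]) simp_all
  show "(t \<triangleleft>\<^sub>T a) \<triangleleft>\<^sub>T b = t \<triangleleft>\<^sub>T (a \<otimes>\<^bsub>A\<^esub> b)"
    by (rule additive_eqI[OF assms(1) additive_comp[OF tensor_ract_additive tensor_ract_additive]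
          tensor_ract_additive]) simp_all
qed

lemma tensor_ract_one: "t \<in> carrier T \<Longrightarrow> t \<triangleleft>\<^sub>T \<one>\<^bsub>A\<^esub> = t"
  by (rule additive_eqI[OF _ tensor_ract_additive additive_id])
     (simp_all add: tensor_ract_pure N.ract_one)

lemma tensor_right_module: "right_module A (tensor_rmodule A M N)"
  by (intro right_module.intro right_module_axioms.intro M.A.ring_axioms
      abelian_group_transfer[OF T_abelian_group])
     (simp_all add: additive_closed[OF tensor_ract_additive] additive_add[OF tensor_ract_additive]
      tensor_ract_right_module tensor_ract_one)

end

locale bimodule_pair = tensor_pair A M N + L: abimodule A M
  for A :: "('a, 'x) ring_scheme"
    and M :: "('a, 'm, 'y) bimodule_scheme"
    and N :: "('a, 'n, 'z) bimodule_scheme"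
begin

abbreviation tensor_lact (infixr "\<triangleright>\<^sub>T" 70)
  where "a \<triangleright>\<^sub>T t \<equiv> tensor_lift T (\<lambda>m n. (a \<triangleright>\<^bsub>M\<^esub> m) \<odot> n) t"

lemma tensor_lact_balanced:
  "a \<in> carrier A \<Longrightarrow> balanced A M N T (\<lambda>m n. (a \<triangleright>\<^bsub>M\<^esub> m) \<odot> n)"
  by (rule balancedI)
     (simp_all add: pure_closed L.lact_closed pure_add_left L.lact_add pure_add_right pure_ract
        L.lact_ract[symmetric])

lemmas tensor_lact_additive = lift_additive[OF T_abelian_group tensor_lact_balanced]
  and tensor_lact_pure = lift_pure[OF T_abelian_group tensor_lact_balanced]

lemma tensor_abimodule: "abimodule A (tensor_bimodule A M N)"
proof (intro abimodule.intro abimodule_axioms.intro)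
  show "right_module A (tensor_bimodule A M N)"
    by (intro right_module.intro right_module_axioms.intro M.A.ring_axioms
        abelian_group_transfer[OF T_abelian_group])
       (simp_all add: additive_closed[OF tensor_ract_additive]
        additive_add[OF tensor_ract_additive] tensor_ract_right_module tensor_ract_one)
next
  note [simp] = tensor_lact_pure tensor_ract_pure L.lact_closed N.ract_closed pure_add_left
    L.lact_add_scalar L.lact_assoc L.lact_one pure_closed
  fix a b t assume a: "a \<in> carrier A" and b: "b \<in> carrier A" 
    and "t \<in> carrier (tensor_bimodule A M N)"
  then have t: "t \<in> carrier T" by simp
  note [simp] = a b
  have "(a \<oplus>\<^bsub>A\<^esub> b) \<triangleright>\<^sub>T t = a \<triangleright>\<^sub>T t \<oplus>\<^bsub>T\<^esub> b \<triangleright>\<^sub>T t"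
    by (rule additive_eqI[OF t tensor_lact_additive
          T.additive_sum[OF tensor_lact_additive tensor_lact_additive]]) simp_all
  then show "(a \<oplus>\<^bsub>A\<^esub> b) \<triangleright>\<^bsub>tensor_bimodule A M N\<^esub> t =
    (a \<triangleright>\<^bsub>tensor_bimodule A M N\<^esub> t) \<oplus>\<^bsub>tensor_bimodule A M N\<^esub> (b \<triangleright>\<^bsub>tensor_bimodule A M N\<^esub> t)"
    by simp
  have "a \<triangleright>\<^sub>T b \<triangleright>\<^sub>T t = (a \<otimes>\<^bsub>A\<^esub> b) \<triangleright>\<^sub>T t"
    by (rule additive_eqI[OF t additive_comp[OF tensor_lact_additive tensor_lact_additive]
          tensor_lact_additive]) simp_all
  then show "a \<triangleright>\<^bsub>tensor_bimodule A M N\<^esub> b \<triangleright>\<^bsub>tensor_bimodule A M N\<^esub> t =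
      (a \<otimes>\<^bsub>A\<^esub> b) \<triangleright>\<^bsub>tensor_bimodule A M N\<^esub> t"
    by simp
next
  note [simp] = tensor_lact_pure tensor_ract_pure L.lact_closed N.ract_closed pure_add_left
    L.lact_add_scalar L.lact_assoc L.lact_one pure_closed
  fix a t b assume a: "a \<in> carrier A" and b: "b \<in> carrier A" 
    and "t \<in> carrier (tensor_bimodule A M N)"
  then have t: "t \<in> carrier T" by simp
  note [simp] = a b
  have "(a \<triangleright>\<^sub>T t) \<triangleleft>\<^sub>T b = a \<triangleright>\<^sub>T (t \<triangleleft>\<^sub>T b)"
    by (rule additive_eqI[OF t additive_comp[OF tensor_lact_additive tensor_ract_additive]
          additive_comp[OF tensor_ract_additive tensor_lact_additive]]) simp_all
  then show "(a \<triangleright>\<^bsub>tensor_bimodule A M N\<^esub> t) \<triangleleft>\<^bsub>tensor_bimodule A M N\<^esub> b =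
      a \<triangleright>\<^bsub>tensor_bimodule A M N\<^esub> (t \<triangleleft>\<^bsub>tensor_bimodule A M N\<^esub> b)"
    by simp
next
  fix t assume "t \<in> carrier (tensor_bimodule A M N)"
  then have t: "t \<in> carrier T" by simp
  have "\<one>\<^bsub>A\<^esub> \<triangleright>\<^sub>T t = t"
    by (rule additive_eqI[OF t tensor_lact_additive additive_id])
       (simp_all add: tensor_lact_pure L.lact_one)
  then show "\<one>\<^bsub>A\<^esub> \<triangleright>\<^bsub>tensor_bimodule A M N\<^esub> t = t" by simp
qed (simp_all add: additive_closed[OF tensor_lact_additive] additive_add[OF tensor_lact_additive])

end

section \<open>Maps between tensor products\<close>

context
  fixes A :: "('a, 'x) ring_scheme"
    and M :: "('a, 'm, 'y) rmodule_scheme" and N :: "('a, 'n, 'z) bimodule_scheme"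
    and M' :: "('a, 'm2, 'y2) rmodule_scheme" and N' :: "('a, 'n2, 'z2) bimodule_scheme"
    and \<phi> \<psi>
  assumes dom: "tensor_pair A M N" and cod: "tensor_pair A M' N'"
    and \<phi>: "\<phi> \<in> right_linear A M M'" and \<psi>: "\<psi> \<in> left_linear A N N'"
begin

interpretation D: tensor_pair A M N by (rule dom)
interpretation E: tensor_pair A M' N' by (rule cod)

lemma tensor_map_balanced: "balanced A M N E.T (\<lambda>m n. pure_tensor A M' N' (\<phi> m) (\<psi> n))"
  by (rule balancedI)
     (simp_all add: E.pure_closed right_linearD[OF \<phi>] left_linearD[OF \<psi>] E.pure_add_left
        E.pure_add_right E.pure_ract)

lemma tensor_map_additive: "tensor_map A M' N' \<phi> \<psi> \<in> additive (tensor_group A M N) (tensor_group A M' N')"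
  unfolding tensor_map_def by (rule D.lift_additive[OF E.T_abelian_group tensor_map_balanced])

lemma tensor_map_pure:
  "m \<in> carrier M \<Longrightarrow> n \<in> carrier N \<Longrightarrow>
    tensor_map A M' N' \<phi> \<psi> (pure_tensor A M N m n) = pure_tensor A M' N' (\<phi> m) (\<psi> n)"
  unfolding tensor_map_def by (rule D.lift_pure[OF E.T_abelian_group tensor_map_balanced])

end

locale tensor_triple = LM: tensor_pair A L M + MN: bimodule_pair A M N
  for A :: "('a, 'x) ring_scheme"
    and L :: "('a, 'l, 'w) rmodule_scheme"
    and M :: "('a, 'm, 'y) bimodule_scheme"
    and N :: "('a, 'n, 'z) bimodule_scheme"
begin

abbreviation "TLM \<equiv> tensor_rmodule A L M"
abbreviation "TMN \<equiv> tensor_bimodule A M N"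

sublocale LM_N: tensor_pair A TLM N
  by (intro tensor_pair.intro LM.tensor_right_module MN.N.abimodule_axioms)

sublocale L_MN: tensor_pair A L TMN
  by (intro tensor_pair.intro LM.M.right_module_axioms MN.tensor_abimodule)

abbreviation "assoc_inner n \<equiv> tensor_lift L_MN.T (\<lambda>l m. L_MN.pure l (MN.pure m n))"

text \<open>The map \<open>tensor_assoc\<close> is a lift whose values are lifts, so balancedness is needed twice: for a
fixed \<open>n\<close> in the variables \<open>l\<close> and \<open>m\<close>, and then in \<open>l \<otimes> m\<close> and \<open>n\<close>.\<close>

lemma inner_balanced:
  assumes n: "n \<in> carrier N"
  shows "balanced A L M L_MN.T (\<lambda>l m. L_MN.pure l (MN.pure m n))"
proof (rule balancedI)
  fix l m m' assume "l \<in> carrier L" "m \<in> carrier M" "m' \<in> carrier M"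
  then show "L_MN.pure l (MN.pure (m \<oplus>\<^bsub>M\<^esub> m') n) =
      L_MN.pure l (MN.pure m n) \<oplus>\<^bsub>L_MN.T\<^esub> L_MN.pure l (MN.pure m' n)"
    using n L_MN.pure_add_right[of l "MN.pure m n" "MN.pure m' n"]
    by (simp add: MN.pure_add_left MN.pure_closed)
next
  fix l a m assume "l \<in> carrier L" "a \<in> carrier A" "m \<in> carrier M"
  then show "L_MN.pure (l \<triangleleft>\<^bsub>L\<^esub> a) (MN.pure m n) = L_MN.pure l (MN.pure (a \<triangleright>\<^bsub>M\<^esub> m) n)"
    using n by (simp add: L_MN.pure_ract MN.pure_closed MN.tensor_lact_pure)
qed (simp_all add: L_MN.pure_closed L_MN.pure_add_left MN.pure_closed n)

lemmas inner_additive = LM.lift_additive[OF L_MN.T_abelian_group inner_balanced]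
  and inner_pure = LM.lift_pure[OF L_MN.T_abelian_group inner_balanced]

lemma assoc_balanced: "balanced A TLM N L_MN.T (\<lambda>s n. assoc_inner n s)"
proof (rule balancedI)
  fix s n n' assume "s \<in> carrier TLM" and n: "n \<in> carrier N" "n' \<in> carrier N"
  then have s: "s \<in> carrier LM.T" by simp
  have nn: "n \<oplus>\<^bsub>N\<^esub> n' \<in> carrier N" using n by simp
  have pure: "L_MN.pure l (MN.pure m (n \<oplus>\<^bsub>N\<^esub> n')) =
      L_MN.pure l (MN.pure m n) \<oplus>\<^bsub>L_MN.T\<^esub> L_MN.pure l (MN.pure m n')"
    if "l \<in> carrier L" "m \<in> carrier M" for l m
    using n that L_MN.pure_add_right[of l "MN.pure m n" "MN.pure m n'"]
    by (simp add: MN.pure_add_right MN.pure_closed)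
  show "assoc_inner (n \<oplus>\<^bsub>N\<^esub> n') s = assoc_inner n s \<oplus>\<^bsub>L_MN.T\<^esub> assoc_inner n' s"
    by (rule LM.additive_eqI[OF s inner_additive[OF nn]
          L_MN.T.additive_sum[OF inner_additive[OF n(1)] inner_additive[OF n(2)]]])
       (simp only: inner_pure n nn pure)
next
  fix s a n assume "s \<in> carrier TLM" and a: "a \<in> carrier A" and n: "n \<in> carrier N"
  then have s: "s \<in> carrier LM.T" by simp
  have an: "a \<triangleright>\<^bsub>N\<^esub> n \<in> carrier N" using a n by (rule MN.N.lact_closed)
  have "assoc_inner n (LM.tensor_ract s a) = assoc_inner (a \<triangleright>\<^bsub>N\<^esub> n) s"
    by (rule LM.additive_eqI[OF s additive_comp[OF LM.tensor_ract_additive[OF a]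
            inner_additive[OF n]] inner_additive[OF an]])
       (simp only: inner_pure LM.tensor_ract_pure LM.N.ract_closed MN.pure_ract a n an)
  then show "assoc_inner n (s \<triangleleft>\<^bsub>TLM\<^esub> a) = assoc_inner (a \<triangleright>\<^bsub>N\<^esub> n) s" by simp
qed (simp_all only: tensor_rmodule_simps additive_closed[OF inner_additive]
       additive_add[OF inner_additive])

lemma assoc_additive: "tensor_assoc A L M N \<in> additive LM_N.T L_MN.T"
  using LM_N.lift_additive[OF L_MN.T_abelian_group assoc_balanced]
  by (simp add: tensor_assoc_def[abs_def] Let_def)

lemma assoc_pure:
  "s \<in> carrier LM.T \<Longrightarrow> n \<in> carrier N \<Longrightarrow> tensor_assoc A L M N (LM_N.pure s n) = assoc_inner n s"
  using LM_N.lift_pure[OF L_MN.T_abelian_group assoc_balanced]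
  by (simp add: tensor_assoc_def[abs_def] Let_def)

end

section \<open>Contraction with a left linear form\<close>

abbreviation left_forms :: "('a, 'x) ring_scheme \<Rightarrow> ('a, 'm, 'y) bimodule_scheme \<Rightarrow> ('m \<Rightarrow> 'a) set"
  where "left_forms A M \<equiv> left_linear A M (regular_bimodule A)"

lemma left_formsD:
  assumes "f \<in> left_forms A M"
  shows "m \<in> carrier M \<Longrightarrow> f m \<in> carrier A"
    and "m \<in> carrier M \<Longrightarrow> n \<in> carrier M \<Longrightarrow> f (m \<oplus>\<^bsub>M\<^esub> n) = f m \<oplus>\<^bsub>A\<^esub> f n"
    and "m \<in> carrier M \<Longrightarrow> a \<in> carrier A \<Longrightarrow> f (a \<triangleright>\<^bsub>M\<^esub> m) = a \<otimes>\<^bsub>A\<^esub> f m"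
  using left_linearD[OF assms] by simp_all

lemma left_formsI:
  assumes "\<And>m. m \<in> carrier M \<Longrightarrow> f m \<in> carrier A"
    and "\<And>m n. m \<in> carrier M \<Longrightarrow> n \<in> carrier M \<Longrightarrow> f (m \<oplus>\<^bsub>M\<^esub> n) = f m \<oplus>\<^bsub>A\<^esub> f n"
    and "\<And>m a. m \<in> carrier M \<Longrightarrow> a \<in> carrier A \<Longrightarrow> f (a \<triangleright>\<^bsub>M\<^esub> m) = a \<otimes>\<^bsub>A\<^esub> f m"
  shows "f \<in> left_forms A M"
  using assms by (auto simp: left_linear_def hom_def)

text \<open>This is \<open>M \<otimes> f\<close> followed by the canonical map \<open>M \<otimes> A \<rightarrow> M\<close>.\<close>

definition contract ::
  "('a, 'm, 'y) rmodule_scheme \<Rightarrow> ('n \<Rightarrow> 'a) \<Rightarrow> ('m, 'n) tensor \<Rightarrow> 'm"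
  where "contract M f t = tensor_lift M (\<lambda>m n. m \<triangleleft>\<^bsub>M\<^esub> f n) t"

context tensor_pair
begin

lemma contract_balanced: "f \<in> left_forms A N \<Longrightarrow> balanced A M N M (\<lambda>m n. m \<triangleleft>\<^bsub>M\<^esub> f n)"
  by (rule balancedI)
     (simp_all add: left_formsD M.ract_closed M.ract_add M.ract_add_scalar M.ract_assoc)

lemma contract_additive: "f \<in> left_forms A N \<Longrightarrow> contract M f \<in> additive T M"
  using lift_additive[OF M.M.abelian_group_axioms contract_balanced, of f]
  by (simp add: contract_def[abs_def])

lemma contract_pure:
  "f \<in> left_forms A N \<Longrightarrow> m \<in> carrier M \<Longrightarrow> n \<in> carrier N \<Longrightarrow> contract M f (m \<odot> n) = m \<triangleleft>\<^bsub>M\<^esub> f n"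
  using lift_pure[OF M.M.abelian_group_axioms contract_balanced, of f]
  by (simp add: contract_def)

lemmas contract_closed = additive_closed[OF contract_additive]

lemma contract_cong:
  assumes "f \<in> left_forms A N" "\<And>n. n \<in> carrier N \<Longrightarrow> f n = g n" "t \<in> carrier T"
  shows "contract M f t = contract M g t"
proof -
  have g: "g \<in> left_forms A N"
    by (rule left_linear_cong[OF assms(1) N.abimodule_axioms assms(2)])
  show ?thesis
    by (rule additive_eqI[OF assms(3) contract_additive[OF assms(1)] contract_additive[OF g]])
       (simp add: contract_pure assms(1,2) g)
qed

lemma form_ract: "f \<in> left_forms A N \<Longrightarrow> a \<in> carrier A \<Longrightarrow> (\<lambda>n. f (n \<triangleleft>\<^bsub>N\<^esub> a)) \<in> left_forms A N"
  by (rule left_formsI) (simp_all add: left_formsD N.ract_closed N.ract_add N.lact_ract)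

lemma form_scale: "f \<in> left_forms A N \<Longrightarrow> a \<in> carrier A \<Longrightarrow> (\<lambda>n. f n \<otimes>\<^bsub>A\<^esub> a) \<in> left_forms A N"
  by (rule left_formsI) (simp_all add: left_formsD M.A.l_distr M.A.m_assoc)

lemma form_add:
  "f \<in> left_forms A N \<Longrightarrow> g \<in> left_forms A N \<Longrightarrow> (\<lambda>n. f n \<oplus>\<^bsub>A\<^esub> g n) \<in> left_forms A N"
  by (rule left_formsI) (simp_all add: left_formsD M.A.r_distr M.A.a_ac)

lemma contract_ract:
  assumes "f \<in> left_forms A N" "a \<in> carrier A" "t \<in> carrier T"
  shows "contract M f (t \<triangleleft>\<^sub>T a) = contract M (\<lambda>n. f (n \<triangleleft>\<^bsub>N\<^esub> a)) t"
  by (rule additive_eqI[OF assms(3)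
        additive_comp[OF tensor_ract_additive contract_additive] contract_additive])
     (simp_all add: assms form_ract contract_pure tensor_ract_pure N.ract_closed)

lemma contract_scale:
  assumes "f \<in> left_forms A N" "a \<in> carrier A" "t \<in> carrier T"
  shows "contract M (\<lambda>n. f n \<otimes>\<^bsub>A\<^esub> a) t = contract M f t \<triangleleft>\<^bsub>M\<^esub> a"
  by (rule additive_eqI[OF assms(3) contract_additive
        additive_comp[OF contract_additive M.ract_additive]])
     (simp_all add: assms form_scale contract_pure left_formsD[OF assms(1)] M.ract_assoc)

lemma contract_add:
  assumes "f \<in> left_forms A N" "g \<in> left_forms A N" "t \<in> carrier T"
  shows "contract M (\<lambda>n. f n \<oplus>\<^bsub>A\<^esub> g n) t = contract M f t \<oplus>\<^bsub>M\<^esub> contract M g t"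
  by (rule additive_eqI[OF assms(3) contract_additive
        M.M.additive_sum[OF contract_additive contract_additive]])
     (simp_all add: assms form_add contract_pure left_formsD[OF assms(1)]
        left_formsD[OF assms(2)] M.ract_add_scalar)

lemma contract_zero:
  assumes "\<And>n. n \<in> carrier N \<Longrightarrow> f n = \<zero>\<^bsub>A\<^esub>" "t \<in> carrier T"
  shows "contract M f t = \<zero>\<^bsub>M\<^esub>"
proof -
  have f: "f \<in> left_forms A N"
    using assms(1) by (intro left_formsI) (simp_all add: N.lact_closed)
  show ?thesis using assms(2)
    by (induction rule: tensor_induct)
       (simp_all add: contract_pure f assms(1) M.ract_zero additive_add[OF contract_additive])
qed

lemma contract_natural:
  assumes M': "right_module A M'" and \<phi>: "\<phi> \<in> right_linear A M M'"
    and f: "f \<in> left_forms A N" and t: "t \<in> carrier T"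
  shows "contract M' f (tensor_map A M' N \<phi> (\<lambda>n. n) t) = \<phi> (contract M f t)"
proof -
  interpret E: tensor_pair A M' N
    by (intro tensor_pair.intro M' N.abimodule_axioms)
  note pp = tensor_pair_axioms E.tensor_pair_axioms \<phi> id_left_linear
  show ?thesis
    by (rule additive_eqI[OF t
          additive_comp[OF tensor_map_additive[OF pp] E.contract_additive[OF f]]
          additive_comp[OF contract_additive[OF f] right_linearD(1)[OF \<phi>]]])
       (simp add: tensor_map_pure[OF pp] E.contract_pure[OF f] contract_pure[OF f]
          right_linearD[OF \<phi>] left_formsD[OF f])
qed

lemma contract_tensor_map_right:
  assumes N': "abimodule A N'" and \<psi>: "\<psi> \<in> left_linear A N N'"
    and f: "f \<in> left_forms A N'" and t: "t \<in> carrier T"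
  shows "contract M f (tensor_map A M N' (\<lambda>m. m) \<psi> t) = contract M (\<lambda>n. f (\<psi> n)) t"
proof -
  interpret E: tensor_pair A M N'
    by (intro tensor_pair.intro M.right_module_axioms N')
  note pp = tensor_pair_axioms E.tensor_pair_axioms id_right_linear \<psi>
  note f\<psi> = left_linear_comp[OF \<psi> f]
  show ?thesis
    by (rule additive_eqI[OF t
          additive_comp[OF tensor_map_additive[OF pp] E.contract_additive[OF f]]
          contract_additive[OF f\<psi>]])
       (simp add: tensor_map_pure[OF pp] E.contract_pure[OF f] contract_pure[OF f\<psi>]
          left_linearD[OF \<psi>])
qed

text \<open>The right counit axiom thus says that contracting with the counit undoes the coaction.\<close>

lemma runit_tensor_map:
  assumes f: "f \<in> left_forms A N" and t: "t \<in> carrier T"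
  shows "tensor_runit M (tensor_map A M (regular_bimodule A) (\<lambda>m. m) f t) = contract M f t"
proof -
  have "tensor_runit M = contract M (\<lambda>a. a)"
    by (simp add: fun_eq_iff tensor_runit_def contract_def)
  then show ?thesis
    using contract_tensor_map_right[OF regular_abimodule[OF M.A.ring_axioms] f id_left_linear t]
    by simp
qed

text \<open>On pure tensors both sides are \<open>f(e(m) n) = e(m) f(n) = e(m f(n))\<close>. With \<open>e\<close> the counit, this turns
the left counit axiom into the right unit law of the convolution of forms.\<close>

lemma form_lunit_tensor_map:
  assumes e: "e \<in> right_linear A M (regular_bimodule A)" and f: "f \<in> left_forms A N"
    and t: "t \<in> carrier T"
  shows "f (tensor_lunit N (tensor_map A (regular_bimodule A) N e (\<lambda>n. n) t)) = e (contract M f t)"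
proof -
  interpret E: tensor_pair A "regular_bimodule A" N
    by (intro tensor_pair.intro abimodule_right[OF regular_abimodule[OF M.A.ring_axioms]]
        N.abimodule_axioms)
  note pp = tensor_pair_axioms E.tensor_pair_axioms e id_left_linear
  have bal: "balanced A (regular_bimodule A) N N (\<lambda>a n. a \<triangleright>\<^bsub>N\<^esub> n)"
    by (rule balancedI) (simp_all add: N.lact_closed N.lact_add N.lact_add_scalar N.lact_assoc)
  have lunit: "tensor_lunit N \<in> additive E.T N"
    using E.lift_additive[OF N.M.abelian_group_axioms bal] by (simp add: tensor_lunit_def[abs_def])
  have lunit_pure: "tensor_lunit N (E.pure a n) = a \<triangleright>\<^bsub>N\<^esub> n" if "a \<in> carrier A" "n \<in> carrier N" for a n
    using E.lift_pure[OF N.M.abelian_group_axioms bal] that by (simp add: tensor_lunit_def)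
  have fa: "f \<in> additive N A" and ea: "e \<in> additive M A"
    using left_linearD(1)[OF f] right_linearD(1)[OF e] by (simp_all add: additive_transfer[of "regular_bimodule A" A])
  show ?thesis
    by (rule additive_eqI[OF t additive_comp[OF additive_comp[OF tensor_map_additive[OF pp] lunit] fa]
          additive_comp[OF contract_additive[OF f] ea]])
       (use right_linearD[OF e] in \<open>simp add: tensor_map_pure[OF pp] lunit_pure left_formsD[OF f]
          contract_pure[OF f]\<close>)
qed

end

text \<open>Hence \<open>f \<circ> contract M g\<close> is again a left linear form, so forms on \<open>M\<close> and \<open>N\<close> yield forms on \<open>M \<otimes> N\<close>.\<close>

lemma (in bimodule_pair) contract_left_linear:
  assumes f: "f \<in> left_forms A N"
  shows "contract M f \<in> left_linear A (tensor_bimodule A M N) M"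
proof -
  have "contract M f (a \<triangleright>\<^sub>T t) = a \<triangleright>\<^bsub>M\<^esub> contract M f t" if "a \<in> carrier A" and t: "t \<in> carrier T" for a t
    using t by (induction rule: tensor_induct)
      (simp_all add: that contract_pure[OF f] tensor_lact_pure L.lact_closed L.lact_ract
         left_formsD[OF f] additive_add[OF contract_additive[OF f]] L.lact_add
         contract_closed[OF f] additive_add[OF tensor_lact_additive]
         additive_closed[OF tensor_lact_additive])
  then show ?thesis
    using contract_additive[OF f] by (simp add: left_linear_def additive_def hom_def)
qed

text \<open>Both sides send \<open>(l \<otimes> m) \<otimes> n\<close> to \<open>l f(m g(n))\<close>.\<close>

lemma (in tensor_triple) contract_assoc:
  assumes f: "f \<in> left_forms A M" and g: "g \<in> left_forms A N" and u: "u \<in> carrier LM_N.T"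
  shows "contract L (\<lambda>s. f (contract M g s)) (tensor_assoc A L M N u) =
    contract L f (contract TLM g u)"
proof -
  have fg: "(\<lambda>s. f (contract M g s)) \<in> left_forms A TMN"
    by (rule left_linear_comp[OF MN.contract_left_linear[OF g] f])
  have add: "contract TLM g \<in> additive LM_N.T LM.T"
    using LM_N.contract_additive[OF g] by (simp only: additive_transfer[of TLM LM.T] tensor_rmodule_simps)
  have inner: "contract L (\<lambda>s. f (contract M g s)) (assoc_inner n s) =
      contract L f (LM.tensor_ract s (g n))" if n: "n \<in> carrier N" and s: "s \<in> carrier LM.T" for s n
    by (rule LM.additive_eqI[OF s additive_comp[OF inner_additive[OF n] L_MN.contract_additive[OF fg]]
          additive_comp[OF LM.tensor_ract_additive LM.contract_additive[OF f]]])
       (simp_all only: left_formsD[OF g] n inner_pure L_MN.contract_pure[OF fg] MN.pure_closed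
          MN.contract_pure[OF g] LM.tensor_ract_pure LM.contract_pure[OF f] LM.N.ract_closed
          tensor_bimodule_simps)
  have pure: "contract L (\<lambda>s. f (contract M g s)) (tensor_assoc A L M N (LM_N.pure s n)) =
      contract L f (contract TLM g (LM_N.pure s n))"
    if s: "s \<in> carrier TLM" and n: "n \<in> carrier N" for s n
  proof -
    have "tensor_assoc A L M N (LM_N.pure s n) = assoc_inner n s"
      using s n by (intro assoc_pure) (simp_all only: tensor_rmodule_simps)
    moreover have "contract TLM g (LM_N.pure s n) = LM.tensor_ract s (g n)"
      using LM_N.contract_pure[OF g s n] by (simp only: tensor_rmodule_simps)
    ultimately show ?thesis
      using s n by (simp only: inner tensor_rmodule_simps)
  qed
  show ?thesis
    by (rule LM_N.additive_eqI[OF u additive_comp[OF assoc_additive L_MN.contract_additive[OF fg]]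
          additive_comp[OF add LM.contract_additive[OF f]] pure])
qed

section \<open>Finitely generated projective modules\<close>

text \<open>The coordinate description of a finitely generated projective left module.\<close>

definition dual_basis ::
  "('a, 'x) ring_scheme \<Rightarrow> ('a, 'n, 'z) bimodule_scheme \<Rightarrow> 'j set \<Rightarrow> ('j \<Rightarrow> 'n) \<Rightarrow> ('j \<Rightarrow> 'n \<Rightarrow> 'a) \<Rightarrow> bool"
  where "dual_basis A N J e f \<longleftrightarrow> finite J \<and>
    (\<forall>j \<in> J. e j \<in> carrier N \<and> f j \<in> left_forms A N) \<and>
    (\<forall>x \<in> carrier N. x = (\<Oplus>\<^bsub>N\<^esub>j\<in>J. f j x \<triangleright>\<^bsub>N\<^esub> e j))"

context abimodule
begin

lemma lact_scalar_additive: "m \<in> carrier M \<Longrightarrow> (\<lambda>a. a \<triangleright>\<^bsub>M\<^esub> m) \<in> additive A M"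
  by (rule additiveI) (simp_all add: lact_closed lact_add_scalar)

lemma lact_zero: "m \<in> carrier M \<Longrightarrow> \<zero>\<^bsub>A\<^esub> \<triangleright>\<^bsub>M\<^esub> m = \<zero>\<^bsub>M\<^esub>"
  using additive_zero[OF lact_scalar_additive A.is_abelian_group M.abelian_group_axioms] .

lemma form_additive: "f \<in> left_forms A M \<Longrightarrow> f \<in> additive M A"
  by (rule additiveI) (simp_all add: left_formsD)

lemma form_zero: "f \<in> left_forms A M \<Longrightarrow> f \<zero>\<^bsub>M\<^esub> = \<zero>\<^bsub>A\<^esub>"
  using additive_zero[OF form_additive M.abelian_group_axioms A.is_abelian_group] .

text \<open>The module is a summand of a free module, embedded by \<open>i\<close> and recovered by \<open>p\<close>. Finitely many
generators have finitely many nonzero coordinates altogether, so all of \<open>i(M)\<close> lies in the span of a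
finite set of unit vectors. The coordinates and the images of the unit vectors under \<open>p\<close> are dual.\<close>

lemma dual_basis_exists:
  assumes "finitely_generated_left A M" "projective_left A M"
  shows "\<exists>(J :: 'm set) e f. dual_basis A M J e f"
proof -
  obtain S where S: "finite S" "S \<subseteq> carrier M"
    and gen: "\<And>x. x \<in> carrier M \<Longrightarrow> \<exists>a \<in> S \<rightarrow> carrier A. x = (\<Oplus>\<^bsub>M\<^esub>s\<in>S. a s \<triangleright>\<^bsub>M\<^esub> s)"
    using assms(1) by (auto simp: finitely_generated_left_def)
  obtain I :: "'m set" and i p where i: "i \<in> left_linear A M (free_bimodule A I)"
    and p: "p \<in> left_linear A (free_bimodule A I) M"
    and pi: "\<And>x. x \<in> carrier M \<Longrightarrow> p (i x) = x"
    using assms(2) by (auto simp: projective_left_def)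
  define F where "F = free_bimodule A I"
  have F: "carrier F = {x \<in> I \<rightarrow>\<^sub>E carrier A. finite {i \<in> I. x i \<noteq> \<zero>\<^bsub>A\<^esub>}}"
    "ring.add F = (\<lambda>x y. \<lambda>i \<in> I. x i \<oplus>\<^bsub>A\<^esub> y i)" "lact F = (\<lambda>a x. \<lambda>i \<in> I. a \<otimes>\<^bsub>A\<^esub> x i)"
    by (simp_all add: F_def free_bimodule_def)
  note iD = left_linearD[OF i, folded F_def] and pD = left_linearD[OF p, folded F_def]
  define J where "J = (\<Union>s\<in>S. {k \<in> I. i s k \<noteq> \<zero>\<^bsub>A\<^esub>})"
  define \<delta> where "\<delta> j = (\<lambda>k\<in>I. if k = j then \<one>\<^bsub>A\<^esub> else \<zero>\<^bsub>A\<^esub>)" for j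
  have J: "finite J" "J \<subseteq> I"
    unfolding J_def using S iD(2) by (auto simp: F)
  have \<delta>: "\<delta> j \<in> carrier F" for j
    by (auto simp: F \<delta>_def intro: finite_subset[of _ "{j}"])
  have form: "(\<lambda>x. i x k) \<in> left_forms A M" if "k \<in> I" for k
    using that iD by (intro left_formsI) (auto simp: F)
  have supp: "i x k = \<zero>\<^bsub>A\<^esub>" if x: "x \<in> carrier M" and k: "k \<in> I - J" for x k
  proof -
    obtain a where a: "a \<in> S \<rightarrow> carrier A" "x = (\<Oplus>\<^bsub>M\<^esub>s\<in>S. a s \<triangleright>\<^bsub>M\<^esub> s)" using gen[OF x] by auto
    have aS: "(\<lambda>s. a s \<triangleright>\<^bsub>M\<^esub> s) \<in> S \<rightarrow> carrier M" using a S by (auto simp: Pi_iff lact_closed)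
    have kI: "k \<in> I" using k by simp
    have "i x k = (\<Oplus>\<^bsub>A\<^esub>s\<in>S. i (a s \<triangleright>\<^bsub>M\<^esub> s) k)" unfolding a(2)
      by (rule additive_finsum[OF form_additive[OF form[OF kI]] M.abelian_group_axioms
            A.is_abelian_group S(1) aS])
    also have "\<dots> = (\<Oplus>\<^bsub>A\<^esub>s\<in>S. \<zero>\<^bsub>A\<^esub>)"
      using k S a(1) left_formsD(3)[OF form[OF kI]]
      by (intro A.finsum_cong') (auto simp: J_def Pi_iff subset_iff)
    finally show ?thesis by (simp add: A.finsum_zero)
  qed
  \<comment> \<open>Induction on the support of \<open>y\<close>, removing one coordinate at a time by linearity of \<open>p\<close>.\<close>
  have expand: "p y = (\<Oplus>\<^bsub>M\<^esub>j\<in>J'. y j \<triangleright>\<^bsub>M\<^esub> p (\<delta> j))"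
    if "finite J'" "J' \<subseteq> I" "y \<in> carrier F" "\<And>k. k \<in> I - J' \<Longrightarrow> y k = \<zero>\<^bsub>A\<^esub>" for J' y
    using that
  proof (induction J' arbitrary: y rule: finite_induct)
    case empty
    have "y = \<zero>\<^bsub>A\<^esub> \<triangleright>\<^bsub>F\<^esub> y"
      using empty by (auto simp: F fun_eq_iff PiE_iff extensional_def)
    then have "p y = \<zero>\<^bsub>A\<^esub> \<triangleright>\<^bsub>M\<^esub> p y" using pD(4)[OF empty(2), of "\<zero>\<^bsub>A\<^esub>"] by simp
    then show ?case using pD(2)[OF empty(2)] by (simp add: lact_zero)
  next
    case (insert j J')
    define y' where "y' = (\<lambda>k\<in>I. if k = j then \<zero>\<^bsub>A\<^esub> else y k)"
    have yA: "y k \<in> carrier A" if "k \<in> I" for k using insert.prems(2) that by (auto simp: F)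
    have y': "y' \<in> carrier F"
      using insert.prems(2) by (auto simp: F y'_def elim: rev_finite_subset)
    have jI: "j \<in> I" using insert by simp
    have j: "y j \<triangleright>\<^bsub>F\<^esub> \<delta> j \<in> carrier F"
      using jI yA by (auto simp: F \<delta>_def intro: finite_subset[of _ "{j}"])
    have "y = y j \<triangleright>\<^bsub>F\<^esub> \<delta> j \<oplus>\<^bsub>F\<^esub> y'"
      using insert.prems(2) yA jI
      by (auto simp: F fun_eq_iff y'_def \<delta>_def PiE_iff extensional_def)
    then have "p y = p (y j \<triangleright>\<^bsub>F\<^esub> \<delta> j) \<oplus>\<^bsub>M\<^esub> p y'" using pD(3)[OF j y'] by simp
    also have "p (y j \<triangleright>\<^bsub>F\<^esub> \<delta> j) = y j \<triangleright>\<^bsub>M\<^esub> p (\<delta> j)" using pD(4)[OF \<delta>] yA[OF jI] by simp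
    also have "p y' = (\<Oplus>\<^bsub>M\<^esub>j\<in>J'. y' j \<triangleright>\<^bsub>M\<^esub> p (\<delta> j))"
      using insert by (intro insert.IH y') (auto simp: y'_def)
    also have "\<dots> = (\<Oplus>\<^bsub>M\<^esub>j\<in>J'. y j \<triangleright>\<^bsub>M\<^esub> p (\<delta> j))"
      using insert yA pD(2)[OF \<delta>]
      by (intro M.finsum_cong') (auto simp: y'_def lact_closed)
    finally show ?case
      using insert yA pD(2)[OF \<delta>] by (subst M.finsum_insert) (auto simp: lact_closed)
  qed
  have "dual_basis A M J (\<lambda>j. p (\<delta> j)) (\<lambda>j x. i x j)"
    unfolding dual_basis_def
  proof (intro conjI ballI)
    fix x assume x: "x \<in> carrier M"
    have "p (i x) = (\<Oplus>\<^bsub>M\<^esub>j\<in>J. i x j \<triangleright>\<^bsub>M\<^esub> p (\<delta> j))"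
      by (rule expand[OF J iD(2)[OF x] supp[OF x]])
    then show "x = (\<Oplus>\<^bsub>M\<^esub>j\<in>J. i x j \<triangleright>\<^bsub>M\<^esub> p (\<delta> j))" using pi[OF x] by simp
  next
    fix j assume "j \<in> J"
    then show "(\<lambda>x. i x j) \<in> left_forms A M" using J(2) by (intro form) auto
  qed (use J pD(2)[OF \<delta>] in auto)
  then show ?thesis by blast
qed

end

context tensor_pair
begin

text \<open>On pure tensors, \<open>m \<otimes> n = \<Sum>\<^sub>j m \<otimes> f\<^sub>j(n) e\<^sub>j = \<Sum>\<^sub>j m f\<^sub>j(n) \<otimes> e\<^sub>j\<close>.\<close>

lemma tensor_expansion:
  assumes b: "dual_basis A N J e f" and t: "t \<in> carrier T"
  shows "t = (\<Oplus>\<^bsub>T\<^esub>j\<in>J. contract M (f j) t \<odot> e j)"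
  using t
proof (induction rule: tensor_induct)
  have J: "finite J" and e: "\<And>j. j \<in> J \<Longrightarrow> e j \<in> carrier N"
    and f: "\<And>j. j \<in> J \<Longrightarrow> f j \<in> left_forms A N"
    and exp: "\<And>x. x \<in> carrier N \<Longrightarrow> x = (\<Oplus>\<^bsub>N\<^esub>j\<in>J. f j x \<triangleright>\<^bsub>N\<^esub> e j)"
    using b by (auto simp: dual_basis_def)
  {
    case (pure m n)
    have fe: "(\<lambda>j. f j n \<triangleright>\<^bsub>N\<^esub> e j) \<in> J \<rightarrow> carrier N"
      using pure by (auto intro!: N.lact_closed left_formsD(1)[OF f] e)
    have "m \<odot> n = m \<odot> (\<Oplus>\<^bsub>N\<^esub>j\<in>J. f j n \<triangleright>\<^bsub>N\<^esub> e j)" using exp[OF pure(2)] by simp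
    also have "\<dots> = (\<Oplus>\<^bsub>T\<^esub>j\<in>J. m \<odot> (f j n \<triangleright>\<^bsub>N\<^esub> e j))"
      by (rule additive_finsum[OF pure_additive_right[OF pure(1)] N.M.abelian_group_axioms
            T_abelian_group J fe])
    also have "\<dots> = (\<Oplus>\<^bsub>T\<^esub>j\<in>J. contract M (f j) (m \<odot> n) \<odot> e j)"
      using pure
      by (intro T.finsum_cong')
         (auto simp: contract_pure[OF f] pure_ract left_formsD(1)[OF f] e
           intro!: pure_closed M.ract_closed)
    finally show ?case .
  next
    case (add s t)
    have "(\<Oplus>\<^bsub>T\<^esub>j\<in>J. contract M (f j) (s \<oplus>\<^bsub>T\<^esub> t) \<odot> e j) =
        (\<Oplus>\<^bsub>T\<^esub>j\<in>J. contract M (f j) s \<odot> e j \<oplus>\<^bsub>T\<^esub> contract M (f j) t \<odot> e j)"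
      using add(1,2)
      by (intro T.finsum_cong')
         (auto simp: additive_add[OF contract_additive[OF f]] contract_closed[OF f] e pure_add_left
           intro!: pure_closed)
    also have "\<dots> = (\<Oplus>\<^bsub>T\<^esub>j\<in>J. contract M (f j) s \<odot> e j) \<oplus>\<^bsub>T\<^esub> (\<Oplus>\<^bsub>T\<^esub>j\<in>J. contract M (f j) t \<odot> e j)"
      using add(1,2) by (intro T.finsum_addf) (auto intro!: pure_closed contract_closed[OF f] e)
    finally show ?case using add(3,4) by simp
  }
qed

text \<open>A tensor is determined by finitely many contractions. The passage from modules back to comodules
rests on this.\<close>

lemma tensor_eqI:
  assumes b: "dual_basis A N J e f" and s: "s \<in> carrier T" and t: "t \<in> carrier T"
    and eq: "\<And>j. j \<in> J \<Longrightarrow> contract M (f j) s = contract M (f j) t"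
  shows "s = t"
proof -
  have "(\<Oplus>\<^bsub>T\<^esub>j\<in>J. contract M (f j) s \<odot> e j) = (\<Oplus>\<^bsub>T\<^esub>j\<in>J. contract M (f j) t \<odot> e j)"
    using b t by (intro T.finsum_cong')
      (auto simp: eq dual_basis_def intro!: pure_closed contract_closed)
  then show ?thesis
    using tensor_expansion[OF b s] tensor_expansion[OF b t] by simp
qed

end

text \<open>Expanding \<open>t\<close> along \<open>N\<close> and then its coefficients along \<open>M\<close> gives the basis \<open>d\<^sub>i \<otimes> e\<^sub>j\<close> with dual forms
\<open>m \<otimes> n \<mapsto> \<phi>\<^sub>i(m f\<^sub>j(n))\<close>. These are the forms that occur in \<open>contract_assoc\<close>, which makes the basis
usable for coassociativity.\<close>

lemma (in bimodule_pair) tensor_dual_basis: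
  assumes c: "dual_basis A M I d \<phi>" and b: "dual_basis A N J e f"
  shows "dual_basis A (tensor_bimodule A M N) (J \<times> I) (\<lambda>z. d (snd z) \<odot> e (fst z))
    (\<lambda>z t. \<phi> (snd z) (contract M (f (fst z)) t))"
  unfolding dual_basis_def
proof (intro conjI ballI)
  have J: "finite J" "\<And>j. j \<in> J \<Longrightarrow> e j \<in> carrier N" "\<And>j. j \<in> J \<Longrightarrow> f j \<in> left_forms A N"
    using b by (auto simp: dual_basis_def)
  have I: "finite I" "\<And>i. i \<in> I \<Longrightarrow> d i \<in> carrier M" "\<And>i. i \<in> I \<Longrightarrow> \<phi> i \<in> left_forms A M"
    "\<And>x. x \<in> carrier M \<Longrightarrow> x = (\<Oplus>\<^bsub>M\<^esub>i\<in>I. \<phi> i x \<triangleright>\<^bsub>M\<^esub> d i)"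
    using c by (auto simp: dual_basis_def)
  show "finite (J \<times> I)" using J I by simp
  fix z assume z: "z \<in> J \<times> I"
  then show "d (snd z) \<odot> e (fst z) \<in> carrier (tensor_bimodule A M N)"
    using J I by (auto intro!: pure_closed)
  show "(\<lambda>t. \<phi> (snd z) (contract M (f (fst z)) t)) \<in> left_forms A (tensor_bimodule A M N)"
    using z J I by (intro left_linear_comp[OF contract_left_linear]) auto
next
  have J: "finite J" "\<And>j. j \<in> J \<Longrightarrow> e j \<in> carrier N" "\<And>j. j \<in> J \<Longrightarrow> f j \<in> left_forms A N"
    using b by (auto simp: dual_basis_def)
  have I: "finite I" "\<And>i. i \<in> I \<Longrightarrow> d i \<in> carrier M" "\<And>i. i \<in> I \<Longrightarrow> \<phi> i \<in> left_forms A M"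
    "\<And>x. x \<in> carrier M \<Longrightarrow> x = (\<Oplus>\<^bsub>M\<^esub>i\<in>I. \<phi> i x \<triangleright>\<^bsub>M\<^esub> d i)"
    using c by (auto simp: dual_basis_def)
  fix t assume "t \<in> carrier (tensor_bimodule A M N)"
  then have t: "t \<in> carrier T" by simp
  let ?a = "\<lambda>j i. \<phi> i (contract M (f j) t)"
  have a: "?a j i \<in> carrier A" if "j \<in> J" "i \<in> I" for i j
    using that t by (intro left_formsD(1)[OF I(3)] contract_closed[OF J(3)])
  have inner: "contract M (f j) t \<odot> e j = (\<Oplus>\<^bsub>T\<^esub>i\<in>I. ?a j i \<triangleright>\<^sub>T d i \<odot> e j)" if j: "j \<in> J" for j
  proof -
    have ad: "(\<lambda>i. ?a j i \<triangleright>\<^bsub>M\<^esub> d i) \<in> I \<rightarrow> carrier M"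
      using a[OF j] I(2) by (auto intro!: L.lact_closed)
    have "contract M (f j) t \<odot> e j = (\<Oplus>\<^bsub>M\<^esub>i\<in>I. ?a j i \<triangleright>\<^bsub>M\<^esub> d i) \<odot> e j"
      using I(4)[OF contract_closed[OF J(3)[OF j] t]] by simp
    also have "\<dots> = (\<Oplus>\<^bsub>T\<^esub>i\<in>I. (?a j i \<triangleright>\<^bsub>M\<^esub> d i) \<odot> e j)"
      by (rule additive_finsum[OF pure_additive_left[OF J(2)[OF j]] M.M.abelian_group_axioms
            T_abelian_group I(1) ad])
    also have "\<dots> = (\<Oplus>\<^bsub>T\<^esub>i\<in>I. ?a j i \<triangleright>\<^sub>T d i \<odot> e j)"
      using a[OF j] I(2) J(2)[OF j]
      by (intro T.finsum_cong')
         (auto simp: tensor_lact_pure intro!: pure_closed L.lact_closed)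
    finally show ?thesis .
  qed
  have cl: "?a j i \<triangleright>\<^sub>T d i \<odot> e j \<in> carrier T" if "j \<in> J" "i \<in> I" for i j
    using a[OF that] that I J
    by (intro additive_closed[OF tensor_lact_additive] pure_closed) auto
  have "t = (\<Oplus>\<^bsub>T\<^esub>j\<in>J. contract M (f j) t \<odot> e j)" by (rule tensor_expansion[OF b t])
  also have "\<dots> = (\<Oplus>\<^bsub>T\<^esub>j\<in>J. \<Oplus>\<^bsub>T\<^esub>i\<in>I. ?a j i \<triangleright>\<^sub>T d i \<odot> e j)"
    using inner cl by (intro T.finsum_cong') (auto intro!: T.finsum_closed)
  also have "\<dots> = (\<Oplus>\<^bsub>T\<^esub>z\<in>J \<times> I. ?a (fst z) (snd z) \<triangleright>\<^sub>T d (snd z) \<odot> e (fst z))"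
    by (rule T.finsum_product[OF J(1) I(1) cl, symmetric])
  finally show "t = (\<Oplus>\<^bsub>tensor_bimodule A M N\<^esub>z\<in>J \<times> I. ?a (fst z) (snd z)
      \<triangleright>\<^bsub>tensor_bimodule A M N\<^esub> (d (snd z) \<odot> e (fst z)))"
    by (subst finsum_transfer[of _ T]) simp_all
qed

section \<open>The convolution of forms on a group coring\<close>

context group_coring
begin

abbreviation "\<C> \<equiv> component C"
abbreviation "\<epsilon> \<equiv> counit C"

lemma component_pair:
  "p \<in> carrier G \<Longrightarrow> q \<in> carrier G \<Longrightarrow> bimodule_pair A (\<C> p) (\<C> q)"
  by (intro bimodule_pair.intro tensor_pair.intro abimodule_right component_bimodule)

lemma module_pair:
  "right_module A M \<Longrightarrow> p \<in> carrier G \<Longrightarrow> tensor_pair A M (\<C> p)"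
  by (intro tensor_pair.intro component_bimodule)

lemma comult_left: "p \<in> carrier G \<Longrightarrow> q \<in> carrier G \<Longrightarrow>
    comult C p q \<in> left_linear A (\<C> (p \<otimes>\<^bsub>G\<^esub> q)) (tensor_bimodule A (\<C> p) (\<C> q))"
  and comult_right: "p \<in> carrier G \<Longrightarrow> q \<in> carrier G \<Longrightarrow>
    comult C p q \<in> right_linear A (\<C> (p \<otimes>\<^bsub>G\<^esub> q)) (tensor_rmodule A (\<C> p) (\<C> q))"
  using comult_linear[of p q] by (simp_all add: tensor_bimodule_as_rmodule)

lemma comult_closed: "p \<in> carrier G \<Longrightarrow> q \<in> carrier G \<Longrightarrow> c \<in> carrier (\<C> (p \<otimes>\<^bsub>G\<^esub> q)) \<Longrightarrow>
    comult C p q c \<in> carrier (tensor_group A (\<C> p) (\<C> q))"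
  using left_linearD(2)[OF comult_left] by fastforce

lemma counit_form: "\<epsilon> \<in> left_forms A (\<C> \<one>\<^bsub>G\<^esub>)"
  using counit_linear by simp

text \<open>The product of the left dual ring, indexed by the degrees of the coring. This keeps inverses of group
elements out of the arguments about coassociativity; \<open>ldp_conv\<close> returns to the degrees of the ring.\<close>

definition conv :: "'g \<Rightarrow> 'g \<Rightarrow> ('c \<Rightarrow> 'a) \<Rightarrow> ('c \<Rightarrow> 'a) \<Rightarrow> 'c \<Rightarrow> 'a"
  where "conv q p f g = (\<lambda>c \<in> carrier (\<C> (q \<otimes>\<^bsub>G\<^esub> p)). g (contract (\<C> q) f (comult C q p c)))"

lemma conv_apply: "c \<in> carrier (\<C> (q \<otimes>\<^bsub>G\<^esub> p)) \<Longrightarrow>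
    conv q p f g c = g (contract (\<C> q) f (comult C q p c))"
  by (simp add: conv_def)

lemma conv_form:
  assumes "q \<in> carrier G" "p \<in> carrier G" "f \<in> left_forms A (\<C> p)" "g \<in> left_forms A (\<C> q)"
  shows "conv q p f g \<in> left_forms A (\<C> (q \<otimes>\<^bsub>G\<^esub> p))"
proof -
  interpret bimodule_pair A "\<C> q" "\<C> p" by (rule component_pair[OF assms(1,2)])
  have "(\<lambda>c. g (contract (\<C> q) f (comult C q p c))) \<in> left_forms A (\<C> (q \<otimes>\<^bsub>G\<^esub> p))"
    using assms by (intro left_linear_comp[OF comult_left left_linear_comp[OF contract_left_linear]])
  then show ?thesis
    using assms by (rule_tac left_linear_cong) (auto simp: conv_apply intro: component_bimodule)
qed

text \<open>The form \<open>c \<otimes> d \<mapsto> g(c f(d))\<close> on \<open>C\<^sub>q \<otimes> C\<^sub>p\<close>, composed with the comultiplication, is the convolution of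
\<open>f\<close> and \<open>g\<close> by definition.\<close>

lemma contract_comult:
  assumes M: "right_module A M" and pq: "q \<in> carrier G" "p \<in> carrier G"
    and f: "f \<in> left_forms A (\<C> p)" and g: "g \<in> left_forms A (\<C> q)"
    and s: "s \<in> carrier (tensor_group A M (\<C> (q \<otimes>\<^bsub>G\<^esub> p)))"
  shows "contract M (\<lambda>t. g (contract (\<C> q) f t))
      (tensor_map A M (tensor_bimodule A (\<C> q) (\<C> p)) (\<lambda>m. m) (comult C q p) s) =
    contract M (conv q p f g) s"
proof -
  interpret Q: bimodule_pair A "\<C> q" "\<C> p" by (rule component_pair[OF pq])
  interpret P: tensor_pair A M "\<C> (q \<otimes>\<^bsub>G\<^esub> p)" using M pq by (intro module_pair) auto
  have gf: "(\<lambda>t. g (contract (\<C> q) f t)) \<in> left_forms A (tensor_bimodule A (\<C> q) (\<C> p))"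
    by (rule left_linear_comp[OF Q.contract_left_linear[OF f] g])
  have "contract M (\<lambda>t. g (contract (\<C> q) f t))
      (tensor_map A M (tensor_bimodule A (\<C> q) (\<C> p)) (\<lambda>m. m) (comult C q p) s) =
    contract M (\<lambda>c. g (contract (\<C> q) f (comult C q p c))) s"
    by (rule P.contract_tensor_map_right[OF Q.tensor_abimodule comult_left[OF pq] gf s])
  also have "\<dots> = contract M (conv q p f g) s"
    by (rule P.contract_cong[OF left_linear_comp[OF comult_left[OF pq] gf] _ s])
       (simp add: conv_apply)
  finally show ?thesis .
qed

text \<open>The same form, applied after a coaction \<open>\<rho>\<close>, splits into two contractions, and the first of them can
be moved in front of \<open>\<rho>\<close> by naturality. Here \<open>\<rho>\<close> is any right linear map, so that the lemma applies to
comultiplications, to coactions and to the coaction constructed on a module.\<close>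

lemma contract_iterated:
  assumes M: "right_module A M" and Y: "right_module A Y" and pq: "q \<in> carrier G" "p \<in> carrier G"
    and f: "f \<in> left_forms A (\<C> p)" and g: "g \<in> left_forms A (\<C> q)"
    and \<rho>: "\<rho> \<in> right_linear A Y (tensor_rmodule A M (\<C> q))"
    and t: "t \<in> carrier (tensor_group A Y (\<C> p))"
  shows "contract M (\<lambda>t. g (contract (\<C> q) f t)) (tensor_assoc A M (\<C> q) (\<C> p)
      (tensor_map A (tensor_rmodule A M (\<C> q)) (\<C> p) \<rho> (\<lambda>x. x) t)) =
    contract M g (\<rho> (contract Y f t))"
proof -
  interpret MQP: tensor_triple A M "\<C> q" "\<C> p"
    by (intro tensor_triple.intro component_pair module_pair M pq)
  interpret YP: tensor_pair A Y "\<C> p" by (rule module_pair[OF Y pq(2)])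
  have u: "tensor_map A (tensor_rmodule A M (\<C> q)) (\<C> p) \<rho> (\<lambda>x. x) t \<in> carrier MQP.LM_N.T"
    by (rule additive_closed[OF tensor_map_additive[OF YP.tensor_pair_axioms
            MQP.LM_N.tensor_pair_axioms \<rho> id_left_linear] t])
  show ?thesis
    using MQP.contract_assoc[OF g f u]
      YP.contract_natural[OF MQP.LM.tensor_right_module \<rho> f t] by (simp only:)
qed

text \<open>Comultiplication makes the components of the coring a comodule over it. Coassociativity equates the
two tensors of the previous lemmas, and applying \<open>h\<close> to their contractions gives the two products.\<close>

lemma conv_assoc:
  assumes G: "p \<in> carrier G" "q \<in> carrier G" "r \<in> carrier G"
    and f: "f \<in> left_forms A (\<C> p)" and g: "g \<in> left_forms A (\<C> q)" and h: "h \<in> left_forms A (\<C> r)"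
  shows "conv r (q \<otimes>\<^bsub>G\<^esub> p) (conv q p f g) h = conv (r \<otimes>\<^bsub>G\<^esub> q) p f (conv r q g h)"
proof
  fix c
  show "conv r (q \<otimes>\<^bsub>G\<^esub> p) (conv q p f g) h c = conv (r \<otimes>\<^bsub>G\<^esub> q) p f (conv r q g h) c"
  proof (cases "c \<in> carrier (\<C> (r \<otimes>\<^bsub>G\<^esub> q \<otimes>\<^bsub>G\<^esub> p))")
    case False
    then show ?thesis using G by (simp add: conv_def G.m_assoc)
  next
    case True
    have mr: "right_module A (\<C> r)" "right_module A (\<C> (r \<otimes>\<^bsub>G\<^esub> q))"
      using G by (auto intro!: abimodule_right component_bimodule)
    have s: "comult C r (q \<otimes>\<^bsub>G\<^esub> p) c \<in> carrier (tensor_group A (\<C> r) (\<C> (q \<otimes>\<^bsub>G\<^esub> p)))"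
      using G True by (intro comult_closed) (auto simp: G.m_assoc)
    have t: "comult C (r \<otimes>\<^bsub>G\<^esub> q) p c \<in> carrier (tensor_group A (\<C> (r \<otimes>\<^bsub>G\<^esub> q)) (\<C> p))"
      using G True by (intro comult_closed) auto
    interpret tensor_pair A "\<C> (r \<otimes>\<^bsub>G\<^esub> q)" "\<C> p" by (rule module_pair[OF mr(2) G(1)])
    have "contract (\<C> r) (conv q p f g) (comult C r (q \<otimes>\<^bsub>G\<^esub> p) c) =
        contract (\<C> r) g (comult C r q (contract (\<C> (r \<otimes>\<^bsub>G\<^esub> q)) f (comult C (r \<otimes>\<^bsub>G\<^esub> q) p c)))"
      using contract_comult[OF mr(1) G(2,1) f g s]
        contract_iterated[OF mr G(2,1) f g comult_right[OF G(3,2)] t]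
        coassociative[OF G(3,2,1) True]
      by (simp only: tensor_bimodule_as_rmodule)
    moreover have "contract (\<C> (r \<otimes>\<^bsub>G\<^esub> q)) f (comult C (r \<otimes>\<^bsub>G\<^esub> q) p c) \<in> carrier (\<C> (r \<otimes>\<^bsub>G\<^esub> q))"
      by (rule contract_closed[OF f t])
    ultimately show ?thesis using True G by (simp add: conv_def G.m_assoc)
  qed
qed

lemma contract_counit:
  assumes p: "p \<in> carrier G" and c: "c \<in> carrier (\<C> p)"
  shows "contract (\<C> p) \<epsilon> (comult C p \<one>\<^bsub>G\<^esub> c) = c"
proof -
  interpret bimodule_pair A "\<C> p" "\<C> \<one>\<^bsub>G\<^esub>" using p by (intro component_pair) auto
  have "comult C p \<one>\<^bsub>G\<^esub> c \<in> carrier T" using p c by (intro comult_closed) auto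
  from runit_tensor_map[OF counit_form this] counit_right[OF p c] show ?thesis by simp
qed

lemma counit_contract:
  assumes p: "p \<in> carrier G" and f: "f \<in> left_forms A (\<C> p)" and c: "c \<in> carrier (\<C> p)"
  shows "\<epsilon> (contract (\<C> \<one>\<^bsub>G\<^esub>) f (comult C \<one>\<^bsub>G\<^esub> p c)) = f c"
proof -
  interpret bimodule_pair A "\<C> \<one>\<^bsub>G\<^esub>" "\<C> p" using p by (intro component_pair) auto
  have t: "comult C \<one>\<^bsub>G\<^esub> p c \<in> carrier T" using p c by (intro comult_closed) auto
  have "\<epsilon> \<in> right_linear A (\<C> \<one>\<^bsub>G\<^esub>) (regular_bimodule A)" using counit_linear by simp
  from form_lunit_tensor_map[OF this f t] counit_left[OF p c] show ?thesis by simp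
qed

end

section \<open>The left dual graded ring\<close>

lemma finsum_left_form:
  assumes "abimodule A N" "finite I" "\<And>i. i \<in> I \<Longrightarrow> h i \<in> left_forms A N"
  shows "(\<lambda>c. \<Oplus>\<^bsub>A\<^esub>i\<in>I. h i c) \<in> left_forms A N"
proof -
  interpret abimodule A N by fact
  note h = left_formsD[OF assms(3)]
  show ?thesis
  proof (rule left_formsI)
    fix m n assume mn: "m \<in> carrier N" "n \<in> carrier N"
    then have "(\<Oplus>\<^bsub>A\<^esub>i\<in>I. h i (m \<oplus>\<^bsub>N\<^esub> n)) = (\<Oplus>\<^bsub>A\<^esub>i\<in>I. h i m \<oplus>\<^bsub>A\<^esub> h i n)"
      by (intro A.finsum_cong') (auto simp: h)
    also have "\<dots> = (\<Oplus>\<^bsub>A\<^esub>i\<in>I. h i m) \<oplus>\<^bsub>A\<^esub> (\<Oplus>\<^bsub>A\<^esub>i\<in>I. h i n)"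
      using mn by (intro A.finsum_addf) (auto simp: h)
    finally show "(\<Oplus>\<^bsub>A\<^esub>i\<in>I. h i (m \<oplus>\<^bsub>N\<^esub> n)) = (\<Oplus>\<^bsub>A\<^esub>i\<in>I. h i m) \<oplus>\<^bsub>A\<^esub> (\<Oplus>\<^bsub>A\<^esub>i\<in>I. h i n)" .
  next
    fix m a assume "m \<in> carrier N" "a \<in> carrier A"
    then show "(\<Oplus>\<^bsub>A\<^esub>i\<in>I. h i (a \<triangleright>\<^bsub>N\<^esub> m)) = a \<otimes>\<^bsub>A\<^esub> (\<Oplus>\<^bsub>A\<^esub>i\<in>I. h i m)"
      using assms(2) by (subst A.finsum_rdistr)
        (auto simp: h intro!: A.finsum_cong')
  qed (auto simp: h intro!: A.finsum_closed)
qed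

context group_coring
begin

abbreviation "R \<equiv> left_dual_ring G A C"
abbreviation "H \<equiv> left_dual_component G A C"
abbreviation "supp \<equiv> left_dual_support G A C"
abbreviation "ldp \<equiv> left_dual_prod G C"

lemma inv_component: "\<alpha> \<in> carrier G \<Longrightarrow> abimodule A (\<C> (inv\<^bsub>G\<^esub> \<alpha>))"
  by (simp add: component_bimodule)

lemma H_form: "f \<in> H \<alpha> \<Longrightarrow> f \<in> left_forms A (\<C> (inv\<^bsub>G\<^esub> \<alpha>))"
  by (simp add: left_dual_component_def)

lemma H_restrict:
  assumes "\<alpha> \<in> carrier G" "f \<in> left_forms A (\<C> (inv\<^bsub>G\<^esub> \<alpha>))"
  shows "restrict f (carrier (\<C> (inv\<^bsub>G\<^esub> \<alpha>))) \<in> H \<alpha>"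
proof -
  have "restrict f (carrier (\<C> (inv\<^bsub>G\<^esub> \<alpha>))) \<in> left_forms A (\<C> (inv\<^bsub>G\<^esub> \<alpha>))"
    by (rule left_linear_cong[OF assms(2) inv_component[OF assms(1)]]) simp
  then show ?thesis by (simp add: left_dual_component_def)
qed

lemma H_eqI:
  assumes "f \<in> H \<alpha>" "g \<in> H \<alpha>" "\<And>c. c \<in> carrier (\<C> (inv\<^bsub>G\<^esub> \<alpha>)) \<Longrightarrow> f c = g c"
  shows "f = g"
  using assms by (auto simp: left_dual_component_def intro: extensionalityI)

lemma H_value: "f \<in> H \<alpha> \<Longrightarrow> c \<in> carrier (\<C> (inv\<^bsub>G\<^esub> \<alpha>)) \<Longrightarrow> f c \<in> carrier A"
  using left_formsD(1)[OF H_form] .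

lemma zero_form_H: "\<alpha> \<in> carrier G \<Longrightarrow> (\<lambda>c\<in>carrier (\<C> (inv\<^bsub>G\<^esub> \<alpha>)). \<zero>\<^bsub>A\<^esub>) \<in> H \<alpha>"
  by (rule H_restrict) (auto intro!: left_formsI)

lemma R_carrier: "f \<in> carrier R \<longleftrightarrow> f \<in> (\<Pi>\<^sub>E \<alpha>\<in>carrier G. H \<alpha>) \<and> finite (supp f)"
  by (simp add: left_dual_ring_def)

lemma supp_closed: "supp f \<subseteq> carrier G"
  by (auto simp: left_dual_support_def)

lemma R_component: "f \<in> carrier R \<Longrightarrow> \<alpha> \<in> carrier G \<Longrightarrow> f \<alpha> \<in> H \<alpha>"
  by (auto simp: R_carrier)

lemma R_finite: "f \<in> carrier R \<Longrightarrow> finite (supp f)"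
  by (simp add: R_carrier)

lemma R_outside_supp:
  "\<alpha> \<in> carrier G \<Longrightarrow> \<alpha> \<notin> supp f \<Longrightarrow> c \<in> carrier (\<C> (inv\<^bsub>G\<^esub> \<alpha>)) \<Longrightarrow> f \<alpha> c = \<zero>\<^bsub>A\<^esub>"
  by (auto simp: left_dual_support_def)

lemma supp_subsetI:
  assumes "\<And>\<alpha> c. \<alpha> \<in> carrier G \<Longrightarrow> \<alpha> \<notin> S \<Longrightarrow> c \<in> carrier (\<C> (inv\<^bsub>G\<^esub> \<alpha>)) \<Longrightarrow> f \<alpha> c = \<zero>\<^bsub>A\<^esub>"
  shows "supp f \<subseteq> S"
  using assms by (auto simp: left_dual_support_def)

lemma R_I:
  assumes "f \<in> extensional (carrier G)" "\<And>\<alpha>. \<alpha> \<in> carrier G \<Longrightarrow> f \<alpha> \<in> H \<alpha>"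
    and "finite S" "supp f \<subseteq> S"
  shows "f \<in> carrier R"
  using assms by (auto simp: R_carrier PiE_def intro: finite_subset)

lemma R_eqI:
  assumes "f \<in> carrier R" "g \<in> carrier R"
    and "\<And>\<alpha> c. \<alpha> \<in> carrier G \<Longrightarrow> c \<in> carrier (\<C> (inv\<^bsub>G\<^esub> \<alpha>)) \<Longrightarrow> f \<alpha> c = g \<alpha> c"
  shows "f = g"
proof (rule extensionalityI)
  show "f \<in> extensional (carrier G)" "g \<in> extensional (carrier G)"
    using assms(1,2) by (auto simp: R_carrier PiE_def)
  fix \<alpha> assume "\<alpha> \<in> carrier G"
  then show "f \<alpha> = g \<alpha>"
    using assms by (intro H_eqI[of _ \<alpha>] R_component) auto
qed

lemma R_value: "f \<in> carrier R \<Longrightarrow> \<alpha> \<in> carrier G \<Longrightarrow> c \<in> carrier (\<C> (inv\<^bsub>G\<^esub> \<alpha>)) \<Longrightarrow> f \<alpha> c \<in> carrier A"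
  using H_value[OF R_component] .

lemma R_add_apply: "\<alpha> \<in> carrier G \<Longrightarrow> c \<in> carrier (\<C> (inv\<^bsub>G\<^esub> \<alpha>)) \<Longrightarrow>
    (f \<oplus>\<^bsub>R\<^esub> g) \<alpha> c = f \<alpha> c \<oplus>\<^bsub>A\<^esub> g \<alpha> c"
  by (simp add: left_dual_ring_def)

lemma R_zero_apply: "\<alpha> \<in> carrier G \<Longrightarrow> c \<in> carrier (\<C> (inv\<^bsub>G\<^esub> \<alpha>)) \<Longrightarrow> \<zero>\<^bsub>R\<^esub> \<alpha> c = \<zero>\<^bsub>A\<^esub>"
  by (simp add: left_dual_ring_def)

lemma R_add_supp: "supp (f \<oplus>\<^bsub>R\<^esub> g) \<subseteq> supp f \<union> supp g"
  by (rule supp_subsetI) (auto simp: R_add_apply R_outside_supp)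

lemma R_add_closed: "f \<in> carrier R \<Longrightarrow> g \<in> carrier R \<Longrightarrow> f \<oplus>\<^bsub>R\<^esub> g \<in> carrier R"
proof (rule R_I[OF _ _ _ R_add_supp])
  assume f: "f \<in> carrier R" and g: "g \<in> carrier R"
  show "finite (supp f \<union> supp g)" using f g by (simp add: R_finite)
  show "f \<oplus>\<^bsub>R\<^esub> g \<in> extensional (carrier G)" by (simp add: left_dual_ring_def)
  fix \<alpha> assume \<alpha>: "\<alpha> \<in> carrier G"
  interpret abimodule A "\<C> (inv\<^bsub>G\<^esub> \<alpha>)" by (rule inv_component[OF \<alpha>])
  have "(\<lambda>c. f \<alpha> c \<oplus>\<^bsub>A\<^esub> g \<alpha> c) \<in> left_forms A (\<C> (inv\<^bsub>G\<^esub> \<alpha>))"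
    using H_form[OF R_component[OF f \<alpha>]] H_form[OF R_component[OF g \<alpha>]]
    by (intro left_formsI) (auto simp: left_formsD A.r_distr A.a_ac)
  from H_restrict[OF \<alpha> this] show "(f \<oplus>\<^bsub>R\<^esub> g) \<alpha> \<in> H \<alpha>"
    using \<alpha> by (simp add: left_dual_ring_def)
qed

lemma R_zero_closed: "\<zero>\<^bsub>R\<^esub> \<in> carrier R"
  by (rule R_I[where S = "{}"])
     (auto simp: left_dual_ring_def zero_form_H left_dual_support_def)

lemma R_abelian_group: "abelian_group R"
proof (rule abelian_groupI)
  fix f assume f: "f \<in> carrier R"
  let ?g = "\<lambda>\<gamma>\<in>carrier G. \<lambda>c\<in>carrier (\<C> (inv\<^bsub>G\<^esub> \<gamma>)). \<ominus>\<^bsub>A\<^esub> f \<gamma> c"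
  have g: "?g \<in> carrier R"
  proof (rule R_I[OF _ _ R_finite[OF f]])
    fix \<alpha> assume \<alpha>: "\<alpha> \<in> carrier G"
    have "(\<lambda>c. \<ominus>\<^bsub>A\<^esub> f \<alpha> c) \<in> left_forms A (\<C> (inv\<^bsub>G\<^esub> \<alpha>))"
      using H_form[OF R_component[OF f \<alpha>]]
      by (intro left_formsI) (auto simp: left_formsD A.minus_add A.r_minus)
    from H_restrict[OF \<alpha> this] show "?g \<alpha> \<in> H \<alpha>" using \<alpha> by simp
  qed (auto intro!: supp_subsetI simp: R_outside_supp)
  show "\<exists>g\<in>carrier R. g \<oplus>\<^bsub>R\<^esub> f = \<zero>\<^bsub>R\<^esub>"
    using g f by (intro bexI[OF _ g] R_eqI R_add_closed R_zero_closed)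
      (auto simp: R_add_apply R_zero_apply R_value A.l_neg)
qed (auto intro!: R_eqI R_add_closed R_zero_closed
      simp: R_add_apply R_zero_apply R_value A.a_ac)

text \<open>The element of \<open>R\<close> concentrated in degree \<open>\<alpha>\<close>. The form \<open>f\<close> may be arbitrary outside of its component,
which avoids a restriction in most places where a form is turned into an element of \<open>R\<close>.\<close>

definition homog :: "'g \<Rightarrow> ('c \<Rightarrow> 'a) \<Rightarrow> 'g \<Rightarrow> 'c \<Rightarrow> 'a"
  where "homog \<alpha> f = (\<lambda>\<gamma>\<in>carrier G. \<lambda>c\<in>carrier (\<C> (inv\<^bsub>G\<^esub> \<gamma>)). if \<gamma> = \<alpha> then f c else \<zero>\<^bsub>A\<^esub>)"

lemma homog_apply: "\<gamma> \<in> carrier G \<Longrightarrow> c \<in> carrier (\<C> (inv\<^bsub>G\<^esub> \<gamma>)) \<Longrightarrow>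
    homog \<alpha> f \<gamma> c = (if \<gamma> = \<alpha> then f c else \<zero>\<^bsub>A\<^esub>)"
  by (simp add: homog_def)

lemma homog_supp: "supp (homog \<alpha> f) \<subseteq> {\<alpha>}"
  by (rule supp_subsetI) (auto simp: homog_apply)

lemma homog_cong: "(\<And>c. c \<in> carrier (\<C> (inv\<^bsub>G\<^esub> \<alpha>)) \<Longrightarrow> f c = g c) \<Longrightarrow> homog \<alpha> f = homog \<alpha> g"
  by (auto simp: homog_def fun_eq_iff restrict_def)

lemma homog_restrict: "homog \<alpha> (restrict f (carrier (\<C> (inv\<^bsub>G\<^esub> \<alpha>)))) = homog \<alpha> f"
  by (rule homog_cong) simp

lemma homog_same: "\<alpha> \<in> carrier G \<Longrightarrow> f \<in> H \<alpha> \<Longrightarrow> homog \<alpha> f \<alpha> = f"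
  by (auto simp: homog_def left_dual_component_def intro: extensionalityI)

lemma homog_closed:
  assumes "\<alpha> \<in> carrier G" "f \<in> left_forms A (\<C> (inv\<^bsub>G\<^esub> \<alpha>))"
  shows "homog \<alpha> f \<in> carrier R"
proof (rule R_I[OF _ _ _ homog_supp])
  fix \<gamma> assume \<gamma>: "\<gamma> \<in> carrier G"
  show "homog \<alpha> f \<gamma> \<in> H \<gamma>"
    using assms zero_form_H[OF \<gamma>] H_restrict[of \<alpha> f] \<gamma>
    by (cases "\<gamma> = \<alpha>") (auto simp: homog_def)
qed (auto simp: homog_def)

text \<open>The ring is the direct sum of its components, so additive statements need only be verified on
homogeneous elements.\<close>

lemma R_induct [consumes 1, case_names zero homog add]:
  assumes "f \<in> carrier R" and zero: "Q \<zero>\<^bsub>R\<^esub>"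
    and homog: "\<And>\<alpha> f. \<alpha> \<in> carrier G \<Longrightarrow> f \<in> H \<alpha> \<Longrightarrow> Q (homog \<alpha> f)"
    and add: "\<And>f g. f \<in> carrier R \<Longrightarrow> g \<in> carrier R \<Longrightarrow> Q f \<Longrightarrow> Q g \<Longrightarrow> Q (f \<oplus>\<^bsub>R\<^esub> g)"
  shows "Q f"
proof -
  have "Q f" if "finite S" "S \<subseteq> carrier G" "f \<in> carrier R" "supp f \<subseteq> S" for S f
    using that
  proof (induction S arbitrary: f rule: finite_induct)
    case empty
    then have "f = \<zero>\<^bsub>R\<^esub>"
      by (intro R_eqI R_zero_closed) (auto simp: R_zero_apply R_outside_supp)
    with zero show ?case by simp
  next
    case (insert \<alpha> S)
    let ?g = "\<lambda>\<gamma>\<in>carrier G. \<lambda>c\<in>carrier (\<C> (inv\<^bsub>G\<^esub> \<gamma>)). if \<gamma> = \<alpha> then \<zero>\<^bsub>A\<^esub> else f \<gamma> c"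
    have \<alpha>: "\<alpha> \<in> carrier G" using insert by simp
    have supp: "supp ?g \<subseteq> S"
      using insert.prems(3) by (intro supp_subsetI) (auto intro!: R_outside_supp)
    have g: "?g \<in> carrier R"
    proof (rule R_I[OF _ _ insert(1) supp])
      fix \<gamma> assume \<gamma>: "\<gamma> \<in> carrier G"
      show "?g \<gamma> \<in> H \<gamma>"
        using \<gamma> zero_form_H[OF \<gamma>] H_restrict[OF \<gamma> H_form[OF R_component[OF insert.prems(2) \<gamma>]]]
        by (cases "\<gamma> = \<alpha>") auto
    qed auto
    have h: "homog \<alpha> (f \<alpha>) \<in> carrier R"
      by (rule homog_closed[OF \<alpha> H_form[OF R_component[OF insert.prems(2) \<alpha>]]])
    have "f = homog \<alpha> (f \<alpha>) \<oplus>\<^bsub>R\<^esub> ?g"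
      using insert.prems h g
      by (intro R_eqI R_add_closed) (auto simp: R_add_apply homog_apply R_value)
    moreover have "Q (homog \<alpha> (f \<alpha>))" using \<alpha> insert.prems by (intro homog R_component)
    moreover have "Q ?g" using insert.prems(1) by (intro insert.IH g supp) auto
    ultimately show ?case using add[OF h g] by simp
  qed
  then show ?thesis using R_finite[OF assms(1)] supp_closed assms(1) by blast
qed

text \<open>Forms of degree \<open>\<alpha>\<close> live on the component of degree \<open>inv \<alpha>\<close>, whence the reversed order of the degrees.\<close>

lemma ldp_conv:
  "\<alpha> \<in> carrier G \<Longrightarrow> \<beta> \<in> carrier G \<Longrightarrow> ldp \<alpha> \<beta> f g = conv (inv\<^bsub>G\<^esub> \<beta>) (inv\<^bsub>G\<^esub> \<alpha>) f g"
  by (simp add: left_dual_prod_def conv_def contract_def G.inv_mult_group)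

lemma ldp_closed:
  assumes "\<alpha> \<in> carrier G" "\<beta> \<in> carrier G" "f \<in> H \<alpha>" "g \<in> H \<beta>"
  shows "ldp \<alpha> \<beta> f g \<in> H (\<alpha> \<otimes>\<^bsub>G\<^esub> \<beta>)"
proof -
  have "ldp \<alpha> \<beta> f g \<in> left_forms A (\<C> (inv\<^bsub>G\<^esub> (\<alpha> \<otimes>\<^bsub>G\<^esub> \<beta>)))"
    using assms by (simp add: ldp_conv G.inv_mult_group conv_form H_form)
  moreover have "ldp \<alpha> \<beta> f g \<in> extensional (carrier (\<C> (inv\<^bsub>G\<^esub> (\<alpha> \<otimes>\<^bsub>G\<^esub> \<beta>))))"
    by (simp add: left_dual_prod_def)
  ultimately show ?thesis by (simp add: left_dual_component_def)
qed

context
  fixes \<alpha> \<beta> c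
  assumes \<alpha>: "\<alpha> \<in> carrier G" and \<beta>: "\<beta> \<in> carrier G"
    and c: "c \<in> carrier (\<C> (inv\<^bsub>G\<^esub> (\<alpha> \<otimes>\<^bsub>G\<^esub> \<beta>)))"
begin

interpretation B: bimodule_pair A "\<C> (inv\<^bsub>G\<^esub> \<beta>)" "\<C> (inv\<^bsub>G\<^esub> \<alpha>)"
  using \<alpha> \<beta> by (intro component_pair) auto

lemma c': "c \<in> carrier (\<C> (inv\<^bsub>G\<^esub> \<beta> \<otimes>\<^bsub>G\<^esub> inv\<^bsub>G\<^esub> \<alpha>))"
  using c \<alpha> \<beta> by (simp add: G.inv_mult_group)

lemma \<Delta>c: "comult C (inv\<^bsub>G\<^esub> \<beta>) (inv\<^bsub>G\<^esub> \<alpha>) c \<in> carrier B.T"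
  using c' \<alpha> \<beta> by (intro comult_closed) auto

lemma ldp_apply: "ldp \<alpha> \<beta> f g c =
    g (contract (\<C> (inv\<^bsub>G\<^esub> \<beta>)) f (comult C (inv\<^bsub>G\<^esub> \<beta>) (inv\<^bsub>G\<^esub> \<alpha>) c))"
  using c' by (simp add: ldp_conv \<alpha> \<beta> conv_apply)

lemma ldp_add_left:
  assumes "f \<in> H \<alpha>" "f' \<in> H \<alpha>" "g \<in> H \<beta>"
    and "\<And>c. c \<in> carrier (\<C> (inv\<^bsub>G\<^esub> \<alpha>)) \<Longrightarrow> h c = f c \<oplus>\<^bsub>A\<^esub> f' c"
  shows "ldp \<alpha> \<beta> h g c = ldp \<alpha> \<beta> f g c \<oplus>\<^bsub>A\<^esub> ldp \<alpha> \<beta> f' g c"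
proof -
  note ff = H_form[OF assms(1)] H_form[OF assms(2)]
  have "contract (\<C> (inv\<^bsub>G\<^esub> \<beta>)) h (comult C (inv\<^bsub>G\<^esub> \<beta>) (inv\<^bsub>G\<^esub> \<alpha>) c) =
      contract (\<C> (inv\<^bsub>G\<^esub> \<beta>)) (\<lambda>x. f x \<oplus>\<^bsub>A\<^esub> f' x) (comult C (inv\<^bsub>G\<^esub> \<beta>) (inv\<^bsub>G\<^esub> \<alpha>) c)"
    using B.contract_cong[OF B.form_add[OF ff] _ \<Delta>c] assms(4) by metis
  then show ?thesis
    by (simp add: ldp_apply B.contract_add[OF ff \<Delta>c] left_formsD(2)[OF H_form[OF assms(3)]]
        B.contract_closed[OF _ \<Delta>c] ff)
qed

lemma ldp_add_right:
  assumes "f \<in> H \<alpha>" "\<And>c. c \<in> carrier (\<C> (inv\<^bsub>G\<^esub> \<beta>)) \<Longrightarrow> h c = g c \<oplus>\<^bsub>A\<^esub> g' c"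
  shows "ldp \<alpha> \<beta> f h c = ldp \<alpha> \<beta> f g c \<oplus>\<^bsub>A\<^esub> ldp \<alpha> \<beta> f g' c"
  by (simp add: ldp_apply assms(2) B.contract_closed[OF H_form[OF assms(1)] \<Delta>c])

lemma ldp_zero_left:
  assumes "\<And>c. c \<in> carrier (\<C> (inv\<^bsub>G\<^esub> \<alpha>)) \<Longrightarrow> f c = \<zero>\<^bsub>A\<^esub>" "g \<in> H \<beta>"
  shows "ldp \<alpha> \<beta> f g c = \<zero>\<^bsub>A\<^esub>"
  by (simp add: ldp_apply B.contract_zero[OF assms(1) \<Delta>c] B.L.form_zero[OF H_form[OF assms(2)]])

lemma ldp_zero_right:
  assumes "f \<in> H \<alpha>" "\<And>c. c \<in> carrier (\<C> (inv\<^bsub>G\<^esub> \<beta>)) \<Longrightarrow> g c = \<zero>\<^bsub>A\<^esub>"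
  shows "ldp \<alpha> \<beta> f g c = \<zero>\<^bsub>A\<^esub>"
  by (simp add: ldp_apply assms(2) B.contract_closed[OF H_form[OF assms(1)] \<Delta>c])

end

lemma R_mult: "f \<otimes>\<^bsub>R\<^esub> g = (\<lambda>\<gamma>\<in>carrier G. \<lambda>c\<in>carrier (\<C> (inv\<^bsub>G\<^esub> \<gamma>)).
    \<Oplus>\<^bsub>A\<^esub>z\<in>{z \<in> supp f \<times> supp g. fst z \<otimes>\<^bsub>G\<^esub> snd z = \<gamma>}.
      ldp (fst z) (snd z) (f (fst z)) (g (snd z)) c)"
  by (simp add: left_dual_ring_def)

lemma R_mult_closed:
  assumes f: "f \<in> carrier R" and g: "g \<in> carrier R"
  shows "f \<otimes>\<^bsub>R\<^esub> g \<in> carrier R"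
proof (rule R_I)
  let ?S = "(\<lambda>z. fst z \<otimes>\<^bsub>G\<^esub> snd z) ` (supp f \<times> supp g)"
  show "f \<otimes>\<^bsub>R\<^esub> g \<in> extensional (carrier G)" by (simp add: R_mult)
  show "finite ?S" using R_finite f g by blast
  show "supp (f \<otimes>\<^bsub>R\<^esub> g) \<subseteq> ?S"
  proof (rule supp_subsetI)
    fix \<alpha> c assume "\<alpha> \<in> carrier G" "\<alpha> \<notin> ?S" "c \<in> carrier (\<C> (inv\<^bsub>G\<^esub> \<alpha>))"
    moreover from this have "{z \<in> supp f \<times> supp g. fst z \<otimes>\<^bsub>G\<^esub> snd z = \<alpha>} = {}" by blast
    ultimately show "(f \<otimes>\<^bsub>R\<^esub> g) \<alpha> c = \<zero>\<^bsub>A\<^esub>" by (simp only: R_mult restrict_apply' A.finsum_empty)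
  qed
  fix \<gamma> assume \<gamma>: "\<gamma> \<in> carrier G"
  let ?Z = "{z \<in> supp f \<times> supp g. fst z \<otimes>\<^bsub>G\<^esub> snd z = \<gamma>}"
  have "(\<lambda>c. \<Oplus>\<^bsub>A\<^esub>z\<in>?Z. ldp (fst z) (snd z) (f (fst z)) (g (snd z)) c) \<in> left_forms A (\<C> (inv\<^bsub>G\<^esub> \<gamma>))"
  proof (rule finsum_left_form[OF inv_component[OF \<gamma>]])
    show "finite ?Z" using R_finite f g by auto
    fix z assume z: "z \<in> ?Z"
    then have "fst z \<in> carrier G" "snd z \<in> carrier G" using subsetD[OF supp_closed] by auto
    then have "ldp (fst z) (snd z) (f (fst z)) (g (snd z)) \<in> H (fst z \<otimes>\<^bsub>G\<^esub> snd z)"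
      using f g by (intro ldp_closed R_component) auto
    with z show "ldp (fst z) (snd z) (f (fst z)) (g (snd z)) \<in> left_forms A (\<C> (inv\<^bsub>G\<^esub> \<gamma>))"
      using H_form by force
  qed
  from H_restrict[OF \<gamma> this] show "(f \<otimes>\<^bsub>R\<^esub> g) \<gamma> \<in> H \<gamma>" using \<gamma> by (simp add: R_mult)
qed

lemma complement_degree:
  assumes "\<alpha> \<in> carrier G" "\<gamma> \<in> carrier G"
  shows "inv\<^bsub>G\<^esub> \<alpha> \<otimes>\<^bsub>G\<^esub> \<gamma> \<in> carrier G" "\<alpha> \<otimes>\<^bsub>G\<^esub> (inv\<^bsub>G\<^esub> \<alpha> \<otimes>\<^bsub>G\<^esub> \<gamma>) = \<gamma>"
  using assms by (simp_all add: G.m_assoc[symmetric])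

lemma ldp_value_closed:
  assumes f: "f \<in> carrier R" and g: "g \<in> carrier R"
    and \<alpha>: "\<alpha> \<in> carrier G" and \<gamma>: "\<gamma> \<in> carrier G" and c: "c \<in> carrier (\<C> (inv\<^bsub>G\<^esub> \<gamma>))"
  shows "ldp \<alpha> (inv\<^bsub>G\<^esub> \<alpha> \<otimes>\<^bsub>G\<^esub> \<gamma>) (f \<alpha>) (g (inv\<^bsub>G\<^esub> \<alpha> \<otimes>\<^bsub>G\<^esub> \<gamma>)) c \<in> carrier A"
proof -
  note \<delta> = complement_degree[OF \<alpha> \<gamma>]
  show ?thesis
    using H_value[OF ldp_closed[OF \<alpha> \<delta>(1) R_component[OF f \<alpha>] R_component[OF g \<delta>(1)]]] c
    by (simp add: \<delta>(2))
qed

text \<open>A pair of degrees with product \<open>\<gamma>\<close> is determined by its first entry. Summing over any finite set that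
contains the support of \<open>f\<close> is what makes distributivity accessible, since the support of a sum can
be smaller than the union of the supports.\<close>

lemma R_mult_apply:
  assumes f: "f \<in> carrier R" and g: "g \<in> carrier R"
    and S: "finite S" "supp f \<subseteq> S" "S \<subseteq> carrier G"
    and \<gamma>: "\<gamma> \<in> carrier G" and c: "c \<in> carrier (\<C> (inv\<^bsub>G\<^esub> \<gamma>))"
  shows "(f \<otimes>\<^bsub>R\<^esub> g) \<gamma> c =
    (\<Oplus>\<^bsub>A\<^esub>\<alpha>\<in>S. ldp \<alpha> (inv\<^bsub>G\<^esub> \<alpha> \<otimes>\<^bsub>G\<^esub> \<gamma>) (f \<alpha>) (g (inv\<^bsub>G\<^esub> \<alpha> \<otimes>\<^bsub>G\<^esub> \<gamma>)) c)"
proof -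
  let ?h = "\<lambda>\<alpha>. ldp \<alpha> (inv\<^bsub>G\<^esub> \<alpha> \<otimes>\<^bsub>G\<^esub> \<gamma>) (f \<alpha>) (g (inv\<^bsub>G\<^esub> \<alpha> \<otimes>\<^bsub>G\<^esub> \<gamma>)) c"
  let ?Z = "{z \<in> supp f \<times> supp g. fst z \<otimes>\<^bsub>G\<^esub> snd z = \<gamma>}"
  have snd: "snd z = inv\<^bsub>G\<^esub> fst z \<otimes>\<^bsub>G\<^esub> \<gamma>" if "z \<in> ?Z" for z
  proof -
    have "fst z \<in> carrier G" "snd z \<in> carrier G" using that subsetD[OF supp_closed] by auto
    moreover have "\<gamma> = fst z \<otimes>\<^bsub>G\<^esub> snd z" using that by simp
    ultimately show ?thesis by (simp add: G.inv_solve_left)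
  qed
  have inj: "inj_on fst ?Z"
  proof (rule inj_onI)
    fix z z' assume "z \<in> ?Z" "z' \<in> ?Z" "fst z = fst z'"
    then show "z = z'" using snd[of z] snd[of z'] by (simp only: prod_eq_iff)
  qed
  note \<gamma>\<alpha> = complement_degree(2)[OF _ \<gamma>]
  have hc: "?h \<alpha> \<in> carrier A" if "\<alpha> \<in> S" for \<alpha>
    using that S(3) by (intro ldp_value_closed f g \<gamma> c) auto
  have "(f \<otimes>\<^bsub>R\<^esub> g) \<gamma> c = (\<Oplus>\<^bsub>A\<^esub>z\<in>?Z. ldp (fst z) (snd z) (f (fst z)) (g (snd z)) c)"
    using \<gamma> c by (simp add: R_mult)
  also have "\<dots> = (\<Oplus>\<^bsub>A\<^esub>z\<in>?Z. ?h (fst z))"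
    using S(2) hc by (intro A.finsum_cong') (auto simp: snd[symmetric] subset_iff)
  also have "\<dots> = (\<Oplus>\<^bsub>A\<^esub>\<alpha>\<in>fst ` ?Z. ?h \<alpha>)"
    using S(2) hc by (intro A.finsum_reindex[OF _ inj, symmetric]) auto
  also have "\<dots> = (\<Oplus>\<^bsub>A\<^esub>\<alpha>\<in>S. ?h \<alpha>)"
  proof (rule A.add.finprod_mono_neutral_cong_left[OF S(1)])
    fix \<alpha> assume \<alpha>: "\<alpha> \<in> S - fst ` ?Z"
    then have \<alpha>G: "\<alpha> \<in> carrier G" using S by auto
    have inv: "inv\<^bsub>G\<^esub> \<alpha> \<otimes>\<^bsub>G\<^esub> \<gamma> \<in> carrier G" using \<alpha>G \<gamma> by simp
    have c': "c \<in> carrier (\<C> (inv\<^bsub>G\<^esub> (\<alpha> \<otimes>\<^bsub>G\<^esub> (inv\<^bsub>G\<^esub> \<alpha> \<otimes>\<^bsub>G\<^esub> \<gamma>))))" using c \<gamma>\<alpha>[OF \<alpha>G] by simp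
    have "\<alpha> \<notin> supp f \<or> inv\<^bsub>G\<^esub> \<alpha> \<otimes>\<^bsub>G\<^esub> \<gamma> \<notin> supp g"
    proof (rule ccontr)
      assume "\<not> ?thesis"
      then have "(\<alpha>, inv\<^bsub>G\<^esub> \<alpha> \<otimes>\<^bsub>G\<^esub> \<gamma>) \<in> ?Z" using \<gamma>\<alpha>[OF \<alpha>G] by simp
      then have "\<alpha> \<in> fst ` ?Z" by (metis (no_types, lifting) fst_conv imageI)
      with \<alpha> show False by blast
    qed
    then show "?h \<alpha> = \<zero>\<^bsub>A\<^esub>"
    proof
      assume "\<alpha> \<notin> supp f"
      then show ?thesis using \<alpha>G inv g
        by (intro ldp_zero_left[OF \<alpha>G inv c']) (auto simp: R_outside_supp R_component)
    next
      assume "inv\<^bsub>G\<^esub> \<alpha> \<otimes>\<^bsub>G\<^esub> \<gamma> \<notin> supp g"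
      then show ?thesis using \<alpha>G inv f
        by (intro ldp_zero_right[OF \<alpha>G inv c']) (auto simp: R_outside_supp R_component)
    qed
  qed (use S(2) hc in auto)
  finally show ?thesis .
qed

lemma R_l_distr:
  assumes f: "f \<in> carrier R" and f': "f' \<in> carrier R" and g: "g \<in> carrier R"
  shows "(f \<oplus>\<^bsub>R\<^esub> f') \<otimes>\<^bsub>R\<^esub> g = f \<otimes>\<^bsub>R\<^esub> g \<oplus>\<^bsub>R\<^esub> f' \<otimes>\<^bsub>R\<^esub> g"
proof (rule R_eqI)
  let ?S = "supp f \<union> supp f'"
  fix \<gamma> c assume \<gamma>: "\<gamma> \<in> carrier G" and c: "c \<in> carrier (\<C> (inv\<^bsub>G\<^esub> \<gamma>))"
  have S: "finite ?S" "supp f \<subseteq> ?S" "supp f' \<subseteq> ?S" "?S \<subseteq> carrier G"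
    using R_finite f f' subsetD[OF supp_closed] by auto
  let ?h = "\<lambda>f \<alpha>. ldp \<alpha> (inv\<^bsub>G\<^esub> \<alpha> \<otimes>\<^bsub>G\<^esub> \<gamma>) (f \<alpha>) (g (inv\<^bsub>G\<^esub> \<alpha> \<otimes>\<^bsub>G\<^esub> \<gamma>)) c"
  have \<alpha>G: "\<alpha> \<in> carrier G" if "\<alpha> \<in> ?S" for \<alpha> using that S(4) by auto
  note \<alpha> = \<alpha>G complement_degree[OF \<alpha>G \<gamma>]
  have hc: "?h f \<alpha> \<in> carrier A" if "f \<in> carrier R" "\<alpha> \<in> ?S" for f \<alpha>
    by (rule ldp_value_closed[OF that(1) g \<alpha>(1)[OF that(2)] \<gamma> c])
  have "((f \<oplus>\<^bsub>R\<^esub> f') \<otimes>\<^bsub>R\<^esub> g) \<gamma> c = (\<Oplus>\<^bsub>A\<^esub>\<alpha>\<in>?S. ?h (f \<oplus>\<^bsub>R\<^esub> f') \<alpha>)"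
    by (rule R_mult_apply[OF R_add_closed[OF f f'] g S(1) R_add_supp S(4) \<gamma> c])
  also have "\<dots> = (\<Oplus>\<^bsub>A\<^esub>\<alpha>\<in>?S. ?h f \<alpha> \<oplus>\<^bsub>A\<^esub> ?h f' \<alpha>)"
  proof (rule A.finsum_cong'[OF refl])
    fix \<alpha> assume a: "\<alpha> \<in> ?S"
    show "?h (f \<oplus>\<^bsub>R\<^esub> f') \<alpha> = ?h f \<alpha> \<oplus>\<^bsub>A\<^esub> ?h f' \<alpha>"
      using \<alpha>[OF a] c f f' g
      by (intro ldp_add_left) (simp_all add: R_component R_add_apply)
  qed (use hc[OF f] hc[OF f'] in auto)
  also have "\<dots> = (\<Oplus>\<^bsub>A\<^esub>\<alpha>\<in>?S. ?h f \<alpha>) \<oplus>\<^bsub>A\<^esub> (\<Oplus>\<^bsub>A\<^esub>\<alpha>\<in>?S. ?h f' \<alpha>)"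
    by (rule A.finsum_addf) (use hc[OF f] hc[OF f'] in auto)
  also have "\<dots> = (f \<otimes>\<^bsub>R\<^esub> g \<oplus>\<^bsub>R\<^esub> f' \<otimes>\<^bsub>R\<^esub> g) \<gamma> c"
    using R_mult_apply[OF f g S(1,2,4) \<gamma> c] R_mult_apply[OF f' g S(1,3,4) \<gamma> c]
    by (simp only: R_add_apply[OF \<gamma> c])
  finally show "((f \<oplus>\<^bsub>R\<^esub> f') \<otimes>\<^bsub>R\<^esub> g) \<gamma> c = (f \<otimes>\<^bsub>R\<^esub> g \<oplus>\<^bsub>R\<^esub> f' \<otimes>\<^bsub>R\<^esub> g) \<gamma> c" .
qed (intro R_mult_closed R_add_closed f f' g)+

lemma R_r_distr:
  assumes f: "f \<in> carrier R" and g: "g \<in> carrier R" and g': "g' \<in> carrier R"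
  shows "f \<otimes>\<^bsub>R\<^esub> (g \<oplus>\<^bsub>R\<^esub> g') = f \<otimes>\<^bsub>R\<^esub> g \<oplus>\<^bsub>R\<^esub> f \<otimes>\<^bsub>R\<^esub> g'"
proof (rule R_eqI)
  fix \<gamma> c assume \<gamma>: "\<gamma> \<in> carrier G" and c: "c \<in> carrier (\<C> (inv\<^bsub>G\<^esub> \<gamma>))"
  let ?h = "\<lambda>g \<alpha>. ldp \<alpha> (inv\<^bsub>G\<^esub> \<alpha> \<otimes>\<^bsub>G\<^esub> \<gamma>) (f \<alpha>) (g (inv\<^bsub>G\<^esub> \<alpha> \<otimes>\<^bsub>G\<^esub> \<gamma>)) c"
  have \<alpha>G: "\<alpha> \<in> carrier G" if "\<alpha> \<in> supp f" for \<alpha> using that subsetD[OF supp_closed] by auto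
  note \<alpha> = \<alpha>G complement_degree[OF \<alpha>G \<gamma>]
  have hc: "?h g \<alpha> \<in> carrier A" if "g \<in> carrier R" "\<alpha> \<in> supp f" for g \<alpha>
    by (rule ldp_value_closed[OF f that(1) \<alpha>(1)[OF that(2)] \<gamma> c])
  note appl = R_mult_apply[OF f _ R_finite[OF f] subset_refl supp_closed \<gamma> c]
  have "(f \<otimes>\<^bsub>R\<^esub> (g \<oplus>\<^bsub>R\<^esub> g')) \<gamma> c = (\<Oplus>\<^bsub>A\<^esub>\<alpha>\<in>supp f. ?h (g \<oplus>\<^bsub>R\<^esub> g') \<alpha>)"
    by (rule appl[OF R_add_closed[OF g g']])
  also have "\<dots> = (\<Oplus>\<^bsub>A\<^esub>\<alpha>\<in>supp f. ?h g \<alpha> \<oplus>\<^bsub>A\<^esub> ?h g' \<alpha>)"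
  proof (rule A.finsum_cong'[OF refl])
    fix \<alpha> assume a: "\<alpha> \<in> supp f"
    show "?h (g \<oplus>\<^bsub>R\<^esub> g') \<alpha> = ?h g \<alpha> \<oplus>\<^bsub>A\<^esub> ?h g' \<alpha>"
      using \<alpha>[OF a] c f g g'
      by (intro ldp_add_right) (simp_all add: R_component R_add_apply)
  qed (use hc[OF g] hc[OF g'] in auto)
  also have "\<dots> = (\<Oplus>\<^bsub>A\<^esub>\<alpha>\<in>supp f. ?h g \<alpha>) \<oplus>\<^bsub>A\<^esub> (\<Oplus>\<^bsub>A\<^esub>\<alpha>\<in>supp f. ?h g' \<alpha>)"
    by (rule A.finsum_addf) (use hc[OF g] hc[OF g'] in auto)
  also have "\<dots> = (f \<otimes>\<^bsub>R\<^esub> g \<oplus>\<^bsub>R\<^esub> f \<otimes>\<^bsub>R\<^esub> g') \<gamma> c"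
    using appl[OF g] appl[OF g'] by (simp only: R_add_apply[OF \<gamma> c])
  finally show "(f \<otimes>\<^bsub>R\<^esub> (g \<oplus>\<^bsub>R\<^esub> g')) \<gamma> c = (f \<otimes>\<^bsub>R\<^esub> g \<oplus>\<^bsub>R\<^esub> f \<otimes>\<^bsub>R\<^esub> g') \<gamma> c" .
qed (intro R_mult_closed R_add_closed f g g')+

lemma homog_mult:
  assumes \<alpha>: "\<alpha> \<in> carrier G" and \<beta>: "\<beta> \<in> carrier G" and f: "f \<in> H \<alpha>" and g: "g \<in> H \<beta>"
  shows "homog \<alpha> f \<otimes>\<^bsub>R\<^esub> homog \<beta> g = homog (\<alpha> \<otimes>\<^bsub>G\<^esub> \<beta>) (ldp \<alpha> \<beta> f g)"
proof (rule R_eqI)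
  note hf = homog_closed[OF \<alpha> H_form[OF f]] and hg = homog_closed[OF \<beta> H_form[OF g]]
  show "homog \<alpha> f \<otimes>\<^bsub>R\<^esub> homog \<beta> g \<in> carrier R" by (rule R_mult_closed[OF hf hg])
  show "homog (\<alpha> \<otimes>\<^bsub>G\<^esub> \<beta>) (ldp \<alpha> \<beta> f g) \<in> carrier R"
    using \<alpha> \<beta> by (intro homog_closed H_form[OF ldp_closed] f g) auto
  fix \<gamma> c assume \<gamma>: "\<gamma> \<in> carrier G" and c: "c \<in> carrier (\<C> (inv\<^bsub>G\<^esub> \<gamma>))"
  note \<delta> = complement_degree[OF \<alpha> \<gamma>]
  have "ldp \<alpha> (inv\<^bsub>G\<^esub> \<alpha> \<otimes>\<^bsub>G\<^esub> \<gamma>) (homog \<alpha> f \<alpha>) (homog \<beta> g (inv\<^bsub>G\<^esub> \<alpha> \<otimes>\<^bsub>G\<^esub> \<gamma>)) c \<in> carrier A"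
    by (rule ldp_value_closed[OF hf hg \<alpha> \<gamma> c])
  then have "(homog \<alpha> f \<otimes>\<^bsub>R\<^esub> homog \<beta> g) \<gamma> c =
      ldp \<alpha> (inv\<^bsub>G\<^esub> \<alpha> \<otimes>\<^bsub>G\<^esub> \<gamma>) (homog \<alpha> f \<alpha>) (homog \<beta> g (inv\<^bsub>G\<^esub> \<alpha> \<otimes>\<^bsub>G\<^esub> \<gamma>)) c"
    using \<alpha> by (subst R_mult_apply[OF hf hg _ homog_supp _ \<gamma> c]) auto
  also have "\<dots> = homog (\<alpha> \<otimes>\<^bsub>G\<^esub> \<beta>) (ldp \<alpha> \<beta> f g) \<gamma> c"
  proof (cases "inv\<^bsub>G\<^esub> \<alpha> \<otimes>\<^bsub>G\<^esub> \<gamma> = \<beta>")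
    case True
    then have "\<gamma> = \<alpha> \<otimes>\<^bsub>G\<^esub> \<beta>" using \<delta> by simp
    then show ?thesis using True \<alpha> \<beta> \<gamma> c f g by (simp add: homog_same homog_apply)
  next
    case False
    then have "\<gamma> \<noteq> \<alpha> \<otimes>\<^bsub>G\<^esub> \<beta>" using \<alpha> \<beta> by (auto simp: G.m_assoc[symmetric])
    moreover have "ldp \<alpha> (inv\<^bsub>G\<^esub> \<alpha> \<otimes>\<^bsub>G\<^esub> \<gamma>) (homog \<alpha> f \<alpha>) (homog \<beta> g (inv\<^bsub>G\<^esub> \<alpha> \<otimes>\<^bsub>G\<^esub> \<gamma>)) c = \<zero>\<^bsub>A\<^esub>"
      using \<alpha> \<delta> c False R_component[OF hf \<alpha>]
      by (intro ldp_zero_right) (simp_all add: homog_apply)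
    ultimately show ?thesis using \<gamma> c by (simp add: homog_apply)
  qed
  finally show "(homog \<alpha> f \<otimes>\<^bsub>R\<^esub> homog \<beta> g) \<gamma> c = homog (\<alpha> \<otimes>\<^bsub>G\<^esub> \<beta>) (ldp \<alpha> \<beta> f g) \<gamma> c" .
qed

text \<open>The form \<open>\<epsilon>(-) a\<close>, which is the degree \<open>\<one>\<close> part of \<open>\<iota> a\<close>.\<close>

definition \<eta> :: "'a \<Rightarrow> 'c \<Rightarrow> 'a"
  where "\<eta> a = (\<lambda>c \<in> carrier (\<C> \<one>\<^bsub>G\<^esub>). \<epsilon> c \<otimes>\<^bsub>A\<^esub> a)"

text \<open>The ring homomorphism \<open>A \<rightarrow> R\<close> that gives each component of \<open>R\<close> its bimodule structure. Restriction of
scalars along \<open>\<iota>\<close> recovers the \<open>A\<close>-module underlying a comodule from the action of \<open>R\<close>.\<close>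

definition \<iota> :: "'a \<Rightarrow> 'g \<Rightarrow> 'c \<Rightarrow> 'a"
  where "\<iota> a = homog \<one>\<^bsub>G\<^esub> (\<eta> a)"

lemma counit_scale_form: "a \<in> carrier A \<Longrightarrow> (\<lambda>c. \<epsilon> c \<otimes>\<^bsub>A\<^esub> a) \<in> left_forms A (\<C> \<one>\<^bsub>G\<^esub>)"
  using counit_form by (intro left_formsI) (auto simp: left_formsD A.l_distr A.m_assoc)

lemma \<eta>_H: "a \<in> carrier A \<Longrightarrow> \<eta> a \<in> H \<one>\<^bsub>G\<^esub>"
  using H_restrict[of "\<one>\<^bsub>G\<^esub>"] counit_scale_form by (simp add: \<eta>_def)

lemma \<iota>_closed: "a \<in> carrier A \<Longrightarrow> \<iota> a \<in> carrier R"
  unfolding \<iota>_def by (intro homog_closed H_form \<eta>_H) auto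

text \<open>By the right counit axiom, contracting \<open>\<Delta>(c)\<close> with \<open>\<eta> a\<close> gives \<open>c a\<close>.\<close>

lemma ldp_\<eta>_left:
  assumes \<beta>: "\<beta> \<in> carrier G" and a: "a \<in> carrier A"
    and c: "c \<in> carrier (\<C> (inv\<^bsub>G\<^esub> \<beta>))"
  shows "ldp \<one>\<^bsub>G\<^esub> \<beta> (\<eta> a) g c = g (c \<triangleleft>\<^bsub>\<C> (inv\<^bsub>G\<^esub> \<beta>)\<^esub> a)"
proof -
  interpret bimodule_pair A "\<C> (inv\<^bsub>G\<^esub> \<beta>)" "\<C> \<one>\<^bsub>G\<^esub>" using \<beta> by (intro component_pair) auto
  have \<Delta>c: "comult C (inv\<^bsub>G\<^esub> \<beta>) \<one>\<^bsub>G\<^esub> c \<in> carrier T" using \<beta> c by (intro comult_closed) auto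
  have "contract (\<C> (inv\<^bsub>G\<^esub> \<beta>)) (\<eta> a) (comult C (inv\<^bsub>G\<^esub> \<beta>) \<one>\<^bsub>G\<^esub> c) = c \<triangleleft>\<^bsub>\<C> (inv\<^bsub>G\<^esub> \<beta>)\<^esub> a"
    using contract_cong[OF counit_scale_form[OF a] _ \<Delta>c, of "\<eta> a"]
      contract_scale[OF counit_form a \<Delta>c] \<beta> c by (simp add: \<eta>_def contract_counit)
  then show ?thesis using \<beta> c by (simp add: ldp_conv conv_apply)
qed

lemma ldp_\<eta>_right:
  assumes \<alpha>: "\<alpha> \<in> carrier G" and f: "f \<in> H \<alpha>"
    and c: "c \<in> carrier (\<C> (inv\<^bsub>G\<^esub> \<alpha>))"
  shows "ldp \<alpha> \<one>\<^bsub>G\<^esub> f (\<eta> a) c = f c \<otimes>\<^bsub>A\<^esub> a"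
proof -
  interpret bimodule_pair A "\<C> \<one>\<^bsub>G\<^esub>" "\<C> (inv\<^bsub>G\<^esub> \<alpha>)" using \<alpha> by (intro component_pair) auto
  have \<Delta>c: "comult C \<one>\<^bsub>G\<^esub> (inv\<^bsub>G\<^esub> \<alpha>) c \<in> carrier T" using \<alpha> c by (intro comult_closed) auto
  show ?thesis
    using \<alpha> c contract_closed[OF H_form[OF f] \<Delta>c]
    by (simp add: ldp_conv conv_apply \<eta>_def counit_contract H_form[OF f])
qed

lemma homog_mult_\<iota>:
  assumes \<alpha>: "\<alpha> \<in> carrier G" and f: "f \<in> H \<alpha>" and a: "a \<in> carrier A"
  shows "homog \<alpha> f \<otimes>\<^bsub>R\<^esub> \<iota> a = homog \<alpha> (\<lambda>c. f c \<otimes>\<^bsub>A\<^esub> a)"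
proof -
  have "homog \<alpha> f \<otimes>\<^bsub>R\<^esub> \<iota> a = homog \<alpha> (ldp \<alpha> \<one>\<^bsub>G\<^esub> f (\<eta> a))"
    unfolding \<iota>_def using homog_mult[OF \<alpha> _ f \<eta>_H[OF a]] \<alpha> by simp
  also have "\<dots> = homog \<alpha> (\<lambda>c. f c \<otimes>\<^bsub>A\<^esub> a)"
    by (rule homog_cong) (simp add: ldp_\<eta>_right \<alpha> f)
  finally show ?thesis .
qed

lemma \<iota>_mult_homog:
  assumes \<alpha>: "\<alpha> \<in> carrier G" and f: "f \<in> H \<alpha>" and a: "a \<in> carrier A"
  shows "\<iota> a \<otimes>\<^bsub>R\<^esub> homog \<alpha> f = homog \<alpha> (\<lambda>c. f (c \<triangleleft>\<^bsub>\<C> (inv\<^bsub>G\<^esub> \<alpha>)\<^esub> a))"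
proof -
  have "\<iota> a \<otimes>\<^bsub>R\<^esub> homog \<alpha> f = homog \<alpha> (ldp \<one>\<^bsub>G\<^esub> \<alpha> (\<eta> a) f)"
    unfolding \<iota>_def using homog_mult[OF _ \<alpha> \<eta>_H[OF a] f] \<alpha> by simp
  also have "\<dots> = homog \<alpha> (\<lambda>c. f (c \<triangleleft>\<^bsub>\<C> (inv\<^bsub>G\<^esub> \<alpha>)\<^esub> a))"
    by (rule homog_cong) (simp add: ldp_\<eta>_left \<alpha> a)
  finally show ?thesis .
qed

lemma R_one: "\<one>\<^bsub>R\<^esub> = \<iota> \<one>\<^bsub>A\<^esub>"
proof -
  have "\<one>\<^bsub>R\<^esub> = homog \<one>\<^bsub>G\<^esub> \<epsilon>" by (simp add: left_dual_ring_def homog_def)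
  also have "\<dots> = \<iota> \<one>\<^bsub>A\<^esub>"
    unfolding \<iota>_def by (rule homog_cong) (simp add: \<eta>_def left_formsD(1)[OF counit_form])
  finally show ?thesis .
qed

lemma \<iota>_add:
  assumes "a \<in> carrier A" "b \<in> carrier A"
  shows "\<iota> (a \<oplus>\<^bsub>A\<^esub> b) = \<iota> a \<oplus>\<^bsub>R\<^esub> \<iota> b"
  using assms
  by (intro R_eqI R_add_closed \<iota>_closed)
     (auto simp: R_add_apply \<iota>_def homog_apply \<eta>_def A.r_distr left_formsD(1)[OF counit_form])

lemma \<iota>_mult:
  assumes "a \<in> carrier A" "b \<in> carrier A"
  shows "\<iota> (a \<otimes>\<^bsub>A\<^esub> b) = \<iota> a \<otimes>\<^bsub>R\<^esub> \<iota> b"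
proof -
  have "\<iota> a \<otimes>\<^bsub>R\<^esub> \<iota> b = homog \<one>\<^bsub>G\<^esub> (\<lambda>c. \<eta> a c \<otimes>\<^bsub>A\<^esub> b)"
    unfolding \<iota>_def[of a] using assms by (intro homog_mult_\<iota> \<eta>_H) auto
  also have "\<dots> = \<iota> (a \<otimes>\<^bsub>A\<^esub> b)"
    unfolding \<iota>_def using assms
    by (intro homog_cong) (auto simp: \<eta>_def A.m_assoc left_formsD(1)[OF counit_form])
  finally show ?thesis by simp
qed

lemma R_mult_zero: "f \<otimes>\<^bsub>R\<^esub> \<zero>\<^bsub>R\<^esub> = \<zero>\<^bsub>R\<^esub>" "\<zero>\<^bsub>R\<^esub> \<otimes>\<^bsub>R\<^esub> f = \<zero>\<^bsub>R\<^esub>"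
proof -
  have "supp \<zero>\<^bsub>R\<^esub> = {}" using supp_subsetI[of "{}" "\<zero>\<^bsub>R\<^esub>"] by (simp add: R_zero_apply)
  then show "f \<otimes>\<^bsub>R\<^esub> \<zero>\<^bsub>R\<^esub> = \<zero>\<^bsub>R\<^esub>" "\<zero>\<^bsub>R\<^esub> \<otimes>\<^bsub>R\<^esub> f = \<zero>\<^bsub>R\<^esub>"
    by (simp_all add: R_mult) (simp_all add: left_dual_ring_def)
qed

text \<open>This is \<open>conv_assoc\<close> read in inverse degrees.\<close>

lemma homog_mult_assoc:
  assumes "\<alpha> \<in> carrier G" "\<beta> \<in> carrier G" "\<gamma> \<in> carrier G" "f \<in> H \<alpha>" "g \<in> H \<beta>" "h \<in> H \<gamma>"
  shows "(homog \<alpha> f \<otimes>\<^bsub>R\<^esub> homog \<beta> g) \<otimes>\<^bsub>R\<^esub> homog \<gamma> h = homog \<alpha> f \<otimes>\<^bsub>R\<^esub> (homog \<beta> g \<otimes>\<^bsub>R\<^esub> homog \<gamma> h)"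
proof -
  have "ldp (\<alpha> \<otimes>\<^bsub>G\<^esub> \<beta>) \<gamma> (ldp \<alpha> \<beta> f g) h = ldp \<alpha> (\<beta> \<otimes>\<^bsub>G\<^esub> \<gamma>) f (ldp \<beta> \<gamma> g h)"
    using assms conv_assoc[of "inv\<^bsub>G\<^esub> \<alpha>" "inv\<^bsub>G\<^esub> \<beta>" "inv\<^bsub>G\<^esub> \<gamma>" f g h]
    by (simp add: ldp_conv G.inv_mult_group H_form)
  then show ?thesis using assms by (simp add: homog_mult ldp_closed G.m_assoc)
qed

lemma R_mult_assoc:
  assumes f: "f \<in> carrier R" and g: "g \<in> carrier R" and h: "h \<in> carrier R"
  shows "(f \<otimes>\<^bsub>R\<^esub> g) \<otimes>\<^bsub>R\<^esub> h = f \<otimes>\<^bsub>R\<^esub> (g \<otimes>\<^bsub>R\<^esub> h)"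
  using f
proof (induction rule: R_induct)
  case (homog \<alpha> f')
  note hf = homog_closed[OF homog(1) H_form[OF homog(2)]]
  show ?case using g
  proof (induction rule: R_induct)
    case (homog \<beta> g')
    note hg = homog_closed[OF homog(1) H_form[OF homog(2)]]
    show ?case using h
      by (induction rule: R_induct)
         (simp_all add: R_mult_zero R_r_distr homog_mult_assoc R_mult_closed hf hg homog
            \<open>\<alpha> \<in> carrier G\<close> \<open>f' \<in> H \<alpha>\<close>)
  qed (simp_all add: R_mult_zero R_l_distr R_r_distr R_mult_closed hf h)
qed (simp_all add: R_mult_zero R_l_distr R_r_distr R_mult_closed g h)

lemma R_mult_one:
  assumes f: "f \<in> carrier R"
  shows "f \<otimes>\<^bsub>R\<^esub> \<one>\<^bsub>R\<^esub> = f" "\<one>\<^bsub>R\<^esub> \<otimes>\<^bsub>R\<^esub> f = f"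
proof -
  note one = \<iota>_closed[OF A.one_closed]
  have "f \<otimes>\<^bsub>R\<^esub> \<iota> \<one>\<^bsub>A\<^esub> = f \<and> \<iota> \<one>\<^bsub>A\<^esub> \<otimes>\<^bsub>R\<^esub> f = f" using f
  proof (induction rule: R_induct)
    case (homog \<alpha> f)
    then interpret abimodule A "\<C> (inv\<^bsub>G\<^esub> \<alpha>)" by (intro inv_component)
    have "homog \<alpha> (\<lambda>c. f c \<otimes>\<^bsub>A\<^esub> \<one>\<^bsub>A\<^esub>) = homog \<alpha> f"
      "homog \<alpha> (\<lambda>c. f (c \<triangleleft>\<^bsub>\<C> (inv\<^bsub>G\<^esub> \<alpha>)\<^esub> \<one>\<^bsub>A\<^esub>)) = homog \<alpha> f"
      using homog by (auto intro!: homog_cong simp: ract_one H_value)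
    then show ?case using homog by (simp add: homog_mult_\<iota> \<iota>_mult_homog)
  qed (simp_all add: R_mult_zero R_l_distr R_r_distr one)
  then show "f \<otimes>\<^bsub>R\<^esub> \<one>\<^bsub>R\<^esub> = f" "\<one>\<^bsub>R\<^esub> \<otimes>\<^bsub>R\<^esub> f = f" by (simp_all add: R_one)
qed

lemma R_ring: "ring R"
proof (rule ringI[OF R_abelian_group])
  show "monoid R"
    by (rule monoidI)
       (simp_all add: R_mult_closed R_mult_assoc R_mult_one, simp add: R_one \<iota>_closed)
qed (simp_all add: R_l_distr R_r_distr)

end

section \<open>Comodules as modules over the left dual ring\<close>

lemma F4_obj_simps [simp]:
  "carrier (F4_obj G A C M) = carrier M"
  "ring.add (F4_obj G A C M) = ring.add M"
  "ring.zero (F4_obj G A C M) = ring.zero M"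
  by (simp_all add: F4_obj_def)

context right_comodule
begin

abbreviation "FM \<equiv> F4_obj G A C M"
abbreviation "act \<alpha> f m \<equiv> contract M f (coact M (inv\<^bsub>G\<^esub> \<alpha>) m)"

lemma M_pair: "p \<in> carrier G \<Longrightarrow> tensor_pair A M (\<C> p)"
  by (rule module_pair[OF right_module_axioms])

lemma coact_closed: "p \<in> carrier G \<Longrightarrow> m \<in> carrier M \<Longrightarrow> coact M p m \<in> carrier (tensor_group A M (\<C> p))"
  using right_linearD(2)[OF coact_linear] by fastforce

lemma act_additive:
  assumes "\<alpha> \<in> carrier G" "f \<in> H \<alpha>"
  shows "act \<alpha> f \<in> additive M M"
proof -
  have p: "inv\<^bsub>G\<^esub> \<alpha> \<in> carrier G" using assms by simp
  interpret tensor_pair A M "\<C> (inv\<^bsub>G\<^esub> \<alpha>)" by (rule M_pair[OF p])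
  have "coact M (inv\<^bsub>G\<^esub> \<alpha>) \<in> additive M T"
    using right_linearD(1)[OF coact_linear[OF p]] by (simp add: additive_transfer[of "tensor_rmodule A M (\<C> (inv\<^bsub>G\<^esub> \<alpha>))" T])
  from additive_comp[OF this contract_additive[OF H_form[OF assms(2)]]] show ?thesis .
qed

lemma act_closed: "\<alpha> \<in> carrier G \<Longrightarrow> f \<in> H \<alpha> \<Longrightarrow> m \<in> carrier M \<Longrightarrow> act \<alpha> f m \<in> carrier M"
  using additive_closed[OF act_additive] .

lemma act_zero:
  assumes "\<alpha> \<in> carrier G" "m \<in> carrier M" "\<And>c. c \<in> carrier (\<C> (inv\<^bsub>G\<^esub> \<alpha>)) \<Longrightarrow> f c = \<zero>\<^bsub>A\<^esub>"
  shows "act \<alpha> f m = \<zero>\<^bsub>M\<^esub>"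
  using assms by (intro tensor_pair.contract_zero[OF M_pair[of "inv\<^bsub>G\<^esub> \<alpha>"]] coact_closed) auto

lemma act_add:
  assumes "\<alpha> \<in> carrier G" "m \<in> carrier M" "f \<in> H \<alpha>" "g \<in> H \<alpha>"
    "\<And>c. c \<in> carrier (\<C> (inv\<^bsub>G\<^esub> \<alpha>)) \<Longrightarrow> h c = f c \<oplus>\<^bsub>A\<^esub> g c"
  shows "act \<alpha> h m = act \<alpha> f m \<oplus>\<^bsub>M\<^esub> act \<alpha> g m"
proof -
  have p: "inv\<^bsub>G\<^esub> \<alpha> \<in> carrier G" using assms by simp
  interpret tensor_pair A M "\<C> (inv\<^bsub>G\<^esub> \<alpha>)" by (rule M_pair[OF p])
  note fg = H_form[OF assms(3)] H_form[OF assms(4)]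
  have "act \<alpha> h m = act \<alpha> (\<lambda>c. f c \<oplus>\<^bsub>A\<^esub> g c) m"
    using contract_cong[OF form_add[OF fg] _ coact_closed[OF p assms(2)], of h] assms(5) by simp
  then show ?thesis by (simp add: contract_add[OF fg coact_closed[OF p assms(2)]])
qed

text \<open>Coassociativity of the coaction, contracted with the form \<open>c \<otimes> d \<mapsto> g(c f(d))\<close>.\<close>

lemma act_ldp:
  assumes G: "\<alpha> \<in> carrier G" "\<beta> \<in> carrier G" and f: "f \<in> H \<alpha>" and g: "g \<in> H \<beta>"
    and m: "m \<in> carrier M"
  shows "act (\<alpha> \<otimes>\<^bsub>G\<^esub> \<beta>) (ldp \<alpha> \<beta> f g) m = act \<beta> g (act \<alpha> f m)"
proof -
  let ?p = "inv\<^bsub>G\<^esub> \<alpha>" and ?q = "inv\<^bsub>G\<^esub> \<beta>"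
  have pq: "?q \<in> carrier G" "?p \<in> carrier G" using G by auto
  have s: "coact M (?q \<otimes>\<^bsub>G\<^esub> ?p) m \<in> carrier (tensor_group A M (\<C> (?q \<otimes>\<^bsub>G\<^esub> ?p)))"
    using pq m by (intro coact_closed) auto
  have "contract M (conv ?q ?p f g) (coact M (?q \<otimes>\<^bsub>G\<^esub> ?p) m) = act \<beta> g (act \<alpha> f m)"
    using contract_comult[OF right_module_axioms pq H_form[OF f] H_form[OF g] s]
      contract_iterated[OF right_module_axioms right_module_axioms pq H_form[OF f] H_form[OF g]
        coact_linear[OF pq(1)] coact_closed[OF pq(2) m]]
      coact_coassociative[OF pq m] by (simp only:)
  then show ?thesis using G by (simp add: ldp_conv G.inv_mult_group)
qed

text \<open>By the counit axiom; the \<open>A\<close>-action of a comodule is therefore part of its \<open>R\<close>-action.\<close>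

lemma act_\<eta>:
  assumes a: "a \<in> carrier A" and m: "m \<in> carrier M"
  shows "act \<one>\<^bsub>G\<^esub> (\<eta> a) m = m \<triangleleft>\<^bsub>M\<^esub> a"
proof -
  interpret tensor_pair A M "\<C> \<one>\<^bsub>G\<^esub>" by (rule M_pair) auto
  have t: "coact M \<one>\<^bsub>G\<^esub> m \<in> carrier T" using m by (intro coact_closed) auto
  show ?thesis
    using contract_cong[OF counit_scale_form[OF a] _ t, of "\<eta> a"]
      contract_scale[OF counit_form a t] runit_tensor_map[OF counit_form t] coact_counit[OF m]
    by (simp add: \<eta>_def)
qed

lemma FM_ract: "m \<triangleleft>\<^bsub>FM\<^esub> f = (\<Oplus>\<^bsub>M\<^esub>\<alpha>\<in>supp f. act \<alpha> (f \<alpha>) m)"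
  by (simp add: F4_obj_def contract_def)

text \<open>As for the product of \<open>R\<close>, additivity in the scalar requires a common index set.\<close>

lemma FM_ract_superset:
  assumes "f \<in> carrier R" "m \<in> carrier M" "finite S" "supp f \<subseteq> S" "S \<subseteq> carrier G"
  shows "m \<triangleleft>\<^bsub>FM\<^esub> f = (\<Oplus>\<^bsub>M\<^esub>\<alpha>\<in>S. act \<alpha> (f \<alpha>) m)"
  unfolding FM_ract using assms
  by (intro M.add.finprod_mono_neutral_cong_left)
     (auto intro!: act_zero act_closed R_component simp: R_outside_supp subset_iff)

lemma FM_ract_closed: "f \<in> carrier R \<Longrightarrow> m \<in> carrier M \<Longrightarrow> m \<triangleleft>\<^bsub>FM\<^esub> f \<in> carrier M"
  unfolding FM_ract using subsetD[OF supp_closed, of _ f]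
  by (auto intro!: M.finsum_closed act_closed R_component)

lemma FM_ract_add:
  assumes f: "f \<in> carrier R" and "m \<in> carrier M" "n \<in> carrier M"
  shows "(m \<oplus>\<^bsub>M\<^esub> n) \<triangleleft>\<^bsub>FM\<^esub> f = m \<triangleleft>\<^bsub>FM\<^esub> f \<oplus>\<^bsub>M\<^esub> n \<triangleleft>\<^bsub>FM\<^esub> f"
proof -
  have cl: "act \<alpha> (f \<alpha>) m \<in> carrier M" if "\<alpha> \<in> supp f" "m \<in> carrier M" for \<alpha> m
    using that subsetD[OF supp_closed] f by (intro act_closed R_component) auto
  have "(m \<oplus>\<^bsub>M\<^esub> n) \<triangleleft>\<^bsub>FM\<^esub> f = (\<Oplus>\<^bsub>M\<^esub>\<alpha>\<in>supp f. act \<alpha> (f \<alpha>) m \<oplus>\<^bsub>M\<^esub> act \<alpha> (f \<alpha>) n)"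
    unfolding FM_ract
  proof (rule M.finsum_cong'[OF refl])
    fix \<alpha> assume "\<alpha> \<in> supp f"
    then have "\<alpha> \<in> carrier G" by (rule subsetD[OF supp_closed])
    with f assms(2,3) show "act \<alpha> (f \<alpha>) (m \<oplus>\<^bsub>M\<^esub> n) = act \<alpha> (f \<alpha>) m \<oplus>\<^bsub>M\<^esub> act \<alpha> (f \<alpha>) n"
      using additive_add[OF act_additive[OF _ R_component[OF f]]] by blast
  qed (use assms cl in auto)
  also have "\<dots> = m \<triangleleft>\<^bsub>FM\<^esub> f \<oplus>\<^bsub>M\<^esub> n \<triangleleft>\<^bsub>FM\<^esub> f"
    unfolding FM_ract by (rule M.finsum_addf) (use assms cl in auto)
  finally show ?thesis .
qed

lemma FM_ract_add_scalar:
  assumes f: "f \<in> carrier R" and g: "g \<in> carrier R" and m: "m \<in> carrier M"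
  shows "m \<triangleleft>\<^bsub>FM\<^esub> (f \<oplus>\<^bsub>R\<^esub> g) = m \<triangleleft>\<^bsub>FM\<^esub> f \<oplus>\<^bsub>M\<^esub> m \<triangleleft>\<^bsub>FM\<^esub> g"
proof -
  let ?S = "supp f \<union> supp g"
  have S: "finite ?S" "supp f \<subseteq> ?S" "supp g \<subseteq> ?S" "?S \<subseteq> carrier G"
    using R_finite f g subsetD[OF supp_closed] by auto
  have cl: "act \<alpha> (f \<alpha>) m \<in> carrier M" if "\<alpha> \<in> ?S" "f \<in> carrier R" for \<alpha> f
    using that S m by (intro act_closed R_component) auto
  have "m \<triangleleft>\<^bsub>FM\<^esub> (f \<oplus>\<^bsub>R\<^esub> g) = (\<Oplus>\<^bsub>M\<^esub>\<alpha>\<in>?S. act \<alpha> ((f \<oplus>\<^bsub>R\<^esub> g) \<alpha>) m)"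
    by (rule FM_ract_superset[OF R_add_closed[OF f g] m S(1) R_add_supp S(4)])
  also have "\<dots> = (\<Oplus>\<^bsub>M\<^esub>\<alpha>\<in>?S. act \<alpha> (f \<alpha>) m \<oplus>\<^bsub>M\<^esub> act \<alpha> (g \<alpha>) m)"
  proof (rule M.finsum_cong'[OF refl])
    fix \<alpha> assume "\<alpha> \<in> ?S"
    with S have \<alpha>: "\<alpha> \<in> carrier G" by auto
    show "act \<alpha> ((f \<oplus>\<^bsub>R\<^esub> g) \<alpha>) m = act \<alpha> (f \<alpha>) m \<oplus>\<^bsub>M\<^esub> act \<alpha> (g \<alpha>) m"
      by (rule act_add[OF \<alpha> m R_component[OF f \<alpha>] R_component[OF g \<alpha>]])
         (rule R_add_apply[OF \<alpha>])
  qed (use f g cl in auto)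
  also have "\<dots> = (\<Oplus>\<^bsub>M\<^esub>\<alpha>\<in>?S. act \<alpha> (f \<alpha>) m) \<oplus>\<^bsub>M\<^esub> (\<Oplus>\<^bsub>M\<^esub>\<alpha>\<in>?S. act \<alpha> (g \<alpha>) m)"
    by (rule M.finsum_addf) (use f g cl in auto)
  also have "\<dots> = m \<triangleleft>\<^bsub>FM\<^esub> f \<oplus>\<^bsub>M\<^esub> m \<triangleleft>\<^bsub>FM\<^esub> g"
    using FM_ract_superset[OF f m S(1,2,4)] FM_ract_superset[OF g m S(1,3,4)] by simp
  finally show ?thesis .
qed

lemma FM_ract_zero: "m \<triangleleft>\<^bsub>FM\<^esub> \<zero>\<^bsub>R\<^esub> = \<zero>\<^bsub>M\<^esub>"
proof -
  have "supp \<zero>\<^bsub>R\<^esub> = {}" using supp_subsetI[of "{}" "\<zero>\<^bsub>R\<^esub>"] by (simp add: R_zero_apply)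
  then show ?thesis by (simp add: FM_ract)
qed

lemma FM_ract_homog:
  assumes "\<alpha> \<in> carrier G" "f \<in> H \<alpha>" "m \<in> carrier M"
  shows "m \<triangleleft>\<^bsub>FM\<^esub> homog \<alpha> f = act \<alpha> f m"
  using FM_ract_superset[OF homog_closed[OF assms(1) H_form[OF assms(2)]] assms(3) _ homog_supp]
    act_closed[OF assms] assms by (simp add: homog_same)

lemma FM_ract_\<iota>: "a \<in> carrier A \<Longrightarrow> m \<in> carrier M \<Longrightarrow> m \<triangleleft>\<^bsub>FM\<^esub> \<iota> a = m \<triangleleft>\<^bsub>M\<^esub> a"
  unfolding \<iota>_def using FM_ract_homog[OF G.one_closed \<eta>_H] act_\<eta> by simp

lemma FM_ract_assoc:
  assumes f: "f \<in> carrier R" and g: "g \<in> carrier R" and m: "m \<in> carrier M"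
  shows "(m \<triangleleft>\<^bsub>FM\<^esub> f) \<triangleleft>\<^bsub>FM\<^esub> g = m \<triangleleft>\<^bsub>FM\<^esub> (f \<otimes>\<^bsub>R\<^esub> g)"
proof -
  interpret R: ring R by (rule R_ring)
  have zero: "\<zero>\<^bsub>M\<^esub> \<triangleleft>\<^bsub>FM\<^esub> h = \<zero>\<^bsub>M\<^esub>" if "h \<in> carrier R" for h
    by (rule additive_zero[OF _ M.abelian_group_axioms M.abelian_group_axioms])
       (auto intro!: additiveI FM_ract_closed FM_ract_add that)
  show ?thesis using f
  proof (induction rule: R_induct)
    case (homog \<alpha> f)
    note hf = homog_closed[OF homog(1) H_form[OF homog(2)]]
    show ?case using g
    proof (induction rule: R_induct)
      case (homog \<beta> g)
      then show ?case using \<open>\<alpha> \<in> carrier G\<close> \<open>f \<in> H \<alpha>\<close> m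
        by (simp add: homog_mult FM_ract_homog ldp_closed act_ldp act_closed)
    qed (simp_all add: FM_ract_zero FM_ract_closed FM_ract_add_scalar R.r_distr m hf)
  qed (simp_all add: FM_ract_zero zero g m R.l_distr FM_ract_add_scalar FM_ract_add FM_ract_closed)
qed

lemma FM_module: "right_module R FM"
proof (intro right_module.intro right_module_axioms.intro R_ring
    abelian_group_transfer[OF M.abelian_group_axioms])
  fix m assume "m \<in> carrier FM"
  then show "m \<triangleleft>\<^bsub>FM\<^esub> \<one>\<^bsub>R\<^esub> = m" by (simp add: R_one FM_ract_\<iota> ract_one)
qed (simp_all add: FM_ract_closed FM_ract_add FM_ract_add_scalar FM_ract_assoc)

end

section \<open>The two categories and the functor\<close>

context group_coring
begin

abbreviation comodules :: "(('g, 'a, 'c, 'm) comodule, 'm \<Rightarrow> 'm) cat"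
  where "comodules \<equiv> comodule_cat G A C"
abbreviation modules :: "(('g \<Rightarrow> 'c \<Rightarrow> 'a, 'm) rmodule, 'm \<Rightarrow> 'm) cat"
  where "modules \<equiv> rmodule_cat R"

lemma comodules_simps:
  "Obj comodules = {M. right_comodule G A C M}"
  "Hom comodules M N = {f \<in> right_linear A M N \<inter> extensional (carrier M).
       \<forall>\<alpha> \<in> carrier G. \<forall>m \<in> carrier M.
         tensor_map A N (component C \<alpha>) f (\<lambda>x. x) (coact M \<alpha> m) = coact N \<alpha> (f m)}"
  "Ident comodules M = (\<lambda>m \<in> carrier M. m)"
  "Comp comodules L M N g f = compose (carrier L) g f"
  by (simp_all add: comodule_cat_def)

lemma modules_simps:
  "Obj modules = {M. right_module R M}"
  "Hom modules M N = right_linear R M N \<inter> extensional (carrier M)"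
  "Ident modules M = (\<lambda>m \<in> carrier M. m)"
  "Comp modules L M N g f = compose (carrier L) g f"
  by (simp_all add: rmodule_cat_def)

end

lemma right_linearI:
  assumes "\<And>m. m \<in> carrier M \<Longrightarrow> f m \<in> carrier N"
    and "\<And>m n. m \<in> carrier M \<Longrightarrow> n \<in> carrier M \<Longrightarrow> f (m \<oplus>\<^bsub>M\<^esub> n) = f m \<oplus>\<^bsub>N\<^esub> f n"
    and "\<And>m a. m \<in> carrier M \<Longrightarrow> a \<in> carrier A \<Longrightarrow> f (m \<triangleleft>\<^bsub>M\<^esub> a) = f m \<triangleleft>\<^bsub>N\<^esub> a"
  shows "f \<in> right_linear A M N"
  using assms by (auto simp: right_linear_def hom_def)

lemma right_linear_compose:
  assumes "right_module A L" "f \<in> right_linear A L M" "g \<in> right_linear A M N"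
  shows "compose (carrier L) g f \<in> right_linear A L N"
proof -
  interpret right_module A L by fact
  show ?thesis using right_linearD[OF assms(2)] right_linearD[OF assms(3)]
    by (intro right_linearI) (simp_all add: compose_def ract_closed)
qed

lemma right_linear_restrict_id:
  assumes "right_module A M"
  shows "(\<lambda>m\<in>carrier M. m) \<in> right_linear A M M"
proof -
  interpret right_module A M by fact
  show ?thesis by (intro right_linearI) (simp_all add: ract_closed)
qed

lemma right_linear_funcset: "f \<in> right_linear A M N \<Longrightarrow> f \<in> carrier M \<rightarrow> carrier N"
  by (auto intro: right_linearD(2))

lemma rmodule_category: "category (rmodule_cat R :: (('r, 'm) rmodule, 'm \<Rightarrow> 'm) cat)"
proof unfold_locales
  fix W X Y Z :: "('r, 'm) rmodule" and f g h :: "'m \<Rightarrow> 'm"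
  let ?C = "rmodule_cat R :: (('r, 'm) rmodule, 'm \<Rightarrow> 'm) cat"
  note [simp] = rmodule_cat_def
  show "Ident ?C X \<in> Hom ?C X X" if "X \<in> Obj ?C"
    using that by (simp add: right_linear_restrict_id)
  show "Comp ?C X Y Z g f \<in> Hom ?C X Z"
    if "X \<in> Obj ?C" "Y \<in> Obj ?C" "Z \<in> Obj ?C" "f \<in> Hom ?C X Y" "g \<in> Hom ?C Y Z"
    using that right_linear_compose[of R X f Y g Z] by simp
  show "Comp ?C X X Y f (Ident ?C X) = f" if "X \<in> Obj ?C" "Y \<in> Obj ?C" "f \<in> Hom ?C X Y"
    using that compose_Id[OF right_linear_funcset[of f R X Y]] by simp
  show "Comp ?C X Y Y (Ident ?C Y) f = f" if "X \<in> Obj ?C" "Y \<in> Obj ?C" "f \<in> Hom ?C X Y"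
    using that Id_compose[OF right_linear_funcset[of f R X Y]] by simp
  show "Comp ?C W Y Z h (Comp ?C W X Y g f) = Comp ?C W X Z (Comp ?C X Y Z h g) f"
    if "W \<in> Obj ?C" "X \<in> Obj ?C" "Y \<in> Obj ?C" "Z \<in> Obj ?C"
      "f \<in> Hom ?C W X" "g \<in> Hom ?C X Y" "h \<in> Hom ?C Y Z"
    using that compose_assoc[OF right_linear_funcset[of f R W X], of h g] by simp
qed

context group_coring
begin

lemma comodule_category: "category (comodules :: (('g, 'a, 'c, 'm) comodule, 'm \<Rightarrow> 'm) cat)"
proof unfold_locales
  fix W X Y Z :: "('g, 'a, 'c, 'm) comodule" and f g h :: "'m \<Rightarrow> 'm"
  let ?C = "comodules :: (('g, 'a, 'c, 'm) comodule, 'm \<Rightarrow> 'm) cat"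
  note [simp] = comodules_simps
  have lin: "f \<in> right_linear A X Y" if "f \<in> Hom ?C X Y" for X Y :: "('g, 'a, 'c, 'm) comodule" and f
    using that by simp
  show "Ident ?C X \<in> Hom ?C X X" if "X \<in> Obj ?C"
  proof -
    interpret X: right_comodule G A C X using that by simp
    let ?i = "\<lambda>m\<in>carrier X. m"
    have i: "?i \<in> right_linear A X X" by (rule right_linear_restrict_id[OF X.right_module_axioms])
    have "tensor_map A X (\<C> \<alpha>) ?i (\<lambda>x. x) (coact X \<alpha> m) = coact X \<alpha> m"
      if \<alpha>: "\<alpha> \<in> carrier G" and m: "m \<in> carrier X" for \<alpha> m
    proof -
      interpret tensor_pair A X "\<C> \<alpha>" by (rule X.M_pair[OF \<alpha>])
      note pp = tensor_pair_axioms tensor_pair_axioms i id_left_linear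
      show ?thesis
        by (rule additive_eqI[OF X.coact_closed[OF \<alpha> m] tensor_map_additive[OF pp] additive_id])
           (simp add: tensor_map_pure[OF pp])
    qed
    with i show ?thesis by simp
  qed
  show "Comp ?C X Y Z g f \<in> Hom ?C X Z"
    if XYZ: "X \<in> Obj ?C" "Y \<in> Obj ?C" "Z \<in> Obj ?C" and f: "f \<in> Hom ?C X Y" and g: "g \<in> Hom ?C Y Z"
  proof -
    interpret X: right_comodule G A C X using XYZ by simp
    interpret Y: right_comodule G A C Y using XYZ by simp
    interpret Z: right_comodule G A C Z using XYZ by simp
    let ?gf = "compose (carrier X) g f"
    have gf: "?gf \<in> right_linear A X Z"
      by (rule right_linear_compose[OF X.right_module_axioms lin[OF f] lin[OF g]])
    have "tensor_map A Z (\<C> \<alpha>) ?gf (\<lambda>x. x) (coact X \<alpha> m) = coact Z \<alpha> (?gf m)"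
      if \<alpha>: "\<alpha> \<in> carrier G" and m: "m \<in> carrier X" for \<alpha> m
    proof -
      interpret XP: tensor_pair A X "\<C> \<alpha>" by (rule X.M_pair[OF \<alpha>])
      interpret YP: tensor_pair A Y "\<C> \<alpha>" by (rule Y.M_pair[OF \<alpha>])
      interpret ZP: tensor_pair A Z "\<C> \<alpha>" by (rule Z.M_pair[OF \<alpha>])
      note p1 = XP.tensor_pair_axioms YP.tensor_pair_axioms lin[OF f] id_left_linear
      note p2 = YP.tensor_pair_axioms ZP.tensor_pair_axioms lin[OF g] id_left_linear
      note p3 = XP.tensor_pair_axioms ZP.tensor_pair_axioms gf id_left_linear
      have "tensor_map A Z (\<C> \<alpha>) ?gf (\<lambda>x. x) (coact X \<alpha> m) =
          tensor_map A Z (\<C> \<alpha>) g (\<lambda>x. x) (tensor_map A Y (\<C> \<alpha>) f (\<lambda>x. x) (coact X \<alpha> m))"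
        by (rule XP.additive_eqI[OF X.coact_closed[OF \<alpha> m] tensor_map_additive[OF p3]
              additive_comp[OF tensor_map_additive[OF p1] tensor_map_additive[OF p2]]])
           (simp add: tensor_map_pure[OF p1] tensor_map_pure[OF p2] tensor_map_pure[OF p3]
              right_linearD(2)[OF lin[OF f]] compose_eq)
      also have "\<dots> = coact Z \<alpha> (g (f m))"
        using f g \<alpha> m right_linearD(2)[OF lin[OF f] m] by simp
      finally show ?thesis using m by (simp add: compose_eq)
    qed
    with gf show ?thesis by simp
  qed
  show "Comp ?C X X Y f (Ident ?C X) = f" if "X \<in> Obj ?C" "Y \<in> Obj ?C" "f \<in> Hom ?C X Y"
    using that compose_Id[OF right_linear_funcset[of f A X Y]] by simp
  show "Comp ?C X Y Y (Ident ?C Y) f = f" if "X \<in> Obj ?C" "Y \<in> Obj ?C" "f \<in> Hom ?C X Y"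
    using that Id_compose[OF right_linear_funcset[of f A X Y]] by simp
  show "Comp ?C W Y Z h (Comp ?C W X Y g f) = Comp ?C W X Z (Comp ?C X Y Z h g) f"
    if "W \<in> Obj ?C" "X \<in> Obj ?C" "Y \<in> Obj ?C" "Z \<in> Obj ?C"
      "f \<in> Hom ?C W X" "g \<in> Hom ?C X Y" "h \<in> Hom ?C Y Z"
    using that compose_assoc[OF right_linear_funcset[of f A W X], of h g] by simp
qed

lemma comodule_hom_act:
  assumes "right_comodule G A C M" "right_comodule G A C N" "\<phi> \<in> Hom comodules M N"
    and \<alpha>: "\<alpha> \<in> carrier G" and f: "f \<in> H \<alpha>" and m: "m \<in> carrier M"
  shows "\<phi> (contract M f (coact M (inv\<^bsub>G\<^esub> \<alpha>) m)) = contract N f (coact N (inv\<^bsub>G\<^esub> \<alpha>) (\<phi> m))"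
proof -
  interpret M: right_comodule G A C M by fact
  interpret N: right_comodule G A C N by fact
  have p: "inv\<^bsub>G\<^esub> \<alpha> \<in> carrier G" using \<alpha> by simp
  interpret P: tensor_pair A M "\<C> (inv\<^bsub>G\<^esub> \<alpha>)" by (rule M.M_pair[OF p])
  have \<phi>: "\<phi> \<in> right_linear A M N"
    "tensor_map A N (\<C> (inv\<^bsub>G\<^esub> \<alpha>)) \<phi> (\<lambda>x. x) (coact M (inv\<^bsub>G\<^esub> \<alpha>) m) = coact N (inv\<^bsub>G\<^esub> \<alpha>) (\<phi> m)"
    using assms(3) p m by (auto simp: comodules_simps)
  show ?thesis
    using P.contract_natural[OF N.right_module_axioms \<phi>(1) H_form[OF f] M.coact_closed[OF p m]]
    by (simp add: \<phi>(2))
qed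

text \<open>On homogeneous elements this is naturality of the contraction, since a comodule morphism commutes
with the coactions.\<close>

lemma F4_hom:
  assumes "right_comodule G A C M" "right_comodule G A C N" "\<phi> \<in> Hom comodules M N"
  shows "\<phi> \<in> Hom modules (F4_obj G A C M) (F4_obj G A C N)"
proof -
  interpret M: right_comodule G A C M by fact
  interpret N: right_comodule G A C N by fact
  have \<phi>: "\<phi> \<in> right_linear A M N" "\<phi> \<in> extensional (carrier M)"
    using assms(3) by (auto simp: comodules_simps)
  have "\<phi> (m \<triangleleft>\<^bsub>M.FM\<^esub> f) = \<phi> m \<triangleleft>\<^bsub>N.FM\<^esub> f" if f: "f \<in> carrier R" and m: "m \<in> carrier M" for f m
    using f
  proof (induction rule: R_induct)
    case zero
    then show ?case
      using additive_zero[OF right_linearD(1)[OF \<phi>(1)] M.M.abelian_group_axioms N.M.abelian_group_axioms]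
      by (simp add: M.FM_ract_zero N.FM_ract_zero)
  next
    case (homog \<alpha> f)
    then show ?case
      using comodule_hom_act[OF assms] m right_linearD(2)[OF \<phi>(1)]
      by (simp add: M.FM_ract_homog N.FM_ract_homog)
  next
    case (add f g)
    then show ?case using m right_linearD(2,3)[OF \<phi>(1)]
      by (simp add: M.FM_ract_add_scalar N.FM_ract_add_scalar M.FM_ract_closed)
  qed
  then show ?thesis
    using \<phi> right_linearD[OF \<phi>(1)] by (auto simp: modules_simps intro!: right_linearI)
qed

lemma F4_functor:
  "functor_between (comodules :: (('g, 'a, 'c, 'm) comodule, 'm \<Rightarrow> 'm) cat) modules (F4 G A C)"
proof (intro functor_between.intro comodule_category rmodule_category functor_between_axioms.intro)
  fix X Y :: "('g, 'a, 'c, 'm) comodule" and f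
  assume X: "X \<in> Obj comodules"
  then show "obj_map (F4 G A C) X \<in> Obj modules"
    using right_comodule.FM_module by (simp add: F4_def comodules_simps modules_simps)
  assume "Y \<in> Obj comodules" "f \<in> Hom comodules X Y"
  with X show "arr_map (F4 G A C) X Y f \<in> Hom modules (obj_map (F4 G A C) X) (obj_map (F4 G A C) Y)"
    using F4_hom by (simp add: F4_def comodules_simps(1))
qed (simp_all add: F4_def comodules_simps modules_simps)

end

section \<open>Modules over the left dual ring as comodules\<close>

lemma left_homogeneously_finite_dual_basis:
  fixes C :: "('g, 'a, 'c) coring"
  assumes "group_coring G A C" "left_homogeneously_finite G A C" "p \<in> carrier G"
  obtains J :: "'c set" and e f where "dual_basis A (component C p) J e f"
proof -
  interpret group_coring G A C by fact
  show thesis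
    using abimodule.dual_basis_exists[OF component_bimodule[OF assms(3)]] assms(2,3) that
    by (auto simp: left_homogeneously_finite_def)
qed

text \<open>Restriction of scalars along \<open>\<iota>\<close>. The coaction is left open, but the record already has the type of
comodules: tensor products over it and over the finished comodule are then the same sets.\<close>

definition scalar_module ::
  "('g, 'x) monoid_scheme \<Rightarrow> ('a, 'y) ring_scheme \<Rightarrow> ('g, 'a, 'c) coring
    \<Rightarrow> ('g \<Rightarrow> 'c \<Rightarrow> 'a, 'm) rmodule \<Rightarrow> ('g, 'a, 'c, 'm) comodule"
  where "scalar_module G A C N =
    \<lparr>carrier = carrier N, monoid.mult = monoid.mult N, one = one N,
     ring.zero = ring.zero N, ring.add = ring.add N,
     ract = (\<lambda>n a. n \<triangleleft>\<^bsub>N\<^esub> group_coring.\<iota> G A C a), coact = undefined\<rparr>"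

text \<open>The coaction is described by its contractions and not by a formula in a dual basis, so that it is
manifestly independent of the choice of one.\<close>

definition comodule_of_module ::
  "('g, 'x) monoid_scheme \<Rightarrow> ('a, 'y) ring_scheme \<Rightarrow> ('g, 'a, 'c) coring
    \<Rightarrow> ('g \<Rightarrow> 'c \<Rightarrow> 'a, 'm) rmodule \<Rightarrow> ('g, 'a, 'c, 'm) comodule"
  where "comodule_of_module G A C N = (scalar_module G A C N)
    \<lparr>coact := (\<lambda>p n. THE t. t \<in> carrier (tensor_group A (scalar_module G A C N) (component C p)) \<and>
       (\<forall>f \<in> left_forms A (component C p).
          contract (scalar_module G A C N) f t = n \<triangleleft>\<^bsub>N\<^esub> group_coring.homog G A C (inv\<^bsub>G\<^esub> p) f))\<rparr>"

definition F4_inverse ::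
  "('g, 'x) monoid_scheme \<Rightarrow> ('a, 'y) ring_scheme \<Rightarrow> ('g, 'a, 'c) coring
    \<Rightarrow> (('g \<Rightarrow> 'c \<Rightarrow> 'a, 'm) rmodule, 'm \<Rightarrow> 'm, ('g, 'a, 'c, 'm) comodule, 'm \<Rightarrow> 'm) fctr"
  where "F4_inverse G A C = \<lparr>obj_map = comodule_of_module G A C, arr_map = (\<lambda>M N f. f)\<rparr>"

lemma comodule_of_module_simps [simp]:
  "carrier (comodule_of_module G A C N) = carrier N"
  "ring.add (comodule_of_module G A C N) = ring.add N"
  "ring.zero (comodule_of_module G A C N) = ring.zero N"
  "ract (comodule_of_module G A C N) = (\<lambda>n a. n \<triangleleft>\<^bsub>N\<^esub> group_coring.\<iota> G A C a)"
  by (simp_all add: comodule_of_module_def scalar_module_def)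

lemma scalar_module_simps [simp]:
  "carrier (scalar_module G A C N) = carrier N"
  "ring.add (scalar_module G A C N) = ring.add N"
  "ring.zero (scalar_module G A C N) = ring.zero N"
  "ract (scalar_module G A C N) = (\<lambda>n a. n \<triangleleft>\<^bsub>N\<^esub> group_coring.\<iota> G A C a)"
  by (simp_all add: scalar_module_def)

lemma tensor_group_scalar_module:
  "tensor_group A (scalar_module G A C N) P = tensor_group A (comodule_of_module G A C N) P"
proof -
  have "tensor_relations A (scalar_module G A C N) P = tensor_relations A (comodule_of_module G A C N) P"
    by (simp add: tensor_relations_def)
  then show ?thesis by (simp add: tensor_group_def tensor_quotient_def tensor_kernel_def)
qed

lemma contract_scalar_module:
  "contract (scalar_module G A C N) = contract (comodule_of_module G A C N)"
  by (simp add: fun_eq_iff contract_def tensor_lift_def finsum_def add_pow_def)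

context group_coring
begin

lemma R_finsum_apply:
  assumes I: "finite I" and h: "h \<in> I \<rightarrow> carrier R"
    and \<alpha>: "\<alpha> \<in> carrier G" and c: "c \<in> carrier (\<C> (inv\<^bsub>G\<^esub> \<alpha>))"
  shows "(\<Oplus>\<^bsub>R\<^esub>i\<in>I. h i) \<alpha> c = (\<Oplus>\<^bsub>A\<^esub>i\<in>I. h i \<alpha> c)"
  by (rule additive_finsum[OF _ R_abelian_group A.is_abelian_group I h, where f = "\<lambda>f. f \<alpha> c"])
     (auto intro!: additiveI R_value \<alpha> c simp: R_add_apply[OF \<alpha> c])

context
  fixes N :: "('g \<Rightarrow> 'c \<Rightarrow> 'a, 'm) rmodule"
  assumes fin: "left_homogeneously_finite G A C" and N: "right_module R N"
begin

interpretation N: right_module R N by (rule N)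

abbreviation "KN \<equiv> comodule_of_module G A C N"

lemma KN_right_module: "right_module A KN"
proof (intro right_module.intro right_module_axioms.intro A.ring_axioms
    abelian_group_transfer[OF N.M.abelian_group_axioms])
  fix n assume "n \<in> carrier KN"
  then show "n \<triangleleft>\<^bsub>KN\<^esub> \<one>\<^bsub>A\<^esub> = n" using N.ract_one by (simp add: R_one)
qed (simp_all add: N.ract_closed N.ract_add N.ract_add_scalar N.ract_assoc \<iota>_closed \<iota>_add \<iota>_mult)

lemma KN_pair: "p \<in> carrier G \<Longrightarrow> tensor_pair A KN (\<C> p)"
  by (rule module_pair[OF KN_right_module])

lemma homog_inv_closed:
  "p \<in> carrier G \<Longrightarrow> f \<in> left_forms A (\<C> p) \<Longrightarrow> homog (inv\<^bsub>G\<^esub> p) f \<in> carrier R"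
  by (intro homog_closed) auto

lemma tensor_eq_by_forms:
  assumes "tensor_pair A X (\<C> p)" and p: "p \<in> carrier G"
    and s: "s \<in> carrier (tensor_group A X (\<C> p))" and t: "t \<in> carrier (tensor_group A X (\<C> p))"
    and eq: "\<And>f. f \<in> left_forms A (\<C> p) \<Longrightarrow> contract X f s = contract X f t"
  shows "s = t"
proof -
  obtain J :: "'c set" and e f where b: "dual_basis A (\<C> p) J e f"
    using left_homogeneously_finite_dual_basis[OF group_coring_axioms fin p] .
  show ?thesis
    by (rule tensor_pair.tensor_eqI[OF assms(1) b s t]) (use b in \<open>auto simp: dual_basis_def eq\<close>)
qed

text \<open>The element is \<open>\<Sum>\<^sub>j n \<cdot> f\<^sub>j \<otimes> e\<^sub>j\<close> for a dual basis \<open>(e\<^sub>j, f\<^sub>j)\<close>. Its contraction with \<open>g\<close> is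
\<open>\<Sum>\<^sub>j n \<cdot> f\<^sub>j \<cdot> \<iota>(g(e\<^sub>j)) = n \<cdot> (\<Sum>\<^sub>j f\<^sub>j(-) g(e\<^sub>j)) = n \<cdot> g\<close>.\<close>

lemma coact_exists:
  assumes p: "p \<in> carrier G" and n: "n \<in> carrier N"
  shows "\<exists>t \<in> carrier (tensor_group A KN (\<C> p)). \<forall>g \<in> left_forms A (\<C> p).
    contract KN g t = n \<triangleleft>\<^bsub>N\<^esub> homog (inv\<^bsub>G\<^esub> p) g"
proof -
  interpret P: tensor_pair A KN "\<C> p" by (rule KN_pair[OF p])
  obtain J :: "'c set" and e f where b: "dual_basis A (\<C> p) J e f"
    using left_homogeneously_finite_dual_basis[OF group_coring_axioms fin p] .
  have J: "finite J" and e: "\<And>j. j \<in> J \<Longrightarrow> e j \<in> carrier (\<C> p)"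
    and f: "\<And>j. j \<in> J \<Longrightarrow> f j \<in> left_forms A (\<C> p)"
    and exp: "\<And>c. c \<in> carrier (\<C> p) \<Longrightarrow> c = (\<Oplus>\<^bsub>\<C> p\<^esub>j\<in>J. f j c \<triangleright>\<^bsub>\<C> p\<^esub> e j)"
    using b by (auto simp: dual_basis_def)
  let ?\<alpha> = "inv\<^bsub>G\<^esub> p"
  have \<alpha>: "?\<alpha> \<in> carrier G" "inv\<^bsub>G\<^esub> ?\<alpha> = p" using p by auto
  let ?x = "\<lambda>j. n \<triangleleft>\<^bsub>N\<^esub> homog ?\<alpha> (f j)"
  have x: "?x j \<in> carrier KN" if "j \<in> J" for j
    using that n p by (simp add: N.ract_closed homog_inv_closed f)
  let ?t = "\<Oplus>\<^bsub>P.T\<^esub>j\<in>J. P.pure (?x j) (e j)"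
  have xe: "(\<lambda>j. P.pure (?x j) (e j)) \<in> J \<rightarrow> carrier P.T"
    using x e by (auto intro!: P.pure_closed)
  have "contract KN g ?t = n \<triangleleft>\<^bsub>N\<^esub> homog ?\<alpha> g" if g: "g \<in> left_forms A (\<C> p)" for g
  proof -
    have ge: "g (e j) \<in> carrier A" if "j \<in> J" for j using left_formsD(1)[OF g e[OF that]] .
    have fg: "(\<lambda>c. f j c \<otimes>\<^bsub>A\<^esub> g (e j)) \<in> left_forms A (\<C> p)" if "j \<in> J" for j
      by (rule P.form_scale[OF f[OF that] ge[OF that]])
    have hc: "(\<lambda>j. homog ?\<alpha> (\<lambda>c. f j c \<otimes>\<^bsub>A\<^esub> g (e j))) \<in> J \<rightarrow> carrier R"
      using fg p by (auto intro!: homog_inv_closed)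
    have tm: "contract KN g (P.pure (?x j) (e j)) = n \<triangleleft>\<^bsub>N\<^esub> homog ?\<alpha> (\<lambda>c. f j c \<otimes>\<^bsub>A\<^esub> g (e j))"
      if j: "j \<in> J" for j
    proof -
      have "homog ?\<alpha> (f j) \<otimes>\<^bsub>R\<^esub> \<iota> (g (e j)) =
          homog ?\<alpha> (restrict (f j) (carrier (\<C> (inv\<^bsub>G\<^esub> ?\<alpha>)))) \<otimes>\<^bsub>R\<^esub> \<iota> (g (e j))"
        by (simp only: homog_restrict)
      also have "\<dots> = homog ?\<alpha> (\<lambda>c. restrict (f j) (carrier (\<C> (inv\<^bsub>G\<^esub> ?\<alpha>))) c \<otimes>\<^bsub>A\<^esub> g (e j))"
        using \<alpha> f[OF j] by (intro homog_mult_\<iota> H_restrict ge[OF j]) simp_all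
      also have "\<dots> = homog ?\<alpha> (\<lambda>c. f j c \<otimes>\<^bsub>A\<^esub> g (e j))"
        by (rule homog_cong) simp
      finally have "homog ?\<alpha> (f j) \<otimes>\<^bsub>R\<^esub> \<iota> (g (e j)) = homog ?\<alpha> (\<lambda>c. f j c \<otimes>\<^bsub>A\<^esub> g (e j))" .
      moreover have "contract KN g (P.pure (?x j) (e j)) = ?x j \<triangleleft>\<^bsub>N\<^esub> \<iota> (g (e j))"
        using P.contract_pure[OF g x[OF j] e[OF j]] by simp
      ultimately show ?thesis
        using N.ract_assoc[OF n homog_inv_closed[OF p f[OF j]] \<iota>_closed[OF ge[OF j]]] by simp
    qed
    have "contract KN g ?t = (\<Oplus>\<^bsub>KN\<^esub>j\<in>J. contract KN g (P.pure (?x j) (e j)))"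
      by (rule additive_finsum[OF P.contract_additive[OF g] P.T_abelian_group
            P.M.M.abelian_group_axioms J xe])
    also have "\<dots> = (\<Oplus>\<^bsub>N\<^esub>j\<in>J. contract KN g (P.pure (?x j) (e j)))"
      by (rule finsum_transfer) simp_all
    also have "\<dots> = (\<Oplus>\<^bsub>N\<^esub>j\<in>J. n \<triangleleft>\<^bsub>N\<^esub> homog ?\<alpha> (\<lambda>c. f j c \<otimes>\<^bsub>A\<^esub> g (e j)))"
      using hc n by (intro N.M.finsum_cong') (auto simp: tm intro!: N.ract_closed)
    also have "\<dots> = n \<triangleleft>\<^bsub>N\<^esub> (\<Oplus>\<^bsub>R\<^esub>j\<in>J. homog ?\<alpha> (\<lambda>c. f j c \<otimes>\<^bsub>A\<^esub> g (e j)))"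
      by (rule additive_finsum[OF N.ract_scalar_additive[OF n] R_abelian_group
            N.M.abelian_group_axioms J hc, symmetric])
    also have "(\<Oplus>\<^bsub>R\<^esub>j\<in>J. homog ?\<alpha> (\<lambda>c. f j c \<otimes>\<^bsub>A\<^esub> g (e j))) = homog ?\<alpha> g"
    proof (rule R_eqI)
      show "(\<Oplus>\<^bsub>R\<^esub>j\<in>J. homog ?\<alpha> (\<lambda>c. f j c \<otimes>\<^bsub>A\<^esub> g (e j))) \<in> carrier R"
        using abelian_group.axioms(1)[OF R_abelian_group] hc by (rule abelian_monoid.finsum_closed)
      show "homog ?\<alpha> g \<in> carrier R" by (rule homog_inv_closed[OF p g])
      fix \<gamma> c assume \<gamma>: "\<gamma> \<in> carrier G" and c: "c \<in> carrier (\<C> (inv\<^bsub>G\<^esub> \<gamma>))"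
      have "(\<Oplus>\<^bsub>R\<^esub>j\<in>J. homog ?\<alpha> (\<lambda>c. f j c \<otimes>\<^bsub>A\<^esub> g (e j))) \<gamma> c =
          (\<Oplus>\<^bsub>A\<^esub>j\<in>J. homog ?\<alpha> (\<lambda>c. f j c \<otimes>\<^bsub>A\<^esub> g (e j)) \<gamma> c)"
        by (rule R_finsum_apply[OF J hc \<gamma> c])
      also have "\<dots> = homog ?\<alpha> g \<gamma> c"
      proof (cases "\<gamma> = ?\<alpha>")
        case True
        with c \<alpha> have c': "c \<in> carrier (\<C> p)" by simp
        have fe: "(\<lambda>j. f j c \<triangleright>\<^bsub>\<C> p\<^esub> e j) \<in> J \<rightarrow> carrier (\<C> p)"
          using left_formsD(1)[OF f c'] e by (auto intro!: P.N.lact_closed)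
        have "g c = g (\<Oplus>\<^bsub>\<C> p\<^esub>j\<in>J. f j c \<triangleright>\<^bsub>\<C> p\<^esub> e j)" using exp[OF c'] by simp
        also have "\<dots> = (\<Oplus>\<^bsub>A\<^esub>j\<in>J. g (f j c \<triangleright>\<^bsub>\<C> p\<^esub> e j))"
          by (rule additive_finsum[OF P.N.form_additive[OF g] P.N.M.abelian_group_axioms
                A.is_abelian_group J fe])
        also have "\<dots> = (\<Oplus>\<^bsub>A\<^esub>j\<in>J. homog ?\<alpha> (\<lambda>c. f j c \<otimes>\<^bsub>A\<^esub> g (e j)) \<gamma> c)"
          using left_formsD(1)[OF f c'] e ge True \<gamma> c
          by (intro A.finsum_cong') (auto simp: left_formsD(3)[OF g] homog_apply)
        finally show ?thesis using True \<gamma> c by (simp add: homog_apply)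
      next
        case False
        then show ?thesis using \<gamma> c by (simp add: homog_apply A.finsum_zero)
      qed
      finally show "(\<Oplus>\<^bsub>R\<^esub>j\<in>J. homog ?\<alpha> (\<lambda>c. f j c \<otimes>\<^bsub>A\<^esub> g (e j))) \<gamma> c = homog ?\<alpha> g \<gamma> c" .
    qed
    finally show ?thesis .
  qed
  then show ?thesis using P.T.finsum_closed[OF xe] by blast
qed

lemma KN_coact:
  assumes p: "p \<in> carrier G" and n: "n \<in> carrier N"
  shows "coact KN p n \<in> carrier (tensor_group A KN (\<C> p))"
    and "g \<in> left_forms A (\<C> p) \<Longrightarrow> contract KN g (coact KN p n) = n \<triangleleft>\<^bsub>N\<^esub> homog (inv\<^bsub>G\<^esub> p) g"
proof -
  let ?Q = "\<lambda>t. t \<in> carrier (tensor_group A KN (\<C> p)) \<and>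
    (\<forall>g \<in> left_forms A (\<C> p). contract KN g t = n \<triangleleft>\<^bsub>N\<^esub> homog (inv\<^bsub>G\<^esub> p) g)"
  have "coact KN p n = (THE t. ?Q t)"
    unfolding tensor_group_scalar_module[symmetric] contract_scalar_module[symmetric]
    by (simp add: comodule_of_module_def)
  moreover have "\<exists>!t. ?Q t"
  proof -
    obtain t where t: "?Q t" using coact_exists[OF p n] by blast
    moreover have "s = t" if "?Q s" for s
      using that t by (intro tensor_eq_by_forms[OF KN_pair[OF p] p]) auto
    ultimately show ?thesis by blast
  qed
  ultimately have "?Q (coact KN p n)" using theI'[of ?Q] by simp
  then show "coact KN p n \<in> carrier (tensor_group A KN (\<C> p))"
    "g \<in> left_forms A (\<C> p) \<Longrightarrow> contract KN g (coact KN p n) = n \<triangleleft>\<^bsub>N\<^esub> homog (inv\<^bsub>G\<^esub> p) g"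
    by blast+
qed

text \<open>Right linearity amounts to \<open>(n \<cdot> \<iota> a) \<cdot> f = n \<cdot> f(- a)\<close>, because contracting \<open>t a\<close> with \<open>f\<close> is the same as
contracting \<open>t\<close> with \<open>f(- a)\<close>.\<close>

lemma KN_coact_linear:
  assumes p: "p \<in> carrier G"
  shows "coact KN p \<in> right_linear A KN (tensor_rmodule A KN (\<C> p))"
proof -
  interpret P: tensor_pair A KN "\<C> p" by (rule KN_pair[OF p])
  have p': "inv\<^bsub>G\<^esub> p \<in> carrier G" "inv\<^bsub>G\<^esub> (inv\<^bsub>G\<^esub> p) = p" using p by auto
  note eqI = tensor_eq_by_forms[OF P.tensor_pair_axioms p]
  show ?thesis
  proof (rule right_linearI)
    fix m n assume "m \<in> carrier KN" "n \<in> carrier KN"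
    then have mn: "m \<in> carrier N" "n \<in> carrier N" by simp_all
    have "coact KN p (m \<oplus>\<^bsub>N\<^esub> n) = coact KN p m \<oplus>\<^bsub>P.T\<^esub> coact KN p n"
    proof (rule eqI)
      fix f assume f: "f \<in> left_forms A (\<C> p)"
      show "contract KN f (coact KN p (m \<oplus>\<^bsub>N\<^esub> n)) = contract KN f (coact KN p m \<oplus>\<^bsub>P.T\<^esub> coact KN p n)"
        using mn by (simp add: additive_add[OF P.contract_additive[OF f]] KN_coact[OF p] f
            N.ract_add homog_inv_closed[OF p f])
    qed (use mn in \<open>simp_all add: KN_coact[OF p]\<close>)
    then show "coact KN p (m \<oplus>\<^bsub>KN\<^esub> n) = coact KN p m \<oplus>\<^bsub>tensor_rmodule A KN (\<C> p)\<^esub> coact KN p n"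
      by simp
  next
    fix n a assume "n \<in> carrier KN" and a: "a \<in> carrier A"
    then have n: "n \<in> carrier N" by simp
    have na: "n \<triangleleft>\<^bsub>N\<^esub> \<iota> a \<in> carrier N" by (rule N.ract_closed[OF n \<iota>_closed[OF a]])
    have "coact KN p (n \<triangleleft>\<^bsub>N\<^esub> \<iota> a) = P.tensor_ract (coact KN p n) a"
    proof (rule eqI)
      fix f assume f: "f \<in> left_forms A (\<C> p)"
      note fa = P.form_ract[OF f a]
      \<comment> \<open>The product formula for homogeneous elements asks for extensional forms.\<close>
      have "\<iota> a \<otimes>\<^bsub>R\<^esub> homog (inv\<^bsub>G\<^esub> p) f =
          \<iota> a \<otimes>\<^bsub>R\<^esub> homog (inv\<^bsub>G\<^esub> p) (restrict f (carrier (\<C> (inv\<^bsub>G\<^esub> (inv\<^bsub>G\<^esub> p)))))"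
        by (simp only: homog_restrict)
      also have "\<dots> = homog (inv\<^bsub>G\<^esub> p)
          (\<lambda>c. restrict f (carrier (\<C> (inv\<^bsub>G\<^esub> (inv\<^bsub>G\<^esub> p)))) (c \<triangleleft>\<^bsub>\<C> (inv\<^bsub>G\<^esub> (inv\<^bsub>G\<^esub> p))\<^esub> a))"
        using p' f by (intro \<iota>_mult_homog H_restrict a) simp_all
      also have "\<dots> = homog (inv\<^bsub>G\<^esub> p) (\<lambda>c. f (c \<triangleleft>\<^bsub>\<C> p\<^esub> a))"
        using p' a by (intro homog_cong) (simp add: P.N.ract_closed)
      finally show "contract KN f (coact KN p (n \<triangleleft>\<^bsub>N\<^esub> \<iota> a)) =
          contract KN f (P.tensor_ract (coact KN p n) a)"
        using n na f fa p by (simp only: P.contract_ract[OF f a] KN_coact[OF p]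
            N.ract_assoc \<iota>_closed[OF a] homog_inv_closed)
    qed (use n na in \<open>simp_all add: KN_coact[OF p] additive_closed[OF P.tensor_ract_additive[OF a]]\<close>)
    then show "coact KN p (n \<triangleleft>\<^bsub>KN\<^esub> a) = coact KN p n \<triangleleft>\<^bsub>tensor_rmodule A KN (\<C> p)\<^esub> a"
      by simp
  qed (simp add: KN_coact[OF p])
qed

text \<open>The product of homogeneous elements for forms that are not required to be extensional.\<close>

lemma homog_inv_mult:
  assumes G: "p \<in> carrier G" "q \<in> carrier G"
    and f: "f \<in> left_forms A (\<C> p)" and g: "g \<in> left_forms A (\<C> q)"
  shows "homog (inv\<^bsub>G\<^esub> p) f \<otimes>\<^bsub>R\<^esub> homog (inv\<^bsub>G\<^esub> q) g = homog (inv\<^bsub>G\<^esub> (q \<otimes>\<^bsub>G\<^esub> p)) (conv q p f g)"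
proof -
  let ?f = "restrict f (carrier (\<C> p))" and ?g = "restrict g (carrier (\<C> q))"
  interpret P: bimodule_pair A "\<C> q" "\<C> p" using G by (intro component_pair)
  have fH: "?f \<in> H (inv\<^bsub>G\<^esub> p)" and gH: "?g \<in> H (inv\<^bsub>G\<^esub> q)"
    using H_restrict[of "inv\<^bsub>G\<^esub> p" f] H_restrict[of "inv\<^bsub>G\<^esub> q" g] G f g by simp_all
  have "conv q p ?f ?g = conv q p f g"
  proof
    fix c
    show "conv q p ?f ?g c = conv q p f g c"
    proof (cases "c \<in> carrier (\<C> (q \<otimes>\<^bsub>G\<^esub> p))")
      case True
      have t: "comult C q p c \<in> carrier P.T" using G True by (intro comult_closed)
      have "contract (\<C> q) ?f (comult C q p c) = contract (\<C> q) f (comult C q p c)"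
        by (rule P.contract_cong[OF f _ t, symmetric]) simp
      then show ?thesis using True P.contract_closed[OF f t] by (simp add: conv_apply)
    qed (simp add: conv_def)
  qed
  moreover have "homog (inv\<^bsub>G\<^esub> p) ?f \<otimes>\<^bsub>R\<^esub> homog (inv\<^bsub>G\<^esub> q) ?g =
      homog (inv\<^bsub>G\<^esub> (q \<otimes>\<^bsub>G\<^esub> p)) (conv q p ?f ?g)"
    using homog_mult[OF _ _ fH gH] G by (simp add: ldp_conv G.inv_mult_group)
  moreover have "homog (inv\<^bsub>G\<^esub> p) ?f = homog (inv\<^bsub>G\<^esub> p) f" "homog (inv\<^bsub>G\<^esub> q) ?g = homog (inv\<^bsub>G\<^esub> q) g"
    using homog_restrict[of "inv\<^bsub>G\<^esub> p" f] homog_restrict[of "inv\<^bsub>G\<^esub> q" g] G by simp_all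
  ultimately show ?thesis by simp
qed

text \<open>Both sides lie in \<open>N \<otimes> (C\<^sub>\<alpha> \<otimes> C\<^sub>\<beta>)\<close>, where the product dual basis separates elements. By
\<open>contract_comult\<close> and \<open>contract_iterated\<close> their contractions are \<open>n \<cdot> (f # g)\<close> and \<open>(n \<cdot> f) \<cdot> g\<close>.\<close>

lemma KN_coassociative:
  assumes \<alpha>: "\<alpha> \<in> carrier G" and \<beta>: "\<beta> \<in> carrier G" and n: "n \<in> carrier N"
  shows "tensor_map A KN (tensor_bimodule A (\<C> \<alpha>) (\<C> \<beta>)) (\<lambda>x. x) (comult C \<alpha> \<beta>)
      (coact KN (\<alpha> \<otimes>\<^bsub>G\<^esub> \<beta>) n) =
    tensor_assoc A KN (\<C> \<alpha>) (\<C> \<beta>) (tensor_map A (tensor_rmodule A KN (\<C> \<alpha>)) (\<C> \<beta>)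
      (coact KN \<alpha>) (\<lambda>x. x) (coact KN \<beta> n))"
proof -
  have \<alpha>\<beta>: "\<alpha> \<otimes>\<^bsub>G\<^esub> \<beta> \<in> carrier G" using \<alpha> \<beta> by simp
  interpret X: tensor_triple A KN "\<C> \<alpha>" "\<C> \<beta>"
    by (intro tensor_triple.intro component_pair KN_pair \<alpha> \<beta>)
  interpret Y: tensor_pair A KN "\<C> \<beta>" by (rule KN_pair[OF \<beta>])
  interpret Z: tensor_pair A KN "\<C> (\<alpha> \<otimes>\<^bsub>G\<^esub> \<beta>)" by (rule KN_pair[OF \<alpha>\<beta>])
  obtain I :: "'c set" and d \<phi> where c: "dual_basis A (\<C> \<alpha>) I d \<phi>"
    using left_homogeneously_finite_dual_basis[OF group_coring_axioms fin \<alpha>] .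
  obtain J :: "'c set" and e f where b: "dual_basis A (\<C> \<beta>) J e f"
    using left_homogeneously_finite_dual_basis[OF group_coring_axioms fin \<beta>] .
  note s = KN_coact(1)[OF \<alpha>\<beta> n] and t = KN_coact(1)[OF \<beta> n]
  show ?thesis
  proof (rule X.L_MN.tensor_eqI[OF X.MN.tensor_dual_basis[OF c b]])
    show "tensor_map A KN (tensor_bimodule A (\<C> \<alpha>) (\<C> \<beta>)) (\<lambda>x. x) (comult C \<alpha> \<beta>)
        (coact KN (\<alpha> \<otimes>\<^bsub>G\<^esub> \<beta>) n) \<in> carrier X.L_MN.T"
      by (rule additive_closed[OF tensor_map_additive[OF Z.tensor_pair_axioms
              X.L_MN.tensor_pair_axioms id_right_linear comult_left[OF \<alpha> \<beta>]] s])
    show "tensor_assoc A KN (\<C> \<alpha>) (\<C> \<beta>) (tensor_map A (tensor_rmodule A KN (\<C> \<alpha>)) (\<C> \<beta>)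
        (coact KN \<alpha>) (\<lambda>x. x) (coact KN \<beta> n)) \<in> carrier X.L_MN.T"
      by (rule additive_closed[OF X.assoc_additive additive_closed[OF tensor_map_additive[OF
                Y.tensor_pair_axioms X.LM_N.tensor_pair_axioms KN_coact_linear[OF \<alpha>] id_left_linear] t]])
    fix z assume "z \<in> J \<times> I"
    then have F: "f (fst z) \<in> left_forms A (\<C> \<beta>)" and \<Phi>: "\<phi> (snd z) \<in> left_forms A (\<C> \<alpha>)"
      using b c by (auto simp: dual_basis_def)
    let ?F = "f (fst z)" and ?\<Phi> = "\<phi> (snd z)"
    have nF: "n \<triangleleft>\<^bsub>N\<^esub> homog (inv\<^bsub>G\<^esub> \<beta>) ?F \<in> carrier N"
      by (rule N.ract_closed[OF n homog_inv_closed[OF \<beta> F]])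
    have "contract KN (conv \<alpha> \<beta> ?F ?\<Phi>) (coact KN (\<alpha> \<otimes>\<^bsub>G\<^esub> \<beta>) n) =
        n \<triangleleft>\<^bsub>N\<^esub> homog (inv\<^bsub>G\<^esub> (\<alpha> \<otimes>\<^bsub>G\<^esub> \<beta>)) (conv \<alpha> \<beta> ?F ?\<Phi>)"
      by (rule KN_coact(2)[OF \<alpha>\<beta> n conv_form[OF \<alpha> \<beta> F \<Phi>]])
    also have "\<dots> = (n \<triangleleft>\<^bsub>N\<^esub> homog (inv\<^bsub>G\<^esub> \<beta>) ?F) \<triangleleft>\<^bsub>N\<^esub> homog (inv\<^bsub>G\<^esub> \<alpha>) ?\<Phi>"
      by (simp only: homog_inv_mult[OF \<beta> \<alpha> F \<Phi>, symmetric]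
          N.ract_assoc[OF n homog_inv_closed[OF \<beta> F] homog_inv_closed[OF \<alpha> \<Phi>]])
    also have "\<dots> = contract KN ?\<Phi> (coact KN \<alpha> (contract KN ?F (coact KN \<beta> n)))"
      by (simp only: KN_coact(2)[OF \<beta> n F] KN_coact(2)[OF \<alpha> nF \<Phi>])
    finally show "contract KN (\<lambda>t. ?\<Phi> (contract (\<C> \<alpha>) ?F t))
        (tensor_map A KN (tensor_bimodule A (\<C> \<alpha>) (\<C> \<beta>)) (\<lambda>x. x) (comult C \<alpha> \<beta>)
          (coact KN (\<alpha> \<otimes>\<^bsub>G\<^esub> \<beta>) n)) =
      contract KN (\<lambda>t. ?\<Phi> (contract (\<C> \<alpha>) ?F t))
        (tensor_assoc A KN (\<C> \<alpha>) (\<C> \<beta>) (tensor_map A (tensor_rmodule A KN (\<C> \<alpha>)) (\<C> \<beta>)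
          (coact KN \<alpha>) (\<lambda>x. x) (coact KN \<beta> n)))"
      by (simp only: contract_comult[OF KN_right_module \<alpha> \<beta> F \<Phi> s]
          contract_iterated[OF KN_right_module KN_right_module \<alpha> \<beta> F \<Phi> KN_coact_linear[OF \<alpha>] t])
  qed
qed

lemma KN_comodule: "right_comodule G A C KN"
proof (intro right_comodule.intro right_comodule_axioms.intro group_coring_axioms KN_right_module
    KN_coact_linear)
  fix \<alpha> \<beta> n assume "\<alpha> \<in> carrier G" "\<beta> \<in> carrier G" "n \<in> carrier KN"
  then show "tensor_map A KN (tensor_bimodule A (\<C> \<alpha>) (\<C> \<beta>)) (\<lambda>x. x) (comult C \<alpha> \<beta>)
      (coact KN (\<alpha> \<otimes>\<^bsub>G\<^esub> \<beta>) n) =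
    tensor_assoc A KN (\<C> \<alpha>) (\<C> \<beta>) (tensor_map A (tensor_rmodule A KN (\<C> \<alpha>)) (\<C> \<beta>)
      (coact KN \<alpha>) (\<lambda>x. x) (coact KN \<beta> n))"
    by (intro KN_coassociative) simp_all
next
  fix n assume "n \<in> carrier KN"
  then have n: "n \<in> carrier N" by simp
  interpret P: tensor_pair A KN "\<C> \<one>\<^bsub>G\<^esub>" by (rule KN_pair) simp
  have "\<one>\<^bsub>R\<^esub> = homog (inv\<^bsub>G\<^esub> \<one>\<^bsub>G\<^esub>) \<epsilon>" by (simp add: left_dual_ring_def homog_def)
  then have "contract KN \<epsilon> (coact KN \<one>\<^bsub>G\<^esub> n) = n"
    using KN_coact(2)[OF G.one_closed n counit_form] N.ract_one[OF n] by simp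
  then show "tensor_runit KN (tensor_map A KN (regular_bimodule A) (\<lambda>x. x) \<epsilon> (coact KN \<one>\<^bsub>G\<^esub> n)) = n"
    using P.runit_tensor_map[OF counit_form KN_coact(1)[OF G.one_closed n]] by simp
qed

text \<open>For homogeneous scalars this is the characterisation of the coaction.\<close>

lemma F4_KN_ract:
  assumes f: "f \<in> carrier R" and n: "n \<in> carrier N"
  shows "n \<triangleleft>\<^bsub>F4_obj G A C KN\<^esub> f = n \<triangleleft>\<^bsub>N\<^esub> f"
proof -
  interpret KN: right_comodule G A C KN by (rule KN_comodule)
  show ?thesis using f
  proof (induction rule: R_induct)
    case zero
    then show ?case using KN.FM_ract_zero N.ract_zero[OF n] by simp
  next
    case (homog \<alpha> f)
    have p: "inv\<^bsub>G\<^esub> \<alpha> \<in> carrier G" using homog by simp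
    show ?case
      using KN.FM_ract_homog[OF homog, of n] KN_coact(2)[OF p n H_form[OF homog(2)]] n homog by simp
  next
    case (add f g)
    then show ?case using KN.FM_ract_add_scalar[of f g n] n by (simp add: N.ract_add_scalar)
  qed
qed

end

text \<open>An \<open>R\<close>-linear map is \<open>A\<close>-linear because \<open>A\<close> acts through \<open>\<iota>\<close>, and it commutes with the coactions because
both composites have the same contractions.\<close>

lemma comodule_hom_iff:
  assumes fin: "left_homogeneously_finite G A C"
    and "right_comodule G A C M" "right_comodule G A C N"
  shows "\<phi> \<in> Hom comodules M N \<longleftrightarrow> \<phi> \<in> Hom modules (F4_obj G A C M) (F4_obj G A C N)"
proof
  assume "\<phi> \<in> Hom comodules M N"
  then show "\<phi> \<in> Hom modules (F4_obj G A C M) (F4_obj G A C N)" by (rule F4_hom[OF assms(2,3)])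
next
  assume \<phi>: "\<phi> \<in> Hom modules (F4_obj G A C M) (F4_obj G A C N)"
  interpret M: right_comodule G A C M by fact
  interpret N: right_comodule G A C N by fact
  have lin: "\<phi> \<in> right_linear R M.FM N.FM" and ext: "\<phi> \<in> extensional (carrier M)"
    using \<phi> by (simp_all add: modules_simps)
  note D = right_linearD[OF lin, simplified]
  have A: "\<phi> \<in> right_linear A M N"
  proof (rule right_linearI)
    fix m a assume "m \<in> carrier M" "a \<in> carrier A"
    then show "\<phi> (m \<triangleleft>\<^bsub>M\<^esub> a) = \<phi> m \<triangleleft>\<^bsub>N\<^esub> a"
      using D(4)[of m "\<iota> a"] D(2)[of m] by (simp add: \<iota>_closed M.FM_ract_\<iota> N.FM_ract_\<iota>)
  qed (use D in auto)
  have "tensor_map A N (\<C> p) \<phi> (\<lambda>x. x) (coact M p m) = coact N p (\<phi> m)"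
    if p: "p \<in> carrier G" and m: "m \<in> carrier M" for p m
  proof -
    interpret MP: tensor_pair A M "\<C> p" by (rule M.M_pair[OF p])
    interpret NP: tensor_pair A N "\<C> p" by (rule N.M_pair[OF p])
    have p': "inv\<^bsub>G\<^esub> p \<in> carrier G" "inv\<^bsub>G\<^esub> (inv\<^bsub>G\<^esub> p) = p" using p by auto
    obtain J :: "'c set" and e f where b: "dual_basis A (\<C> p) J e f"
      using left_homogeneously_finite_dual_basis[OF group_coring_axioms fin p] .
    show ?thesis
    proof (rule NP.tensor_eqI[OF b])
      show "tensor_map A N (\<C> p) \<phi> (\<lambda>x. x) (coact M p m) \<in> carrier NP.T"
        by (rule additive_closed[OF tensor_map_additive[OF MP.tensor_pair_axioms
                NP.tensor_pair_axioms A id_left_linear] M.coact_closed[OF p m]])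
      show "coact N p (\<phi> m) \<in> carrier NP.T" by (rule N.coact_closed[OF p D(2)[OF m]])
      fix j assume "j \<in> J"
      then have f: "f j \<in> left_forms A (\<C> p)" using b by (auto simp: dual_basis_def)
      let ?f = "restrict (f j) (carrier (\<C> p))"
      have fH: "?f \<in> H (inv\<^bsub>G\<^esub> p)" using H_restrict[OF p'(1), of "f j"] f p' by simp
      note cM = MP.contract_cong[OF f, of ?f] and cN = NP.contract_cong[OF f, of ?f]
      have "\<phi> (contract M ?f (coact M p m)) = contract N ?f (coact N p (\<phi> m))"
        using D(4)[OF m homog_closed[OF p'(1) H_form[OF fH]]]
          M.FM_ract_homog[OF p'(1) fH m] N.FM_ract_homog[OF p'(1) fH D(2)[OF m]] p'(2) by simp
      moreover have "contract M ?f (coact M p m) = contract M (f j) (coact M p m)"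
        using cM[OF _ M.coact_closed[OF p m]] by simp
      moreover have "contract N ?f (coact N p (\<phi> m)) = contract N (f j) (coact N p (\<phi> m))"
        using cN[OF _ N.coact_closed[OF p D(2)[OF m]]] by simp
      ultimately show "contract N (f j) (tensor_map A N (\<C> p) \<phi> (\<lambda>x. x) (coact M p m)) =
          contract N (f j) (coact N p (\<phi> m))"
        using MP.contract_natural[OF N.right_module_axioms A f M.coact_closed[OF p m]] by simp
    qed
  qed
  with A ext show "\<phi> \<in> Hom comodules M N" by (simp add: comodules_simps)
qed

lemma identity_module_hom:
  assumes "right_module R X" "carrier Y = carrier X" "ring.add Y = ring.add X"
    and "\<And>m f. m \<in> carrier X \<Longrightarrow> f \<in> carrier R \<Longrightarrow> m \<triangleleft>\<^bsub>Y\<^esub> f = m \<triangleleft>\<^bsub>X\<^esub> f"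
  shows "(\<lambda>m\<in>carrier X. m) \<in> Hom modules X Y" "(\<lambda>m\<in>carrier X. m) \<in> Hom modules Y X"
proof -
  interpret X: right_module R X by fact
  show "(\<lambda>m\<in>carrier X. m) \<in> Hom modules X Y" "(\<lambda>m\<in>carrier X. m) \<in> Hom modules Y X"
    using assms(2-4) by (auto simp: modules_simps X.ract_closed intro!: right_linearI)
qed

lemma module_hom_cong:
  assumes "right_module R X" "right_module R Y"
    and "carrier X' = carrier X" "ring.add X' = ring.add X" "carrier Y' = carrier Y" "ring.add Y' = ring.add Y"
    and "\<And>m f. m \<in> carrier X \<Longrightarrow> f \<in> carrier R \<Longrightarrow> m \<triangleleft>\<^bsub>X'\<^esub> f = m \<triangleleft>\<^bsub>X\<^esub> f"
    and "\<And>m f. m \<in> carrier Y \<Longrightarrow> f \<in> carrier R \<Longrightarrow> m \<triangleleft>\<^bsub>Y'\<^esub> f = m \<triangleleft>\<^bsub>Y\<^esub> f"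
    and \<phi>: "\<phi> \<in> Hom modules X Y"
  shows "\<phi> \<in> Hom modules X' Y'"
proof -
  have lin: "\<phi> \<in> right_linear R X Y" "\<phi> \<in> extensional (carrier X)"
    using \<phi> by (simp_all add: modules_simps)
  show ?thesis
    using assms(3-8) right_linearD[OF lin(1)] lin(2)
    by (auto simp: modules_simps intro!: right_linearI)
qed

text \<open>The inverse functor also leaves maps unchanged. By \<open>comodule_hom_iff\<close> it suffices to see that identity
maps are \<open>R\<close>-linear, which holds since the two actions of \<open>R\<close> on the same set agree (\<open>F4_KN_ract\<close>).\<close>

theorem F4_equivalence:
  assumes fin: "left_homogeneously_finite G A C"
  shows "equivalence_of_categories (comodules :: (('g, 'a, 'c, 'm) comodule, 'm \<Rightarrow> 'm) cat) modules
    (F4 G A C)"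
proof -
  let ?C = "comodules :: (('g, 'a, 'c, 'm) comodule, 'm \<Rightarrow> 'm) cat"
  let ?D = "modules :: (('g \<Rightarrow> 'c \<Rightarrow> 'a, 'm) rmodule, 'm \<Rightarrow> 'm) cat"
  let ?F = "F4 G A C :: (('g, 'a, 'c, 'm) comodule, 'm \<Rightarrow> 'm, ('g \<Rightarrow> 'c \<Rightarrow> 'a, 'm) rmodule, 'm \<Rightarrow> 'm) fctr"
  let ?K = "F4_inverse G A C :: (('g \<Rightarrow> 'c \<Rightarrow> 'a, 'm) rmodule, 'm \<Rightarrow> 'm, ('g, 'a, 'c, 'm) comodule, 'm \<Rightarrow> 'm) fctr"
  note F = F4_def and K = F4_inverse_def
  have Kc: "right_comodule G A C (comodule_of_module G A C N)" if "right_module R N" for N :: "('g \<Rightarrow> 'c \<Rightarrow> 'a, 'm) rmodule"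
    by (rule KN_comodule[OF fin that])
  have Kr: "m \<triangleleft>\<^bsub>F4_obj G A C (comodule_of_module G A C N)\<^esub> f = m \<triangleleft>\<^bsub>N\<^esub> f"
    if "right_module R N" "m \<in> carrier N" "f \<in> carrier R" for N :: "('g \<Rightarrow> 'c \<Rightarrow> 'a, 'm) rmodule" and m f
    by (rule F4_KN_ract[OF fin that(1,3,2)])
  have Khom: "f \<in> Hom ?C (comodule_of_module G A C X) (comodule_of_module G A C Y)"
    if X: "right_module R X" and Y: "right_module R Y" and f: "f \<in> Hom ?D X Y" for X Y f
    unfolding comodule_hom_iff[OF fin Kc[OF X] Kc[OF Y]]
    by (rule module_hom_cong[OF X Y _ _ _ _ _ _ f]) (simp_all add: Kr X Y)
  have Kf: "functor_between ?D ?C ?K"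
    by (intro functor_between.intro functor_between_axioms.intro rmodule_category comodule_category)
       (use Kc Khom in \<open>simp_all add: K modules_simps(1,3,4) comodules_simps(1,3,4)\<close>)
  have id_iso: "compose (carrier X) (\<lambda>m\<in>carrier X. m) (\<lambda>m\<in>carrier X. m) = (\<lambda>m\<in>carrier X. m)"
    for X :: "('g \<Rightarrow> 'c \<Rightarrow> 'a, 'm) rmodule"
    by (auto simp: compose_def restrict_def fun_eq_iff)
  have natural: "compose (carrier X) (\<lambda>m\<in>carrier Y. m) f = compose (carrier X) f (\<lambda>m\<in>carrier X. m)"
    if "f \<in> Hom ?D X Y" for X Y f
    using that right_linearD(2)[of f R X Y]
    by (auto simp: modules_simps compose_def restrict_def fun_eq_iff)
  have 1: "naturally_isomorphic ?C ?C id_functor (comp_functor ?K ?F)"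
    unfolding naturally_isomorphic_def
  proof (intro exI[of _ "\<lambda>X. \<lambda>m\<in>carrier X. m"] conjI ballI)
    fix X assume "X \<in> Obj ?C"
    then have X: "right_comodule G A C X" by (simp add: comodules_simps)
    let ?Y = "comodule_of_module G A C (F4_obj G A C X)"
    note FX = right_comodule.FM_module[OF X]
    have "(\<lambda>m\<in>carrier X. m) \<in> Hom ?C X ?Y" "(\<lambda>m\<in>carrier X. m) \<in> Hom ?C ?Y X"
      unfolding comodule_hom_iff[OF fin X Kc[OF FX]] comodule_hom_iff[OF fin Kc[OF FX] X]
      using identity_module_hom[OF FX, of "F4_obj G A C ?Y"] Kr[OF FX] by simp_all
    then show "iso_arr ?C (obj_map id_functor X) (obj_map (comp_functor ?K ?F) X) (\<lambda>m\<in>carrier X. m)"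
      using id_iso[of "F4_obj G A C X"]
      by (auto simp: iso_arr_def id_functor_def comp_functor_def F K comodules_simps(3,4))
  next
    fix X Y f assume "X \<in> Obj ?C" "Y \<in> Obj ?C" and f: "f \<in> Hom ?C X Y"
    then have "right_comodule G A C X" "right_comodule G A C Y" by (simp_all add: comodules_simps)
    from natural[OF F4_hom[OF this f]]
    show "Comp ?C (obj_map id_functor X) (obj_map id_functor Y) (obj_map (comp_functor ?K ?F) Y)
        (\<lambda>m\<in>carrier Y. m) (arr_map id_functor X Y f) =
      Comp ?C (obj_map id_functor X) (obj_map (comp_functor ?K ?F) X) (obj_map (comp_functor ?K ?F) Y)
        (arr_map (comp_functor ?K ?F) X Y f) (\<lambda>m\<in>carrier X. m)"
      by (simp add: id_functor_def comp_functor_def F K comodules_simps(4))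
  qed
  have 2: "naturally_isomorphic ?D ?D (comp_functor ?F ?K) id_functor"
    unfolding naturally_isomorphic_def
  proof (intro exI[of _ "\<lambda>X. \<lambda>m\<in>carrier X. m"] conjI ballI)
    fix X assume "X \<in> Obj ?D"
    then have X: "right_module R X" by (simp add: modules_simps)
    have "(\<lambda>m\<in>carrier X. m) \<in> Hom ?D X (F4_obj G A C (comodule_of_module G A C X))"
      "(\<lambda>m\<in>carrier X. m) \<in> Hom ?D (F4_obj G A C (comodule_of_module G A C X)) X"
      using identity_module_hom[OF X, of "F4_obj G A C (comodule_of_module G A C X)"] Kr[OF X] by simp_all
    then show "iso_arr ?D (obj_map (comp_functor ?F ?K) X) (obj_map id_functor X) (\<lambda>m\<in>carrier X. m)"
      using id_iso[of X]
      by (auto simp: iso_arr_def id_functor_def comp_functor_def F K modules_simps(3,4))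
  next
    fix X Y f assume "X \<in> Obj ?D" "Y \<in> Obj ?D" and f: "f \<in> Hom ?D X Y"
    from natural[OF f]
    show "Comp ?D (obj_map (comp_functor ?F ?K) X) (obj_map (comp_functor ?F ?K) Y) (obj_map id_functor Y)
        (\<lambda>m\<in>carrier Y. m) (arr_map (comp_functor ?F ?K) X Y f) =
      Comp ?D (obj_map (comp_functor ?F ?K) X) (obj_map id_functor X) (obj_map id_functor Y)
        (arr_map id_functor X Y f) (\<lambda>m\<in>carrier X. m)"
      by (simp add: id_functor_def comp_functor_def F K modules_simps(4))
  qed
  show ?thesis
    unfolding equivalence_of_categories_def using F4_functor Kf 1 2 by blast
qed

end

theorem proposition4p4:
  fixes G :: "('g, 'x) monoid_scheme" and A :: "('a, 'y) ring_scheme"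
    and C :: "('g, 'a, 'c) coring"
  assumes "group_coring G A C"
  shows "functor_between
      (comodule_cat G A C :: (('g, 'a, 'c, 'm) comodule, 'm \<Rightarrow> 'm) cat)
      (rmodule_cat (left_dual_ring G A C)) (F4 G A C) \<and>
    (left_homogeneously_finite G A C \<and> finite (carrier G) \<longrightarrow>
      equivalence_of_categories
        (comodule_cat G A C :: (('g, 'a, 'c, 'm) comodule, 'm \<Rightarrow> 'm) cat)
        (rmodule_cat (left_dual_ring G A C)) (F4 G A C))"
  using group_coring.F4_functor[OF assms] group_coring.F4_equivalence[OF assms] by blast

end
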